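(* Let $h$ be a transcendental meromorphic function on $\mathbb{C}$ with at least one pole and with order $\rho(h)\notin\mathbb{N}\cup\{\infty\}$, where $\mathbb{N}$ is the set of positive integers. Let $L_1$ and $L_2$ be two $L$-functions (elements of the extended Selberg class $\mathcal{S}^{\sharp}$) with positive degree. If $L_1-h$ and $L_2-h$ have the same zeros counting multiplicities, then $L_1\equiv L_2$.
   Context: An $L$-function means an element of the extended Selberg class $\mathcal{S}^{\sharp}$, i.e. a Dirichlet series $L(s)=\sum_{n=1}^{\infty}\frac{a(n)}{n^s}$ with $a(1)=1$, identified with its meromorphic continuation to $\mathbb{C}$, satisfying: (i) Ramanujan hypothesis: $a(n)\ll n^{\varepsilon}$ for every $\varepsilon>0$; (ii) Analytic continuation: there is a non-negative integer $k$ such that $(s-1)^kL(s)$ is an entire function of finite order; (iii) Functional equation: $\Lambda_L(s)=\omega\overline{\Lambda_L(1-\overline{s})}$, where $\Lambda_L(s)=L(s)Q^s\prod_{j=1}^{K}\Gamma(\lambda_js+\mu_j)$ with constants $Q>0$, $\lambda_j>0$, $\mathrm{Re}\,\mu_j\ge 0$, $|\omega|=1$. No Euler product is assumed. The degree of $L$ is $d_L=2\sum_{j=1}^{K}\lambda_j$, where $K$ and $\lambda_j$ are the numbers in (iii). For a meromorphic function $f$ on $\mathbb{C}$, let $m(r,f)=\frac{1}{2\pi}\int_0^{2\pi}\log^+|f(re^{i\theta})|\,d\theta$, $N(r,f)=\int_0^r\frac{n(t,f)-n(0,f)}{t}\,dt+n(0,f)\log r$, where $\log^+x=\max\{\log x,0\}$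 and $n(t,f)$ is the number of poles of $f$ in $|z|\le t$ counting multiplicity, and $T(r,f)=m(r,f)+N(r,f)$. The order of $f$ is $\rho(f)=\limsup_{r\to\infty}\frac{\log^+T(r,f)}{\log r}\in[0,\infty]$. A meromorphic function on $\mathbb{C}$ is transcendental if it is not rational. "Same zeros counting multiplicities" means that a point of $\mathbb{C}$ is a zero of multiplicity $m$ of one function if and only if it is a zero of multiplicity $m$ of the other. *)

theory Defs
  imports
    "HOL-Complex_Analysis.Complex_Analysis"
    "HOL-Library.Landau_Symbols"
begin

section \<open>Nevanlinna characteristic and order\<close>

definition log_plus :: "real \<Rightarrow> real" where
  "log_plus x = (if x > 0 then max (ln x) 0 else 0)"

text \<open>
  All notions in this section depend only on the values of \<open>f\<close> off a sparse set, so the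
  (arbitrary) value of \<open>f\<close> at its poles is irrelevant.
\<close>

definition nev_m :: "real \<Rightarrow> (complex \<Rightarrow> complex) \<Rightarrow> real" where
  "nev_m r f = 1 / (2 * pi) *
     integral {0..2 * pi} (\<lambda>\<theta>. log_plus (norm (f (of_real r * exp (\<i> * of_real \<theta>)))))"

definition nev_n :: "real \<Rightarrow> (complex \<Rightarrow> complex) \<Rightarrow> nat" where
  "nev_n t f = (\<Sum>z | norm z \<le> t \<and> is_pole f z. nat (- zorder f z))"

definition nev_N :: "real \<Rightarrow> (complex \<Rightarrow> complex) \<Rightarrow> real" where
  "nev_N r f = integral {0..r} (\<lambda>t. (real (nev_n t f) - real (nev_n 0 f)) / t)
     + real (nev_n 0 f) * ln r"

definition nev_T :: "real \<Rightarrow> (complex \<Rightarrow> complex) \<Rightarrow> real" where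
  "nev_T r f = nev_m r f + nev_N r f"

definition nev_order :: "(complex \<Rightarrow> complex) \<Rightarrow> ereal" where
  "nev_order f = Limsup at_top (\<lambda>r. ereal (log_plus (nev_T r f) / ln r))"

section \<open>Meromorphic functions on the plane\<close>

definition rational_function :: "(complex \<Rightarrow> complex) \<Rightarrow> bool" where
  "rational_function f \<longleftrightarrow>
     (\<exists>p q :: complex poly. q \<noteq> 0 \<and> (\<forall>\<^sub>\<approx>z. f z = poly p z / poly q z))"

definition transcendental_meromorphic :: "(complex \<Rightarrow> complex) \<Rightarrow> bool" where
  "transcendental_meromorphic f \<longleftrightarrow> f meromorphic_on UNIV \<and> \<not> rational_function f"

text \<open>
  Both \<^const>\<open>isolated_zero\<close> and \<^const>\<open>zorder\<close> look only at punctured neighbourhoods, so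
  removable singularities (such as cancelling poles in a difference) are filled in.
\<close>

definition zero_of_multiplicity :: "(complex \<Rightarrow> complex) \<Rightarrow> complex \<Rightarrow> nat \<Rightarrow> bool" where
  "zero_of_multiplicity f z m \<longleftrightarrow> isolated_zero f z \<and> zorder f z = int m"

definition same_zeros_CM :: "(complex \<Rightarrow> complex) \<Rightarrow> (complex \<Rightarrow> complex) \<Rightarrow> bool" where
  "same_zeros_CM f g \<longleftrightarrow> (\<forall>z m. zero_of_multiplicity f z m \<longleftrightarrow> zero_of_multiplicity g z m)"

section \<open>The extended Selberg class\<close>

definition completed_L ::
  "(complex \<Rightarrow> complex) \<Rightarrow> real \<Rightarrow> nat \<Rightarrow> (nat \<Rightarrow> real) \<Rightarrow> (nat \<Rightarrow> complex) \<Rightarrow> complex \<Rightarrow> complex"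
where
  "completed_L L Q K lam mu s =
     L s * of_real Q powr s * (\<Prod>j=1..K. Gamma (of_real (lam j) * s + mu j))"

text \<open>
  The functional equation is an identity of meromorphic functions, hence imposed off a sparse
  set: the library assigns the value \<open>0\<close> to \<open>Gamma\<close> at its poles, so the pointwise
  equation could fail at points where such a pole cancels a zero of \<open>L\<close>.
\<close>

definition selberg_functional_equation ::
  "(complex \<Rightarrow> complex) \<Rightarrow> real \<Rightarrow> complex \<Rightarrow> nat \<Rightarrow> (nat \<Rightarrow> real) \<Rightarrow> (nat \<Rightarrow> complex) \<Rightarrow> bool"
where
  "selberg_functional_equation L Q \<omega> K lam mu \<longleftrightarrow>
     Q > 0 \<and> norm \<omega> = 1 \<and> (\<forall>j\<in>{1..K}. lam j > 0 \<and> Re (mu j) \<ge> 0) \<and>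
     (\<forall>\<^sub>\<approx>s. completed_L L Q K lam mu s = \<omega> * cnj (completed_L L Q K lam mu (1 - cnj s)))"

definition ramanujan_hypothesis :: "(nat \<Rightarrow> complex) \<Rightarrow> bool" where
  "ramanujan_hypothesis a \<longleftrightarrow> (\<forall>\<epsilon>>0. (\<lambda>n. norm (a n)) \<in> O(\<lambda>n. real n powr \<epsilon>))"

text \<open>
  \<open>L\<close> is the meromorphic continuation itself, normalised by \<^const>\<open>nicely_meromorphic_on\<close>
  (continuous off its poles, value \<open>0\<close> at a pole), so that equality of \<open>L\<close>-functions is
  equality of functions. Under the Ramanujan hypothesis the Dirichlet series converges
  absolutely for \<open>Re s > 1\<close>. The entire function \<open>F\<close> is \<open>(s - 1)^k * L s\<close> with its
  singularity at \<open>1\<close> removed.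
\<close>

definition extended_selberg_class :: "(complex \<Rightarrow> complex) set" where
  "extended_selberg_class = {L.
     L nicely_meromorphic_on UNIV \<and>
     (\<exists>a :: nat \<Rightarrow> complex. a 1 = 1 \<and> ramanujan_hypothesis a \<and>
        (\<forall>s. Re s > 1 \<longrightarrow> (\<lambda>n. a (Suc n) / of_nat (Suc n) powr s) sums L s)) \<and>
     (\<exists>(k::nat) F. F holomorphic_on UNIV \<and> nev_order F < \<infinity> \<and>
        (\<forall>s. s \<noteq> 1 \<longrightarrow> F s = (s - 1) ^ k * L s)) \<and>
     (\<exists>Q \<omega> K lam mu. selberg_functional_equation L Q \<omega> K lam mu)}"

text \<open>
  The data of the functional equation is not unique, so the degree is introduced as a relation:
  \<open>d\<close> is the degree computed from some admissible data. (It is a classical fact that all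
  admissible data give the same \<open>d\<close>.)
\<close>

definition has_degree :: "(complex \<Rightarrow> complex) \<Rightarrow> real \<Rightarrow> bool" where
  "has_degree L d \<longleftrightarrow>
     (\<exists>Q \<omega> K lam mu. selberg_functional_equation L Q \<omega> K lam mu \<and> d = 2 * (\<Sum>j=1..K. lam j))"

end

theory Submission
  imports Defs
begin

text \<open>
  Suppose \<open>L1 \<noteq> L2\<close>. Unless \<open>h\<close> is one of the \<open>L\<close>-functions, the quotient
  \<open>F = (L1 - h) / (L2 - h)\<close> has zeros and poles at most at \<open>1\<close>, hence
  \<open>F = (z - 1)\<^sup>m exp g\<close> with \<open>g\<close> entire. An \<open>L\<close>-function satisfies
  \<open>T(r, L) = O(r powr \<beta>)\<close> for every \<open>\<beta> > 1\<close>, by the functional equation off a vertical strip and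
  a Phragmen-Lindelof argument inside it. So \<open>T(r, exp g)\<close> is controlled by \<open>T(r, h)\<close>, and the
  coefficient estimate for \<open>Re g\<close> makes \<open>g\<close> a polynomial of degree at most
  \<open>max \<lfloor>\<rho>\<rfloor> 1\<close>, where \<open>\<rho>\<close> is the order of \<open>h\<close>. As \<open>h = (L1 - F L2) / (1 - F)\<close>,
  this gives \<open>\<rho> \<le> \<lfloor>\<rho>\<rfloor>\<close> if \<open>\<rho> > 1\<close>, which is impossible for non-integral \<open>\<rho>\<close>.
  If \<open>\<rho> < 1\<close>, then \<open>g\<close> is linear, and in some sector around the positive real axis
  \<open>h - 1 = ((L1 - 1) - F (L2 - 1)) / (1 - F)\<close> decays like \<open>2\<close> to the power \<open>- Re z\<close>, because both
  Dirichlet series start with \<open>1\<close> and \<open>F\<close> stays away from \<open>1\<close> there. Jensen's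
  formula then yields \<open>T(r, h) \<ge> c r\<close>, a contradiction.
\<close>

section \<open>Integrals over circles\<close>

text \<open>Growth alone settles only orders above 1. The L-functions are only known to satisfy a
  bound with an exponent above 1, so for \<rho> < 1 the function g may be linear and comparing
  characteristics yields nothing. The common leading coefficient a(1) = 1 has to be used instead,
  which is why h - 1 and not h is estimated. The same sector argument excludes that h is an
  L-function, since its order would be at most 1, hence below 1. Order 0 falls under \<rho> < 1.

  The point 1 is exceptional because the L-functions may have poles of different orders there;
  elsewhere a pole of h passes to both differences with the same order and cancels in the quotient.

  Exponents \<beta> > 1 stand in for the sharper r log r: the strict inequalities between \<rho>,
  its integer part and 1 leave room for them, and a crude bound for Gamma can then replace
  Stirling's formula. Finite order is a statement about T, whereas Phragmen-Lindelof needs pointwise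
  bounds; a Poisson-Jensen inequality converts the one into the other.\<close>

lemma has_integral_circle_Poisson:
  assumes hol: "f holomorphic_on ball 0 R" and r: "norm z < r" "r < R"
  shows "((\<lambda>t. f (of_real r * cis t) * of_real ((r\<^sup>2 - (norm z)\<^sup>2) / (norm (of_real r * cis t - z))\<^sup>2))
           has_integral 2 * of_real pi * f z) {0..2 * pi}"
proof -
  \<comment> \<open>The extra factor equals 1 at \<open>z\<close>, and on the circle
    \<open>of_real (r\<^sup>2) - cnj z * u\<close> is \<open>u * cnj (u - z)\<close>. Cauchy's
    formula for \<open>h\<close> therefore carries the Poisson kernel.\<close>
  define h where "h = (\<lambda>u. f u * of_real (r\<^sup>2 - (norm z)\<^sup>2) / (of_real (r\<^sup>2) - cnj z * u))"
  have r0: "r > 0" using r norm_ge_zero[of z] by linarith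
  have ne: "of_real (r\<^sup>2) - cnj z * u \<noteq> 0" if "u \<in> cball 0 r" for u
  proof
    assume "of_real (r\<^sup>2) - cnj z * u = 0"
    hence "norm (cnj z * u) = norm (of_real (r\<^sup>2) :: complex)" by simp
    hence "norm z * norm u = r\<^sup>2" by (simp add: norm_mult norm_power)
    moreover have "norm z * norm u < r * r"
      by (rule le_less_trans[OF mult_left_mono mult_strict_right_mono]) (use that r r0 in auto)
    ultimately show False by (simp add: power2_eq_square)
  qed
  have "h holomorphic_on cball 0 r"
    unfolding h_def using ne r by (intro holomorphic_intros holomorphic_on_subset[OF hol]) auto
  hence "((\<lambda>u. h u/(u-z)) has_contour_integral (2 * of_real pi * \<i> * h z)) (circlepath 0 r)"
    by (rule Cauchy_integral_circlepath_simple) (use r in auto)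
  moreover have "h z = f z"
  proof -
    have "cnj z * z = of_real ((norm z)\<^sup>2)"
      using complex_norm_square[of z] by (simp add: mult.commute)
    thus ?thesis using ne[of z] r unfolding h_def by (simp add: of_real_diff)
  qed
  ultimately have "((\<lambda>t. h (0 + r * cis t) / (0 + r * cis t - z) * r * \<i> * cis t) has_integral (2 * of_real pi * \<i> * f z)) {0..2*pi}"
    unfolding circlepath_def by (subst (asm) has_contour_integral_part_circlepath_iff) auto
  hence "((\<lambda>t. (h (0 + r * cis t) / (0 + r * cis t - z) * r * \<i> * cis t) * (-\<i>)) has_integral (2 * of_real pi * \<i> * f z) * (-\<i>)) {0..2*pi}"
    by (rule has_integral_mult_left)
  moreover have "(h (0 + r * cis t) / (0 + r * cis t - z) * r * \<i> * cis t) * (-\<i>) =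
      f (of_real r * cis t) * of_real ((r\<^sup>2 - (norm z)\<^sup>2) / (norm (of_real r * cis t - z))\<^sup>2)" for t
  proof -
    define u where "u = of_real r * cis t"
    have nu: "norm u = r" using r0 by (simp add: u_def norm_mult)
    hence uu: "u * cnj u = of_real (r\<^sup>2)" using complex_norm_square[of u] by simp
    have u0: "u \<noteq> 0" using nu r0 by auto
    have uz: "u - z \<noteq> 0" using nu r by auto
    have a: "of_real (r\<^sup>2) - cnj z * u = u * cnj (u - z)" using uu by (simp add: algebra_simps)
    have b: "(of_real ((norm (u - z))\<^sup>2) :: complex) = (u - z) * cnj (u - z)"
      by (rule complex_norm_square)
    have w0: "cnj (u - z) \<noteq> 0" using uz by (metis complex_cnj_zero_iff)
    have alg: "fu * c / (u * w) / v * r * \<i> * ct * (-\<i>) = fu * (c / (v * w))"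
      if "u = of_real r * ct" "v \<noteq> 0" "w \<noteq> 0" for fu c v w ct
      using that u0 by (simp add: field_simps)
    show ?thesis
      unfolding u_def[symmetric] add_0 h_def a of_real_divide b
      by (rule alg) (use uz w0 in \<open>auto simp: u_def\<close>)
  qed
  ultimately show ?thesis by (simp add: algebra_simps)
qed

lemma has_integral_circle_mean:
  assumes "f holomorphic_on ball 0 R" "0 < r" "r < R"
  shows "((\<lambda>t. f (of_real r * cis t)) has_integral 2 * of_real pi * f 0) {0..2 * pi}"
  using has_integral_circle_Poisson[of f R 0 r] assms by (simp add: norm_mult)

lemma has_integral_circle_coeff:
  assumes "f holomorphic_on ball 0 R" "0 < r" "r < R"
  shows "((\<lambda>t. f (of_real r * cis t) * cis (- (real n * t)))
           has_integral 2 * of_real pi * ((deriv ^^ n) f 0 / fact n * of_real r ^ n)) {0..2 * pi}"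
proof -
  have "f holomorphic_on cball 0 r" by (rule holomorphic_on_subset[OF assms(1)]) (use assms in auto)
  hence "((\<lambda>u. f u / (u - 0) ^ Suc n) has_contour_integral ((2 * pi * \<i>) / fact n * (deriv ^^ n) f 0)) (circlepath 0 r)"
    using assms by (intro Cauchy_has_contour_integral_higher_derivative_circlepath holomorphic_on_imp_continuous_on)
      (auto intro: holomorphic_on_subset)
  hence "((\<lambda>t. f (0 + r * cis t) / (0 + r * cis t - 0) ^ Suc n * r * \<i> * cis t) has_integral ((2 * pi * \<i>) / fact n * (deriv ^^ n) f 0)) {0..2*pi}"
    unfolding circlepath_def by (subst (asm) has_contour_integral_part_circlepath_iff) auto
  hence "((\<lambda>t. (f (0 + r * cis t) / (0 + r * cis t - 0) ^ Suc n * r * \<i> * cis t) * (-\<i> * r ^ n)) has_integral ((2 * pi * \<i>) / fact n * (deriv ^^ n) f 0) * (-\<i> * r ^ n)) {0..2*pi}"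
    by (rule has_integral_mult_left)
  moreover have "(f (0 + r * cis t) / (0 + r * cis t - 0) ^ Suc n * r * \<i> * cis t) * (-\<i> * r ^ n) =
     f (of_real r * cis t) * cis (- (real n * t))" for t
  proof -
    have "cis (- (real n * t)) = inverse (cis t ^ n)"
      unfolding cis_inverse[symmetric] Complex.DeMoivre by simp
    thus ?thesis using assms by (simp add: field_simps)
  qed
  ultimately show ?thesis by (simp add: algebra_simps)
qed

text \<open>The conjugate part of \<open>Re f = (f + cnj f) / 2\<close> has vanishing \<open>n\<close>-th Fourier coefficient.\<close>
lemma has_integral_circle_Re_coeff:
  assumes "f holomorphic_on ball 0 R" "0 < r" "r < R" "n > 0"
  shows "((\<lambda>t. of_real (Re (f (of_real r * cis t))) * cis (- (real n * t)))
           has_integral of_real pi * ((deriv ^^ n) f 0 / fact n * of_real r ^ n)) {0..2 * pi}"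
proof -
  have "((\<lambda>t. (\<lambda>z. f z * z ^ n) (of_real r * cis t)) has_integral 2 * of_real pi * (\<lambda>z. f z * z ^ n) 0) {0..2 * pi}"
    using assms by (intro has_integral_circle_mean[of _ R] holomorphic_intros) auto
  from has_integral_linear[OF this bounded_linear_cnj]
  have "((\<lambda>t. cnj (f (of_real r * cis t) * (of_real r * cis t) ^ n)) has_integral 0) {0..2 * pi}"
    using assms by (simp add: power_0_left o_def)
  from has_integral_divide[OF this, of "of_real r ^ n"]
  have "((\<lambda>t. cnj (f (of_real r * cis t) * (of_real r * cis t) ^ n) / of_real r ^ n) has_integral 0) {0..2 * pi}"
    by simp
  from has_integral_divide[OF has_integral_add[OF has_integral_circle_coeff[OF assms(1-3), of n] this], of 2]
  have *: "((\<lambda>t. (f (of_real r * cis t) * cis (- (real n * t)) + cnj (f (of_real r * cis t) * (of_real r * cis t) ^ n) / of_real r ^ n) / 2)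
     has_integral of_real pi * ((deriv ^^ n) f 0 / fact n * of_real r ^ n)) {0..2 * pi}" by simp
  have "(f (of_real r * cis t) * cis (- (real n * t)) + cnj (f (of_real r * cis t) * (of_real r * cis t) ^ n) / of_real r ^ n) / 2
      = of_real (Re (f (of_real r * cis t))) * cis (- (real n * t))" for t
  proof -
    have e: "cnj (cis t) ^ n = cis (- (real n * t))"
      by (simp add: cis_cnj Complex.DeMoivre)
    have "w + cnj w = 2 * of_real (Re w)" for w
      by (simp add: complex_add_cnj)
    thus ?thesis using assms e
      by (simp add: power_mult_distrib field_simps flip: distrib_left)
  qed
  with * show ?thesis by simp
qed

text \<open>Meromorphic identities hold off a sparse set; on a circle the exceptional parameters are
  then finite, hence negligible for integrals. The endpoint \<open>2*pi\<close> is treated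
  separately because \<open>Arg2pi\<close> only takes values below it.\<close>

lemma finite_circle_preimage:
  assumes "S sparse_in UNIV" "r > 0"
  shows "finite {t\<in>{0..2*pi}. of_real r * cis t \<in> S}"
proof (rule finite_subset)
  have "finite (cball 0 r \<inter> S)"
    using assms sparse_in_compact_finite sparse_in_subset by (metis Int_commute compact_cball subset_UNIV)
  thus "finite (insert (2*pi) (Arg2pi ` (cball 0 r \<inter> S)))" by simp
  show "{t\<in>{0..2*pi}. of_real r * cis t \<in> S} \<subseteq> insert (2*pi) (Arg2pi ` (cball 0 r \<inter> S))"
  proof safe
    fix t assume t: "t \<in> {0..2*pi}" "of_real r * cis t \<in> S" "t \<notin> Arg2pi ` (cball 0 r \<inter> S)"
    have "t = Arg2pi (of_real r * cis t)" if "t < 2 * pi"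
      using Arg2pi_unique[of r t "of_real r * cis t"] t that assms by (simp add: cis_conv_exp)
    moreover have "of_real r * cis t \<in> cball 0 r \<inter> S" using t assms by (simp add: norm_mult)
    ultimately show "t = 2 * pi" using t by force
  qed
qed

text \<open>For \<open>a\<close> outside the circle the integrand is, up to a constant, the real
  part of a logarithm that is holomorphic on a larger disc, and the mean value property applies.
  Reflection in the circle reduces \<open>a\<close> inside to this case, and \<open>a\<close> on the
  circle is reached as a limit from outside.\<close>

lemma has_integral_ln_circle_dist:
  assumes r: "r > 0"
  shows "((\<lambda>t. ln (norm (of_real r * cis t - a))) has_integral 2 * pi * ln (max r (norm a))) {0..2 * pi}"
proof -
  have gt: "((\<lambda>t. ln (norm (of_real r * cis t - a))) has_integral 2 * pi * ln (norm a)) {0..2 * pi}"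
    if a: "norm a > r" for a
  proof -
    have a0: "a \<noteq> 0" using a r by auto
    have pos: "0 < Re (1 - z / a)" if "z \<in> ball 0 (norm a)" for z
    proof -
      have "Re (z / a) \<le> norm (z / a)" by (rule complex_Re_le_cmod)
      also have "\<dots> < 1" using that a0 by (simp add: norm_divide)
      finally show ?thesis by simp
    qed
    have "((\<lambda>t. Ln (1 - (of_real r * cis t) / a)) has_integral 2 * of_real pi * Ln (1 - 0 / a)) {0..2 * pi}"
    proof (rule has_integral_circle_mean[OF _ r a])
      show "(\<lambda>z. Ln (1 - z / a)) holomorphic_on ball 0 (norm a)"
      proof (intro holomorphic_intros)
        fix z :: complex assume "z \<in> ball 0 (norm a)"
        from pos[OF this] show "1 - z / a \<notin> \<real>\<^sub>\<le>\<^sub>0" by (meson complex_nonpos_Reals_iff not_less)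
      qed (use a0 in auto)
    qed
    from has_integral_linear[OF this bounded_linear_Re]
    have "((\<lambda>t. Re (Ln (1 - (of_real r * cis t) / a))) has_integral 0) {0..2 * pi}"
      by (simp add: o_def)
    from has_integral_add[OF has_integral_const_real[of "ln (norm a)"] this]
    have "((\<lambda>t. ln (norm a) + Re (Ln (1 - (of_real r * cis t) / a))) has_integral 2 * pi * ln (norm a)) {0..2 * pi}"
      by simp
    moreover have "ln (norm a) + Re (Ln (1 - (of_real r * cis t) / a)) = ln (norm (of_real r * cis t - a))" for t
    proof -
      have "of_real r * cis t \<in> ball 0 (norm a)" using a r by (simp add: norm_mult)
      from pos[OF this] have ne: "1 - (of_real r * cis t) / a \<noteq> 0" by auto
      have "norm (of_real r * cis t - a) = norm a * norm (1 - (of_real r * cis t) / a)"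
        unfolding norm_mult[symmetric] using a0 by (simp add: algebra_simps norm_minus_commute)
      thus ?thesis using ne a0 by (simp add: Re_Ln ln_mult)
    qed
    ultimately show ?thesis by simp
  qed
  consider "norm a > r" | "norm a < r" | "norm a = r" by linarith
  thus ?thesis
  proof cases
    case 1
    thus ?thesis using gt[of a] by simp
  next
    case 2
    show ?thesis
    proof (cases "a = 0")
      case True
      thus ?thesis using r has_integral_const_real[of "ln r" 0 "2*pi"] by (simp add: norm_mult)
    next
      case False
      \<comment> \<open>The reflection of \<open>a\<close> in the circle: from every point of the
        circle, the distances to \<open>a\<close> and \<open>b\<close> have the constant ratio
        \<open>norm a / r\<close>.\<close>
      define b where "b = of_real (r\<^sup>2) / cnj a"
      have "r * norm a < r * r" using 2 r by simp
      moreover have "norm b = r * r / norm a" by (simp add: b_def norm_divide norm_power flip: power2_eq_square)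
      ultimately have b: "norm b > r" using False r by (simp add: less_divide_eq)
      have eq: "norm (of_real r * cis t - a) = (norm a / r) * norm (of_real r * cis t - b)" for t
      proof -
        have "of_real r * cis t - b = - (of_real r * cis t / cnj a) * cnj (of_real r * cis t - a)"
          using False by (simp add: b_def field_simps power2_eq_square cis_cnj cis_mult)
        hence "norm (of_real r * cis t - b) = (r / norm a) * norm (of_real r * cis t - a)"
          using r by (simp only: norm_mult norm_divide norm_minus_cancel complex_mod_cnj) simp
        thus ?thesis using False r by simp
      qed
      have "of_real r * cis t - b \<noteq> 0" for t using b r by (auto simp: norm_mult)
      hence "ln (norm (of_real r * cis t - a)) = ln (norm a / r) + ln (norm (of_real r * cis t - b))" for t
        unfolding eq using False r by (subst ln_mult) auto
      moreover have "((\<lambda>t. ln (norm a / r) + ln (norm (of_real r * cis t - b))) has_integral 2 * pi * ln (norm a / r) + 2 * pi * ln (norm b)) {0..2*pi}"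
        using has_integral_add[OF has_integral_const_real[of "ln (norm a / r)" 0 "2*pi"] gt[OF b]] by simp
      moreover have "ln (norm a / r) + ln (norm b) = ln r"
        using False r by (simp add: b_def norm_divide ln_div ln_mult power2_eq_square norm_mult)
      ultimately show ?thesis using 2 by (simp flip: distrib_left)
    qed
  next
    case 3
    \<comment> \<open>These points lie outside the circle and move radially towards
      \<open>a\<close>, so their distance from each fixed point of the circle decreases and monotone
      convergence applies.\<close>
    define A where "A = (\<lambda>n. of_real (1 + 1 / real (Suc n)) * a)"
    have nA: "norm (A n) = (1 + 1 / real (Suc n)) * r" for n
      unfolding A_def norm_mult norm_of_real 3 by simp
    have A: "norm (A n) > r" for n unfolding nA using r by (simp add: field_simps)
    \<comment> \<open>At these parameters the logarithms tend to minus infinity whereas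
      \<open>ln 0\<close> is 0, so pointwise convergence would fail; the integrands are set to 0
      there.\<close>
    define S where "S = {t\<in>{0..2*pi}. of_real r * cis t \<in> {a}}"
    have finS: "finite S" unfolding S_def by (rule finite_circle_preimage) (use r in auto)
    have int: "((\<lambda>t. if t \<in> S then 0 else ln (norm (of_real r * cis t - A n))) has_integral 2 * pi * ln (norm (A n))) {0..2 * pi}" for n
      by (rule has_integral_spike_finite[OF finS _ gt[OF A]]) auto
    have lim: "(\<lambda>n. 1 + 1 / real (Suc n)) \<longlonglongrightarrow> 1"
      using tendsto_add[OF tendsto_const[of 1] LIMSEQ_inverse_real_of_nat] by (simp add: inverse_eq_divide)
    have limA: "A \<longlonglongrightarrow> a"
      using tendsto_mult[OF tendsto_of_real[OF lim] tendsto_const[of a]] by (simp add: A_def)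
    have limN: "(\<lambda>n. 2 * pi * ln (norm (A n))) \<longlonglongrightarrow> 2 * pi * ln r"
      using limA 3 r by (intro tendsto_intros) (auto intro: tendsto_norm)
    have mono: "norm (of_real r * cis t - A (Suc n)) \<le> norm (of_real r * cis t - A n)" for t n
    proof -
      define w where "w = of_real r * cis t"
      have sq: "(norm (w - of_real k * a))\<^sup>2 = r\<^sup>2 + k\<^sup>2 * r\<^sup>2 - 2 * k * Re (w * cnj a)" for k
      proof -
        have "(norm (w - of_real k * a))\<^sup>2 = (norm w)\<^sup>2 + k\<^sup>2 * (norm a)\<^sup>2 - 2 * k * Re (w * cnj a)"
          unfolding cmod_power2 by (simp add: power2_eq_square algebra_simps)
        thus ?thesis using 3 r by (simp add: w_def norm_mult)
      qed
      have re: "Re (w * cnj a) \<le> r\<^sup>2"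
        using complex_Re_le_cmod[of "w * cnj a"] 3 r by (simp add: w_def norm_mult power2_eq_square)
      define p q where "p = 1 + 1 / real (Suc (Suc n))" and "q = 1 + 1 / real (Suc n)"
      have pq: "1 \<le> p" "p \<le> q" by (auto simp: p_def q_def intro!: divide_left_mono)
      have "(q\<^sup>2 * r\<^sup>2 - 2 * q * Re (w * cnj a)) - (p\<^sup>2 * r\<^sup>2 - 2 * p * Re (w * cnj a))
           = (q - p) * ((q + p) * r\<^sup>2 - 2 * Re (w * cnj a))"
        by (simp add: algebra_simps power2_eq_square)
      moreover have "(q + p) * r\<^sup>2 \<ge> 2 * r\<^sup>2" using pq by (intro mult_right_mono) auto
      hence "(q - p) * ((q + p) * r\<^sup>2 - 2 * Re (w * cnj a)) \<ge> 0"
        using pq re by (intro mult_nonneg_nonneg) auto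
      ultimately have "(norm (w - of_real p * a))\<^sup>2 \<le> (norm (w - of_real q * a))\<^sup>2"
        unfolding sq by linarith
      thus ?thesis unfolding A_def w_def p_def q_def by (rule power2_le_imp_le) simp
    qed
    have ne: "of_real r * cis t - A n \<noteq> 0" for t n 
    proof
      assume "of_real r * cis t - A n = 0"
      hence "A n = of_real r * cis t" by simp
      hence "norm (A n) = r" using r by (simp add: norm_mult)
      with A[of n] show False by simp
    qed
    have "(\<lambda>t. if t \<in> S then 0 else ln (norm (of_real r * cis t - a))) integrable_on {0..2*pi} \<and>
        (\<lambda>n. integral {0..2*pi} (\<lambda>t. if t \<in> S then 0 else ln (norm (of_real r * cis t - A n)))) \<longlonglongrightarrow>
        integral {0..2*pi} (\<lambda>t. if t \<in> S then 0 else ln (norm (of_real r * cis t - a)))"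
    proof (rule monotone_convergence_decreasing)
      fix n
      show "(\<lambda>t. if t \<in> S then 0 else ln (norm (of_real r * cis t - A n))) integrable_on {0..2*pi}"
        using int by blast
    next
      fix n t
      show "(if t \<in> S then 0 else ln (norm (of_real r * cis t - A (Suc n)))) \<le> (if t \<in> S then 0 else ln (norm (of_real r * cis t - A n)))"
        using mono[of t n] ne[of t n] ne[of t "Suc n"] by auto
    next
      fix t assume t: "t \<in> {0..2*pi}"
      show "(\<lambda>n. if t \<in> S then 0 else ln (norm (of_real r * cis t - A n))) \<longlonglongrightarrow> (if t \<in> S then 0 else ln (norm (of_real r * cis t - a)))"
        using limA t by (auto simp: S_def intro!: tendsto_intros)
    next
      show "bounded (range (\<lambda>n. integral {0..2*pi} (\<lambda>t. if t \<in> S then 0 else ln (norm (of_real r * cis t - A n)))))"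
        unfolding integral_unique[OF int] by (rule convergent_imp_bounded[OF limN])
    qed
    hence "((\<lambda>t. if t \<in> S then 0 else ln (norm (of_real r * cis t - a))) has_integral 2 * pi * ln r) {0..2*pi}"
      unfolding integral_unique[OF int] using limN LIMSEQ_unique has_integral_iff by blast
    from has_integral_spike_finite[OF finS _ this, of "\<lambda>t. ln (norm (of_real r * cis t - a))"] show ?thesis using 3 by simp
  qed
qed

lemma absolutely_integrable_ln_circle_dist:
  assumes r: "r > 0"
  shows "(\<lambda>t. ln (norm (of_real r * cis t - a))) absolutely_integrable_on {0..2 * pi}"
proof -
  \<comment> \<open>The logarithm is bounded above on the circle, so \<open>C\<close> minus it is
    nonnegative, and integrable means absolutely integrable. The \<open>max 0\<close> covers the
    point where the argument vanishes and \<open>ln\<close> returns 0.\<close>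
  define C where "C = max 0 (ln (r + norm a))"
  have "(\<lambda>t. C - ln (norm (of_real r * cis t - a))) absolutely_integrable_on {0..2 * pi}"
  proof (rule nonnegative_absolutely_integrable_1)
    show "(\<lambda>t. C - ln (norm (of_real r * cis t - a))) integrable_on {0..2 * pi}"
      using has_integral_ln_circle_dist[OF r, of a] by (intro integrable_diff) auto
    fix t
    have le: "norm (of_real r * cis t - a) \<le> r + norm a"
      using norm_triangle_ineq4[of "of_real r * cis t" a] r by (simp add: norm_mult)
    show "0 \<le> C - ln (norm (of_real r * cis t - a))"
    proof (cases "of_real r * cis t - a = 0")
      case False
      hence "ln (norm (of_real r * cis t - a)) \<le> ln (r + norm a)" using le r by (subst ln_le_cancel_iff) (auto intro: add_pos_nonneg)
      thus ?thesis by (simp add: C_def)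
    qed (simp add: C_def)
  qed
  from set_integral_diff(1)[OF absolutely_integrable_continuous_real[of 0 "2*pi" "\<lambda>_. C"] this]
  show ?thesis by simp
qed

section \<open>Jensen's formula\<close>

lemma eventually_cosparse_UNIV_at: "eventually P (cosparse UNIV) \<Longrightarrow> eventually P (at z)"
  by (rule eventually_cosparse_imp_eventually_at) auto

lemma meromorphic_eventually_zero_or_nonzero:
  assumes "f meromorphic_on UNIV"
  shows "(\<forall>\<^sub>\<approx>z. f z = 0) \<or> (\<forall>\<^sub>\<approx>z. f z \<noteq> 0)"
  by (rule meromorphic_imp_constant_or_avoid) (use assms in auto)

lemma zorder_eq_0_cosparse:
  assumes f: "f meromorphic_on UNIV" and nz: "\<forall>\<^sub>\<approx>z. f z \<noteq> 0"
  shows "\<forall>\<^sub>\<approx>z. zorder f z = 0"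
  using meromorphic_on_imp_not_pole_cosparse[OF f] meromorphic_on_imp_not_zero_cosparse[OF f]
proof eventually_elim
  case (elim z)
  show ?case
    by (rule not_pole_not_isolated_zero_imp_zorder_eq_0)
       (use elim meromorphic_on_subset[OF f] eventually_cosparse_UNIV_at[OF nz]
          in \<open>auto intro: eventually_frequently\<close>)
qed

text \<open>Passes from orders to values: order 0 alone ignores the value at the point, and only the
  normalisation of \<open>f\<close> turns it into analyticity and a nonzero value.\<close>

lemma nicely_meromorphic_zorder_0_imp:
  assumes f: "f nicely_meromorphic_on UNIV" and nz: "\<forall>\<^sub>\<approx>z. f z \<noteq> 0" and 0: "zorder f z = 0"
  shows "f analytic_on {z}" "f z \<noteq> 0"
proof -
  have m: "f meromorphic_on {z}"
    using f meromorphic_on_subset unfolding nicely_meromorphic_on_def by blast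
  have iso: "isolated_singularity_at f z" using m by (simp add: meromorphic_at_iff)
  have "\<not> is_pole f z" using isolated_pole_imp_neg_zorder[OF iso] 0 by auto
  thus an: "f analytic_on {z}" using nicely_meromorphic_on_imp_analytic_at[OF f] by auto
  show "f z \<noteq> 0"
  proof
    assume "f z = 0"
    hence "isolated_zero f z"
      using non_isolated_zero_imp_eventually_zero[OF an] eventually_cosparse_UNIV_at[OF nz, of z]
        eventually_frequently[of "at z"] by (auto simp: frequently_def)
    thus False using zorder_isolated_zero_pos[OF _ an] 0 by auto
  qed
qed

lemma zorder_prod_linear_powi:
  fixes m :: "complex \<Rightarrow> int"
  assumes "finite A"
  shows "zorder (\<lambda>z. \<Prod>a\<in>A. (z - a) powi m a) z = (if z \<in> A then m z else 0)"
proof -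
  define n where "n = (if z \<in> A then m z else 0)"
  define S where "S = - (A - {z})"
  have "zorder (\<lambda>z. \<Prod>a\<in>A. (z - a) powi m a) z = n"
  proof (rule zorder_eqI[of S z "\<lambda>w. \<Prod>a\<in>A - {z}. (w - a) powi m a"])
    show "open S" unfolding S_def using assms by (intro open_Compl finite_imp_closed) auto
    show "(\<lambda>w. \<Prod>a\<in>A - {z}. (w - a) powi m a) holomorphic_on S"
      by (intro holomorphic_intros) (auto simp: S_def)
    fix w assume "w \<in> S" "w \<noteq> z"
    thus "(\<Prod>a\<in>A. (w - a) powi m a) = (\<Prod>a\<in>A - {z}. (w - a) powi m a) * (w - z) powi n"
      using assms by (auto simp: n_def prod.remove mult.commute)
  qed (use assms in \<open>auto simp: S_def\<close>)
  thus ?thesis by (simp add: n_def)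
qed

lemma finite_zorder_neq_0_cball:
  assumes f: "f meromorphic_on UNIV" and nz: "\<forall>\<^sub>\<approx>z. f z \<noteq> 0"
  shows "finite {a. a \<in> cball 0 r \<and> zorder f a \<noteq> 0}"
proof -
  have "{a. zorder f a \<noteq> 0} sparse_in UNIV"
    using zorder_eq_0_cosparse[OF f nz] by (simp add: eventually_cosparse)
  from sparse_in_compact_finite[OF sparse_in_subset[OF this subset_UNIV] compact_cball, of 0 r]
  show ?thesis by (simp add: Int_def)
qed

text \<open>The zero-free factor lives on a disc strictly larger than the closed one, so that it has
  a holomorphic logarithm up to and beyond the circle of integration.\<close>

lemma meromorphic_factorization_cball:
  assumes f: "f meromorphic_on UNIV" and nz: "\<forall>\<^sub>\<approx>z. f z \<noteq> 0" and r: "r > 0"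
  obtains u R where "r < R" "u holomorphic_on ball 0 R" "\<And>z. z \<in> ball 0 R \<Longrightarrow> u z \<noteq> 0"
    "\<forall>\<^sub>\<approx>z. f z = u z * (\<Prod>a | a \<in> cball 0 r \<and> zorder f a \<noteq> 0. (z - a) powi zorder f a)"
proof -
  define Z where "Z = {z. zorder f z \<noteq> 0}"
  have fin: "finite (Z \<inter> cball 0 x)" for x
    using finite_zorder_neq_0_cball[OF f nz, of x] by (simp add: Z_def Int_def conj_commute)
  define A where "A = {a. a \<in> cball 0 r \<and> zorder f a \<noteq> 0}"
  define B where "B = Z \<inter> cball 0 (r + 1) - A"
  \<comment> \<open>The distance from 0 to the next zero or pole outside the closed disc, capped at
    \<open>r + 1\<close>; a minimum of finitely many numbers above \<open>r\<close>.\<close>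
  define R where "R = Min (insert (r + 1) (norm ` B))"
  have finB: "finite B" and finA: "finite A"
    unfolding A_def B_def using fin finite_zorder_neq_0_cball[OF f nz] by auto
  have R: "r < R" using finB by (auto simp: R_def B_def A_def Z_def)
  have ZR: "Z \<inter> ball 0 R = A"
  proof
    show "A \<subseteq> Z \<inter> ball 0 R" using R by (auto simp: A_def Z_def)
    show "Z \<inter> ball 0 R \<subseteq> A"
    proof
      fix z assume z: "z \<in> Z \<inter> ball 0 R"
      have "R \<le> r + 1" unfolding R_def using finB by (intro Min_le) auto
      hence "z \<in> Z \<inter> cball 0 (r + 1)" using z by auto
      moreover have "z \<notin> B"
      proof
        assume "z \<in> B"
        hence "R \<le> norm z" unfolding R_def using finB by (intro Min_le) auto
        thus False using z by auto
      qed
      ultimately show "z \<in> A" by (auto simp: B_def)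
    qed
  qed
  define P where "P = (\<lambda>z. \<Prod>a\<in>A. (z - a) powi zorder f a)"
  have Pm: "P meromorphic_on X" for X unfolding P_def by (intro meromorphic_intros)
  have "\<forall>\<^sub>\<approx>z. z \<notin> A" using finA by (intro eventually_not_in_cosparse finite_imp_sparse)
  hence Pnz: "\<forall>\<^sub>\<approx>z. P z \<noteq> 0" by eventually_elim (use finA in \<open>auto simp: P_def\<close>)
  define g where "g = (\<lambda>z. f z / P z)"
  define u where "u = remove_sings g"
  have gm: "g meromorphic_on UNIV" unfolding g_def by (intro meromorphic_intros f Pm)
  have um: "u nicely_meromorphic_on UNIV" unfolding u_def by (intro remove_sings_nicely_meromorphic gm)
  have ug: "\<forall>\<^sub>\<approx>z. u z = g z" unfolding u_def by (rule eventually_remove_sings_eq[OF gm])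
  have unz: "\<forall>\<^sub>\<approx>z. u z \<noteq> 0" using ug nz Pnz by eventually_elim (auto simp: g_def)
  have fq: "frequently (\<lambda>z. q z \<noteq> 0) (at w)" if "\<forall>\<^sub>\<approx>z. q z \<noteq> 0" for q :: "complex \<Rightarrow> complex" and w
    using eventually_cosparse_UNIV_at[OF that] by (intro eventually_frequently) auto
  have zo: "zorder u z = 0" if "z \<in> ball 0 R" for z
  proof -
    have "zorder u z = zorder g z" by (rule zorder_cong) (use eventually_cosparse_UNIV_at[OF ug] in auto)
    also have "\<dots> = zorder f z - zorder P z" unfolding g_def
      by (rule Meromorphic.zorder_divide[OF meromorphic_on_subset[OF f] fq[OF nz] Pm fq[OF Pnz]]) auto
    also have "zorder P z = (if z \<in> A then zorder f z else 0)"
      unfolding P_def by (rule zorder_prod_linear_powi[OF finA])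
    finally show ?thesis using that ZR by (auto simp: Z_def)
  qed
  show ?thesis
  proof (rule that[of R u])
    show "u holomorphic_on ball 0 R"
      by (rule analytic_imp_holomorphic, subst analytic_on_analytic_at)
         (use nicely_meromorphic_zorder_0_imp(1)[OF um unz zo] in auto)
    show "u z \<noteq> 0" if "z \<in> ball 0 R" for z
      using nicely_meromorphic_zorder_0_imp(2)[OF um unz zo[OF that]] .
    show "\<forall>\<^sub>\<approx>z. f z = u z * (\<Prod>a | a \<in> cball 0 r \<and> zorder f a \<noteq> 0. (z - a) powi zorder f a)"
      unfolding A_def[symmetric] using ug Pnz by eventually_elim (auto simp: g_def P_def)
  qed (rule R)
qed

lemma ln_powi: "x > 0 \<Longrightarrow> ln (x powi n) = of_int n * ln x" for x :: real
  by (simp add: ln_powr flip: powr_real_of_int')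

text \<open>The weight of a zero or pole in Jensen's formula and in \<open>nev_N\<close>. For a pole
  at the origin it reproduces the term \<open>n(0,f) log r\<close>, so one sum covers all
  points.\<close>

definition log_weight :: "real \<Rightarrow> complex \<Rightarrow> real" where
  "log_weight r a = (if a = 0 then ln r else ln (r / norm a))"

lemma log_weight_nonneg: "r \<ge> 1 \<Longrightarrow> norm a \<le> r \<Longrightarrow> log_weight r a \<ge> 0"
  by (auto simp: log_weight_def)

text \<open>The logarithm of the zero-free factor contributes its value at 0 by the mean value
  property, and every factor \<open>z - a\<close> with \<open>norm a \<le> r\<close> contributes
  \<open>ln r\<close>. The leading Laurent coefficient \<open>zor_poly f 0 0\<close> takes the place
  of the value at 0, so zeros and poles at the origin are allowed, as are zeros and poles on the
  circle.\<close>

theorem Jensen_formula: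
  assumes f: "f meromorphic_on UNIV" and nz: "\<forall>\<^sub>\<approx>z. f z \<noteq> 0" and r: "r > 0"
  shows "(\<lambda>t. ln (norm (f (of_real r * cis t)))) absolutely_integrable_on {0..2 * pi}" (is ?th1)
    and "((\<lambda>t. ln (norm (f (of_real r * cis t)))) has_integral
           2 * pi * (ln (norm (zor_poly f 0 0)) +
             (\<Sum>a | a \<in> cball 0 r \<and> zorder f a \<noteq> 0. of_int (zorder f a) * log_weight r a))) {0..2 * pi}" (is ?th2)
proof -
  define A where "A = {a. a \<in> cball 0 r \<and> zorder f a \<noteq> 0}"
  define m where "m = zorder f"
  have finA: "finite A" unfolding A_def by (rule finite_zorder_neq_0_cball[OF f nz])
  obtain u R where R: "r < R" and u: "u holomorphic_on ball 0 R" "\<And>z. z \<in> ball 0 R \<Longrightarrow> u z \<noteq> 0"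
    and fu: "\<forall>\<^sub>\<approx>z. f z = u z * (\<Prod>a\<in>A. (z - a) powi m a)"
    by (rule meromorphic_factorization_cball[OF assms, folded A_def, folded m_def]) (rule that)
  have "0 \<in> ball 0 R" using R r by simp
  then obtain v where v: "v holomorphic_on ball 0 R" "\<And>z. z \<in> ball 0 R \<Longrightarrow> exp (v z) = u z"
    using holomorphic_logarithm_exists[OF convex_ball open_ball u] by blast
  define E where "E = {t\<in>{0..2*pi}. of_real r * cis t \<in> A \<union> {z. f z \<noteq> u z * (\<Prod>a\<in>A. (z - a) powi m a)}}"
  have "finite E" unfolding E_def
  proof (rule finite_circle_preimage[OF _ r], rule sparse_in_union')
    show "A sparse_in UNIV" using finA by (intro finite_imp_sparse)
    show "{z. f z \<noteq> u z * (\<Prod>a\<in>A. (z - a) powi m a)} sparse_in UNIV"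
      using fu by (simp add: eventually_cosparse)
  qed
  have rR: "of_real r * cis t \<in> ball 0 R" for t using R r by (simp add: norm_mult)
  define G where "G = (\<lambda>t. Re (v (of_real r * cis t)) + (\<Sum>a\<in>A. of_int (m a) * ln (norm (of_real r * cis t - a))))"
  have eq: "ln (norm (f (of_real r * cis t))) = G t" if "t \<in> {0..2*pi} - E" for t
  proof -
    define w where "w = of_real r * cis t"
    have w: "w \<notin> A" "f w = u w * (\<Prod>a\<in>A. (w - a) powi m a)" using that by (auto simp: E_def w_def)
    have "norm (f w) = exp (Re (v w)) * (\<Prod>a\<in>A. norm (w - a) powi m a)"
      unfolding w(2) norm_mult v(2)[OF rR[of t, folded w_def], symmetric]
      by (simp add: prod_norm[symmetric] norm_power_int norm_exp_eq_Re)
    also have "ln \<dots> = Re (v w) + ln (\<Prod>a\<in>A. norm (w - a) powi m a)"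
      using w finA by (subst ln_mult) (auto intro!: prod_pos zero_less_power_int)
    also have "ln (\<Prod>a\<in>A. norm (w - a) powi m a) = (\<Sum>a\<in>A. ln (norm (w - a) powi m a))"
      using w finA by (intro ln_prod) (auto intro!: zero_less_power_int)
    also have "\<dots> = (\<Sum>a\<in>A. of_int (m a) * ln (norm (w - a)))"
      using w by (intro sum.cong refl ln_powi) auto
    finally show ?thesis by (simp add: G_def w_def)
  qed
  have cont: "continuous_on {0..2*pi} (\<lambda>t. Re (v (of_real r * cis t)))"
    by (intro continuous_intros continuous_on_compose2[OF holomorphic_on_imp_continuous_on[OF v(1)]])
       (use rR in auto)
  have "G absolutely_integrable_on {0..2*pi}" unfolding G_def
  proof (rule set_integral_add(1)[OF absolutely_integrable_continuous_real[OF cont] absolutely_integrable_sum[OF finA]])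
    show "(\<lambda>t. of_int (m a) * ln (norm (of_real r * cis t - a))) absolutely_integrable_on {0..2 * pi}" for a
      using absolutely_integrable_scaleR_left[OF absolutely_integrable_ln_circle_dist[OF r, of a], of "of_int (m a)"] by simp
  qed
  thus ?th1
    by (rule absolutely_integrable_spike[OF _ negligible_finite[OF \<open>finite E\<close>]]) (use eq in auto)
  define L where "L = 2 * pi * Re (v 0) + (\<Sum>a\<in>A. of_int (m a) * (2 * pi * ln r))"
  have "(G has_integral L) {0..2*pi}" unfolding G_def L_def
  proof (rule has_integral_add[OF _ has_integral_sum[OF finA]])
    show "((\<lambda>t. Re (v (of_real r * cis t))) has_integral 2 * pi * Re (v 0)) {0..2*pi}"
      using has_integral_linear[OF has_integral_circle_mean[OF v(1) r R] bounded_linear_Re]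
      by (simp add: o_def)
    fix a assume "a \<in> A"
    hence "max r (norm a) = r" by (auto simp: A_def)
    thus "((\<lambda>t. of_int (m a) * ln (norm (of_real r * cis t - a))) has_integral of_int (m a) * (2 * pi * ln r)) {0..2 * pi}"
      using has_integral_mult_right[OF has_integral_ln_circle_dist[OF r, of a]] by simp
  qed
  hence I: "((\<lambda>t. ln (norm (f (of_real r * cis t)))) has_integral L) {0..2*pi}"
    by (rule has_integral_spike_finite[OF \<open>finite E\<close>, rotated]) (use eq in auto)
  \<comment> \<open>The factor of \<open>a = 0\<close>, if it occurs, cancels against the power of
    \<open>z\<close> in the definition of the leading coefficient; the other factors are evaluated
    at 0.\<close>
  have c: "zor_poly f 0 0 = u 0 * (\<Prod>a\<in>A - {0}. (- a) powi m a)"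
  proof (rule zor_poly_eqI[where g = "\<lambda>x. x" and F = "at 0"])
    have "f meromorphic_on {0}" using f meromorphic_on_subset by blast
    thus "isolated_singularity_at f 0" "not_essential f 0" by (auto simp: meromorphic_at_iff)
    show "\<exists>\<^sub>F w in at 0. f w \<noteq> 0"
      using eventually_cosparse_UNIV_at[OF nz] by (intro eventually_frequently) auto
    have "((\<lambda>x. u x * (\<Prod>a\<in>A-{0}. (x - a) powi m a)) \<longlongrightarrow> u 0 * (\<Prod>a\<in>A-{0}. (0 - a) powi m a)) (at 0)"
    proof (intro tendsto_intros)
      have "isCont u 0" using u R r by (intro analytic_at_imp_isCont) (auto simp: analytic_at intro!: exI[of _ "ball 0 R"])
      thus "(u \<longlongrightarrow> u 0) (at 0)" by (simp add: isCont_def)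
    qed auto
    moreover have "eventually (\<lambda>x. u x * (\<Prod>a\<in>A-{0}. (x - a) powi m a) = f x * (x - 0) powi - zorder f 0) (at 0)"
      using eventually_cosparse_UNIV_at[OF fu, of 0] eventually_neq_at_within[of 0 0 UNIV]
    proof eventually_elim
      case (elim x)
      show ?case
      proof (cases "0 \<in> A")
        case True
        thus ?thesis using elim finA by (simp add: prod.remove[of A 0] m_def power_int_minus)
      next
        case False
        hence "zorder f 0 = 0" using r by (auto simp: A_def)
        thus ?thesis using elim finA False by (simp add: m_def)
      qed
    qed
    ultimately show "((\<lambda>x. f x * (x - 0) powi - zorder f 0) \<longlongrightarrow> u 0 * (\<Prod>a\<in>A - {0}. (- a) powi m a)) (at 0)"
      by (subst (asm) tendsto_cong) auto
  qed (auto simp: filterlim_ident)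
  have "ln (norm (zor_poly f 0 0)) = Re (v 0) + (\<Sum>a\<in>A-{0}. of_int (m a) * ln (norm a))"
  proof -
    have "norm (zor_poly f 0 0) = exp (Re (v 0)) * (\<Prod>a\<in>A-{0}. norm a powi m a)"
      unfolding c norm_mult using v(2)[of 0, symmetric] R r
      by (simp add: prod_norm[symmetric] norm_power_int norm_exp_eq_Re)
    also have "ln \<dots> = Re (v 0) + ln (\<Prod>a\<in>A-{0}. norm a powi m a)"
      using finA by (subst ln_mult) (auto intro!: prod_pos zero_less_power_int)
    also have "ln (\<Prod>a\<in>A-{0}. norm a powi m a) = (\<Sum>a\<in>A-{0}. ln (norm a powi m a))"
      using finA by (intro ln_prod) (auto intro!: zero_less_power_int)
    also have "\<dots> = (\<Sum>a\<in>A-{0}. of_int (m a) * ln (norm a))"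
      by (intro sum.cong refl ln_powi) auto
    finally show ?thesis .
  qed
  \<comment> \<open>For \<open>a \<noteq> 0\<close> the number \<open>ln r\<close> splits into
    \<open>ln (norm a)\<close> and \<open>log_weight r a\<close>; at the origin the weight is all of
    it.\<close>
  moreover have "(\<Sum>a\<in>A-{0}. of_int (m a) * ln (norm a)) + (\<Sum>a\<in>A. of_int (m a) * log_weight r a) = (\<Sum>a\<in>A. of_int (m a) * ln r)"
  proof -
    have "(\<Sum>a\<in>A-{0}. of_int (m a) * ln (norm a)) = (\<Sum>a\<in>A. if a = 0 then 0 else of_int (m a) * ln (norm a))"
      using finA by (intro sum.mono_neutral_cong_left) auto
    thus ?thesis
      using r by (simp flip: sum.distrib) (intro sum.cong refl, auto simp: log_weight_def ln_div algebra_simps)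
  qed
  ultimately have "L = 2 * pi * (ln (norm (zor_poly f 0 0)) + (\<Sum>a\<in>A. of_int (m a) * log_weight r a))"
    unfolding L_def by (simp add: algebra_simps sum_distrib_left)
  thus ?th2 using I unfolding m_def A_def by simp
qed

section \<open>The Nevanlinna characteristic\<close>

lemma log_plus_nonneg [simp]: "log_plus x \<ge> 0"
  by (simp add: log_plus_def)

lemma log_plus_eq_max: "x \<ge> 0 \<Longrightarrow> log_plus x = max (ln x) 0"
  by (auto simp: log_plus_def)

text \<open>Reduces estimates of \<open>log_plus\<close> to exponential bounds. The condition
  \<open>c \<ge> 0\<close> absorbs the truncation at 0 and the value 0 assigned to nonpositive
  arguments.\<close>

lemma log_plus_le_iff: "c \<ge> 0 \<Longrightarrow> log_plus x \<le> c \<longleftrightarrow> x \<le> exp c"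
  by (auto simp: log_plus_def not_less ln_le_cancel_iff[of x "exp c", simplified] intro: order_trans[of _ 0])

lemma log_plus_mono: "x \<le> y \<Longrightarrow> log_plus x \<le> log_plus y"
  by (auto simp: log_plus_def le_max_iff_disj)

lemma le_exp_log_plus: "x \<le> exp (log_plus x)"
  using log_plus_le_iff[of "log_plus x" x] by simp

lemma log_plus_mult_le: "x \<ge> 0 \<Longrightarrow> y \<ge> 0 \<Longrightarrow> log_plus (x * y) \<le> log_plus x + log_plus y"
  using le_exp_log_plus[of x] le_exp_log_plus[of y]
  by (subst log_plus_le_iff) (auto simp: exp_add intro!: mult_mono)

lemma log_plus_add_le: "log_plus (x + y) \<le> log_plus x + log_plus y + ln 2"
proof (subst log_plus_le_iff)
  have "x + y \<le> exp (log_plus x) * 1 + 1 * exp (log_plus y)"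
    using le_exp_log_plus[of x] le_exp_log_plus[of y] by simp
  also have "\<dots> \<le> exp (log_plus x) * exp (log_plus y) + exp (log_plus x) * exp (log_plus y)"
    by (intro add_mono mult_left_mono mult_right_mono) auto
  also have "\<dots> = exp (log_plus x + log_plus y + ln 2)" by (simp add: exp_add)
  finally show "x + y \<le> exp (log_plus x + log_plus y + ln 2)" .
qed auto

text \<open>Splits Jensen's integral into the proximity functions of \<open>f\<close> and
  \<open>1 / f\<close>. At 0 it survives because \<open>ln 0\<close> and \<open>1 / 0\<close> are
  both 0.\<close>

lemma ln_eq_log_plus_diff: "x \<ge> 0 \<Longrightarrow> ln x = log_plus x - log_plus (1 / x)"
  by (cases "x = 0") (auto simp: log_plus_eq_max ln_div max_def)

section \<open>The proximity function\<close>

lemma nev_m_cis: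
  "nev_m r f = 1 / (2 * pi) * integral {0..2 * pi} (\<lambda>t. log_plus (norm (f (of_real r * cis t))))"
  unfolding nev_m_def cis_conv_exp ..

text \<open>Jensen's formula gives integrability of the logarithm unless \<open>f\<close> vanishes
  off a sparse set; in that case the integrand is 0 up to finitely many parameters.\<close>

lemma integrable_log_plus_circle:
  assumes f: "f meromorphic_on UNIV" and r: "r > 0"
  shows "(\<lambda>t. log_plus (norm (f (of_real r * cis t)))) absolutely_integrable_on {0..2 * pi}"
  using meromorphic_eventually_zero_or_nonzero[OF f]
proof
  assume nz: "\<forall>\<^sub>\<approx>z. f z \<noteq> 0"
  have "(\<lambda>t. max (ln (norm (f (of_real r * cis t)))) 0) absolutely_integrable_on {0..2 * pi}"
    by (intro absolutely_integrable_max_1 Jensen_formula(1) f nz r) simp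
  thus ?thesis by (simp add: log_plus_eq_max)
next
  assume z: "\<forall>\<^sub>\<approx>z. f z = 0"
  have fin: "finite {t\<in>{0..2*pi}. of_real r * cis t \<in> {z. f z \<noteq> 0}}"
    by (rule finite_circle_preimage[OF _ r]) (use z in \<open>simp add: eventually_cosparse\<close>)
  show ?thesis
    by (rule absolutely_integrable_spike[OF _ negligible_finite[OF fin], where f = "\<lambda>_. 0"])
       (auto simp: log_plus_def)
qed

lemma nev_m_le:
  assumes "r > 0" "f meromorphic_on UNIV" "\<And>z. norm z = r \<Longrightarrow> log_plus (norm (f z)) \<le> C"
  shows "nev_m r f \<le> C"
proof -
  have "integral {0..2 * pi} (\<lambda>t. log_plus (norm (f (of_real r * cis t)))) \<le> integral {0..2*pi} (\<lambda>_. C)"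
    using assms by (intro integral_le set_lebesgue_integral_eq_integral(1) integrable_log_plus_circle)
      (auto simp: norm_mult)
  thus ?thesis unfolding nev_m_cis by (simp add: field_simps)
qed

lemma nev_m_nonneg: "nev_m r f \<ge> 0"
proof -
  have "integral {0..2 * pi} (\<lambda>t. log_plus (norm (f (of_real r * cis t)))) \<ge> 0"
    by (cases "(\<lambda>t. log_plus (norm (f (of_real r * cis t)))) integrable_on {0..2*pi}")
       (auto simp: not_integrable_integral intro!: Henstock_Kurzweil_Integration.integral_nonneg)
  thus ?thesis unfolding nev_m_cis by simp
qed

lemma nev_m_cong:
  assumes "\<forall>\<^sub>\<approx>z. f z = g z" "r > 0"
  shows "nev_m r f = nev_m r g"
proof -
  have "finite {t\<in>{0..2*pi}. of_real r * cis t \<in> {z. f z \<noteq> g z}}"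
    by (rule finite_circle_preimage) (use assms in \<open>auto simp: eventually_cosparse\<close>)
  hence "integral {0..2 * pi} (\<lambda>t. log_plus (norm (f (of_real r * cis t)))) =
         integral {0..2 * pi} (\<lambda>t. log_plus (norm (g (of_real r * cis t))))"
    by (intro integral_spike[OF negligible_finite]) auto
  thus ?thesis unfolding nev_m_cis by simp
qed

lemma nev_m_mult_le:
  assumes f: "f meromorphic_on UNIV" and g: "g meromorphic_on UNIV" and r: "r > 0"
  shows "nev_m r (\<lambda>z. f z * g z) \<le> nev_m r f + nev_m r g"
proof -
  note I = set_lebesgue_integral_eq_integral(1)[OF integrable_log_plus_circle[OF _ r]]
  have "integral {0..2 * pi} (\<lambda>t. log_plus (norm (f (of_real r * cis t) * g (of_real r * cis t))))
     \<le> integral {0..2 * pi} (\<lambda>t. log_plus (norm (f (of_real r * cis t))) + log_plus (norm (g (of_real r * cis t))))"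
    using I[OF f] I[OF g] I[of "\<lambda>z. f z * g z"] f g
    by (intro integral_le integrable_add) (auto simp: norm_mult intro!: log_plus_mult_le meromorphic_intros)
  also have "\<dots> = integral {0..2 * pi} (\<lambda>t. log_plus (norm (f (of_real r * cis t)))) +
      integral {0..2 * pi} (\<lambda>t. log_plus (norm (g (of_real r * cis t))))"
    by (intro integral_add I f g)
  finally show ?thesis unfolding nev_m_cis by (simp add: field_simps)
qed

lemma nev_m_add_le:
  assumes f: "f meromorphic_on UNIV" and g: "g meromorphic_on UNIV" and r: "r > 0"
  shows "nev_m r (\<lambda>z. f z + g z) \<le> nev_m r f + nev_m r g + ln 2"
proof -
  note I = set_lebesgue_integral_eq_integral(1)[OF integrable_log_plus_circle[OF _ r]]
  have "integral {0..2 * pi} (\<lambda>t. log_plus (norm (f (of_real r * cis t) + g (of_real r * cis t))))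
     \<le> integral {0..2 * pi} (\<lambda>t. log_plus (norm (f (of_real r * cis t))) + log_plus (norm (g (of_real r * cis t))) + ln 2)"
    using I[OF f] I[OF g] I[of "\<lambda>z. f z + g z"] f g
    by (intro integral_le integrable_add)
       (auto intro!: order_trans[OF log_plus_mono[OF norm_triangle_ineq] log_plus_add_le] meromorphic_intros)
  also have "\<dots> = integral {0..2 * pi} (\<lambda>t. log_plus (norm (f (of_real r * cis t)))) +
      integral {0..2 * pi} (\<lambda>t. log_plus (norm (g (of_real r * cis t)))) + 2 * pi * ln 2"
    using integral_add[OF I[OF f] I[OF g]]
      integral_add[OF integrable_add[OF I[OF f] I[OF g]] integrable_const_ivl[of "ln 2" 0 "2 * pi"]]
    by simp
  finally show ?thesis unfolding nev_m_cis by (simp add: field_simps)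
qed

section \<open>Multiplicities of poles and the counting function\<close>

text \<open>Set to 0 away from poles so that subadditivity also holds where a function vanishes
  identically near the point and \<open>zorder\<close> carries no information.\<close>

definition pole_order :: "(complex \<Rightarrow> complex) \<Rightarrow> complex \<Rightarrow> nat" where
  "pole_order f z = (if is_pole f z then nat (- zorder f z) else 0)"

lemma meromorphic_at_eventually_zero_or_nonzero:
  assumes "f meromorphic_on {z}"
  shows "eventually (\<lambda>w. f w = 0) (at z) \<or> eventually (\<lambda>w. f w \<noteq> 0) (at z)"
  using assms not_essential_frequently_0_imp_eventually_0[of f z]
  by (auto simp: meromorphic_at_iff frequently_def)

lemma pole_order_cong: "eventually (\<lambda>w. f w = g w) (at z) \<Longrightarrow> pole_order f z = pole_order g z"
  unfolding pole_order_def using is_pole_cong[of f g z z] zorder_cong[of f g z z] by auto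

lemma pole_order_eq:
  assumes "f meromorphic_on {z}" "eventually (\<lambda>w. f w \<noteq> 0) (at z)"
  shows "pole_order f z = nat (- zorder f z)"
  using zorder_neg_imp_is_pole[OF assms] unfolding pole_order_def by (cases "zorder f z < 0") auto

lemma pole_order_add_le:
  assumes f: "f meromorphic_on {z}" and g: "g meromorphic_on {z}"
  shows "pole_order (\<lambda>z. f z + g z) z \<le> pole_order f z + pole_order g z"
proof -
  have fg: "(\<lambda>z. f z + g z) meromorphic_on {z}" by (intro meromorphic_intros f g)
  consider "eventually (\<lambda>w. f w = 0) (at z)" | "eventually (\<lambda>w. g w = 0) (at z)"
    | "eventually (\<lambda>w. f w + g w = 0) (at z)"
    | "eventually (\<lambda>w. f w \<noteq> 0) (at z)" "eventually (\<lambda>w. g w \<noteq> 0) (at z)" "eventually (\<lambda>w. f w + g w \<noteq> 0) (at z)"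
    using meromorphic_at_eventually_zero_or_nonzero f g fg by blast
  thus ?thesis
  proof cases
    case 1
    hence "pole_order (\<lambda>z. f z + g z) z = pole_order g z"
      by (intro pole_order_cong) (auto elim: eventually_mono)
    thus ?thesis by simp
  next
    case 2
    hence "pole_order (\<lambda>z. f z + g z) z = pole_order f z"
      by (intro pole_order_cong) (auto elim: eventually_mono)
    thus ?thesis by simp
  next
    case 3
    hence "pole_order (\<lambda>z. f z + g z) z = pole_order (\<lambda>_. 0) z" by (intro pole_order_cong)
    also have "\<dots> = 0" by (simp add: pole_order_def)
    finally show ?thesis by simp
  next
    case 4
    have "zorder (\<lambda>z. f z + g z) z \<ge> min (zorder f z) (zorder g z)"
      by (rule zorder_add_ge) (use f g 4 in \<open>auto intro: eventually_frequently\<close>)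
    thus ?thesis using pole_order_eq[OF f 4(1)] pole_order_eq[OF g 4(2)] pole_order_eq[OF fg 4(3)]
      by linarith
  qed
qed

lemma pole_order_mult_le:
  assumes f: "f meromorphic_on {z}" and g: "g meromorphic_on {z}"
  shows "pole_order (\<lambda>z. f z * g z) z \<le> pole_order f z + pole_order g z"
proof -
  have fg: "(\<lambda>z. f z * g z) meromorphic_on {z}" by (intro meromorphic_intros f g)
  consider "eventually (\<lambda>w. f w * g w = 0) (at z)"
    | "eventually (\<lambda>w. f w \<noteq> 0) (at z)" "eventually (\<lambda>w. g w \<noteq> 0) (at z)"
    using meromorphic_at_eventually_zero_or_nonzero[OF f] meromorphic_at_eventually_zero_or_nonzero[OF g]
    by (metis (mono_tags, lifting) eventually_mono mult_eq_0_iff)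
  thus ?thesis
  proof cases
    case 1
    hence "pole_order (\<lambda>z. f z * g z) z = pole_order (\<lambda>_. 0) z" by (intro pole_order_cong)
    also have "\<dots> = 0" by (simp add: pole_order_def)
    finally show ?thesis by simp
  next
    case 2
    have "zorder (\<lambda>z. f z * g z) z = zorder f z + zorder g z"
      by (rule zorder_mult) (use f g 2 in \<open>auto intro: eventually_frequently\<close>)
    moreover have "eventually (\<lambda>w. f w * g w \<noteq> 0) (at z)" using 2 by eventually_elim auto
    ultimately show ?thesis using pole_order_eq[OF f 2(1)] pole_order_eq[OF g 2(2)] pole_order_eq[OF fg]
      by linarith
  qed
qed

lemma finite_poles_cball:
  assumes "f meromorphic_on UNIV"
  shows "finite {z. norm z \<le> r \<and> is_pole f z}"
proof -
  have "{z. is_pole f z} sparse_in UNIV"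
    using meromorphic_on_imp_not_pole_cosparse[OF assms] by (simp add: eventually_cosparse)
  from sparse_in_compact_finite[OF sparse_in_subset[OF this subset_UNIV] compact_cball, of 0 r]
  show ?thesis by (simp add: Int_def)
qed

lemma nev_N_eq:
  assumes f: "f meromorphic_on UNIV" and r: "r > 0" and A: "finite A" "A \<subseteq> cball 0 r"
    and pA: "{z. norm z \<le> r \<and> is_pole f z} \<subseteq> A"
  shows "nev_N r f = (\<Sum>a\<in>A. real (pole_order f a) * log_weight r a)"
proof -
  define p where "p = pole_order f"
  have n: "real (nev_n t f) = (\<Sum>a\<in>A. if norm a \<le> t then real (p a) else 0)" if "t \<le> r" for t
  proof -
    have "nev_n t f = (\<Sum>a\<in>A. if norm a \<le> t then p a else 0)"
      unfolding nev_n_def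
      by (rule sum.mono_neutral_cong_left) (use A pA that in \<open>auto simp: p_def pole_order_def\<close>)
    thus ?thesis by (simp add: of_nat_sum if_distrib cong: if_cong)
  qed
  have n0: "real (nev_n 0 f) = (if 0 \<in> A then real (p 0) else 0)"
    using n[of 0] r A(1) by (simp add: sum.delta)
  have dif: "real (nev_n t f) - real (nev_n 0 f) = (\<Sum>a\<in>A-{0}. if norm a \<le> t then real (p a) else 0)"
    if "0 \<le> t" "t \<le> r" for t
    using A(1) that unfolding n[OF that(2)] n0 by (auto simp: sum.remove)
  have int_a: "((\<lambda>t. if norm a \<le> t then real (p a) / t else 0) has_integral real (p a) * log_weight r a) {0..r}"
    if a: "a \<in> A - {0}" for a
  proof -
    have a': "norm a > 0" "norm a \<le> r" using a A by auto
    have "((\<lambda>t. 1 / t) has_integral ln r - ln (norm a)) {norm a..r}"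
      using a' by (intro fundamental_theorem_of_calculus)
        (auto intro!: derivative_eq_intros intro: less_le_trans[OF a'(1)]
          simp: has_real_derivative_iff_has_vector_derivative[symmetric])
    from has_integral_mult_right[OF this, of "real (p a)"]
    have "((\<lambda>t. real (p a) / t) has_integral real (p a) * log_weight r a) {norm a..r}"
      using a' r a by (simp add: log_weight_def ln_div)
    hence "((\<lambda>t. if t \<in> {norm a..r} then real (p a) / t else 0) has_integral real (p a) * log_weight r a) {0..r}"
      by (subst has_integral_restrict) auto
    thus ?thesis by (rule has_integral_eq[rotated]) auto
  qed
  have "((\<lambda>t. \<Sum>a\<in>A-{0}. if norm a \<le> t then real (p a) / t else 0) has_integral (\<Sum>a\<in>A-{0}. real (p a) * log_weight r a)) {0..r}"
    by (rule has_integral_sum) (use A(1) int_a in auto)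
  hence "((\<lambda>t. (real (nev_n t f) - real (nev_n 0 f)) / t) has_integral (\<Sum>a\<in>A-{0}. real (p a) * log_weight r a)) {0..r}"
  proof (rule has_integral_eq[rotated])
    fix t assume "t \<in> {0..r}"
    thus "(\<Sum>a\<in>A-{0}. if norm a \<le> t then real (p a) / t else 0) = (real (nev_n t f) - real (nev_n 0 f)) / t"
      by (subst dif) (auto simp: sum_divide_distrib if_distrib[of "\<lambda>x. x / t"] cong: if_cong)
  qed
  hence "nev_N r f = (\<Sum>a\<in>A-{0}. real (p a) * log_weight r a) + (if 0 \<in> A then real (p 0) else 0) * ln r"
    unfolding nev_N_def n0 by (simp add: integral_unique)
  moreover have "log_weight r 0 = ln r" by (simp add: log_weight_def)
  ultimately show ?thesis using A(1) by (cases "0 \<in> A") (simp_all add: p_def sum.remove[of A 0])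
qed

text \<open>The comparison is made pole by pole; \<open>r \<ge> 1\<close> keeps the weight
  \<open>ln r\<close> of the origin nonnegative.\<close>

lemma nev_N_le_sum:
  assumes f: "f meromorphic_on UNIV" and g: "g meromorphic_on UNIV" and h: "h meromorphic_on UNIV"
    and r: "r \<ge> 1" and le: "\<And>z. pole_order h z \<le> pole_order f z + pole_order g z"
  shows "nev_N r h \<le> nev_N r f + nev_N r g"
proof -
  define A where "A = {z. norm z \<le> r \<and> is_pole f z} \<union> {z. norm z \<le> r \<and> is_pole g z} \<union> {z. norm z \<le> r \<and> is_pole h z}"
  have A: "finite A" "A \<subseteq> cball 0 r" unfolding A_def using finite_poles_cball f g h by auto
  have N: "nev_N r q = (\<Sum>a\<in>A. real (pole_order q a) * log_weight r a)" if "q \<in> {f, g, h}" for q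
    by (rule nev_N_eq) (use A that r f g h in \<open>auto simp: A_def\<close>)
  have "nev_N r h \<le> (\<Sum>a\<in>A. real (pole_order f a + pole_order g a) * log_weight r a)"
    unfolding N[of h, simplified] using A(2) r
    by (intro sum_mono mult_right_mono log_weight_nonneg of_nat_mono le) auto
  thus ?thesis by (simp add: N algebra_simps sum.distrib)
qed

lemma nev_N_nonneg:
  assumes "f meromorphic_on UNIV" "r \<ge> 1"
  shows "nev_N r f \<ge> 0"
  using assms finite_poles_cball[OF assms(1), of r]
  by (subst nev_N_eq[of f r "{z. norm z \<le> r \<and> is_pole f z}"])
     (auto intro!: sum_nonneg mult_nonneg_nonneg log_weight_nonneg)

section \<open>The characteristic of products, sums and reciprocals\<close>

lemma nev_T_mult_le:
  assumes "f meromorphic_on UNIV" "g meromorphic_on UNIV" "r \<ge> 1"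
  shows "nev_T r (\<lambda>z. f z * g z) \<le> nev_T r f + nev_T r g"
proof -
  have "nev_N r (\<lambda>z. f z * g z) \<le> nev_N r f + nev_N r g"
    by (rule nev_N_le_sum)
       (use assms meromorphic_on_subset[OF assms(1)] meromorphic_on_subset[OF assms(2)]
         in \<open>auto intro!: pole_order_mult_le meromorphic_intros\<close>)
  thus ?thesis unfolding nev_T_def using nev_m_mult_le[OF assms(1,2), of r] assms(3) by linarith
qed

lemma nev_T_add_le:
  assumes "f meromorphic_on UNIV" "g meromorphic_on UNIV" "r \<ge> 1"
  shows "nev_T r (\<lambda>z. f z + g z) \<le> nev_T r f + nev_T r g + ln 2"
proof -
  have "nev_N r (\<lambda>z. f z + g z) \<le> nev_N r f + nev_N r g"
    by (rule nev_N_le_sum)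
       (use assms meromorphic_on_subset[OF assms(1)] meromorphic_on_subset[OF assms(2)]
         in \<open>auto intro!: pole_order_add_le meromorphic_intros\<close>)
  thus ?thesis unfolding nev_T_def using nev_m_add_le[OF assms(1,2), of r] assms(3) by linarith
qed

lemma nev_T_cong:
  assumes fg: "\<forall>\<^sub>\<approx>z. f z = g z" and r: "r > 0"
  shows "nev_T r f = nev_T r g"
proof -
  have "is_pole f z = is_pole g z" "zorder f z = zorder g z" for z
    using is_pole_cong[of f g z z] zorder_cong[of f g z z] eventually_cosparse_UNIV_at[OF fg, of z] by auto
  hence "nev_N r f = nev_N r g" unfolding nev_N_def nev_n_def by simp
  thus ?thesis unfolding nev_T_def using nev_m_cong[OF fg r] by simp
qed

lemma nev_T_analytic:
  assumes "f analytic_on UNIV"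
  shows "nev_T r f = nev_m r f"
proof -
  have "\<not> is_pole f z" for z
    using assms analytic_at_imp_no_pole analytic_on_subset by blast
  thus ?thesis by (simp add: nev_T_def nev_N_def nev_n_def)
qed

lemma nev_T_const: "r > 0 \<Longrightarrow> nev_T r (\<lambda>_. c) \<le> log_plus (norm c)"
  by (subst nev_T_analytic) (auto intro!: nev_m_le)

lemma nev_T_uminus: "nev_T r (\<lambda>z. - f z) = nev_T r f"
  by (simp add: nev_T_def nev_m_def nev_N_def nev_n_def)

lemma nev_T_diff_le:
  assumes "f meromorphic_on UNIV" "g meromorphic_on UNIV" "r \<ge> 1"
  shows "nev_T r (\<lambda>z. f z - g z) \<le> nev_T r f + nev_T r g + ln 2"
  using nev_T_add_le[OF assms(1) meromorphic_on_uminus[OF assms(2)] assms(3)]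
  by (simp add: nev_T_uminus)

text \<open>Jensen's formula with positive and negative parts separated: the logarithm splits into
  two \<open>log_plus\<close>, and each order into a pole order of \<open>f\<close> and one of
  \<open>1 / f\<close>. The correction term does not depend on \<open>r\<close>.\<close>

theorem nev_T_inverse:
  assumes f: "f meromorphic_on UNIV" and nz: "\<forall>\<^sub>\<approx>z. f z \<noteq> 0" and r: "r > 0"
  shows "nev_T r (\<lambda>z. 1 / f z) = nev_T r f - ln (norm (zor_poly f 0 0))"
proof -
  define A where "A = {a. a \<in> cball 0 r \<and> zorder f a \<noteq> 0}"
  define g where "g = (\<lambda>z. 1 / f z)"
  have g: "g meromorphic_on UNIV" unfolding g_def by (intro meromorphic_intros f)
  have fm: "f meromorphic_on {z}" and gm: "g meromorphic_on {z}" for z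
    using f g meromorphic_on_subset by blast+
  have fz: "eventually (\<lambda>w. f w \<noteq> 0) (at z)" for z by (rule eventually_cosparse_UNIV_at[OF nz])
  hence gz: "eventually (\<lambda>w. g w \<noteq> 0) (at z)" for z by (simp add: g_def)
  have zg: "zorder g z = - zorder f z" for z
    using Meromorphic.zorder_divide[of "\<lambda>_. 1" z f] fm[of z] eventually_frequently[OF _ fz[of z]]
      meromorphic_on_const[of 1 "{z}"]
    by (simp add: g_def)
  have pf: "pole_order f z = nat (- zorder f z)" and pg: "pole_order g z = nat (zorder f z)" for z
    using pole_order_eq[OF fm fz] pole_order_eq[OF gm gz] by (auto simp: zg)
  have poles: "is_pole f z \<Longrightarrow> zorder f z \<noteq> 0" "is_pole g z \<Longrightarrow> zorder f z \<noteq> 0" for z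
    using isolated_pole_imp_neg_zorder[of f z] isolated_pole_imp_neg_zorder[of g z] fm gm zg
    by (auto simp: meromorphic_at_iff)
  have A: "finite A" "A \<subseteq> cball 0 r" unfolding A_def using finite_zorder_neq_0_cball[OF f nz] by auto
  have N: "nev_N r f = (\<Sum>a\<in>A. real (pole_order f a) * log_weight r a)"
          "nev_N r g = (\<Sum>a\<in>A. real (pole_order g a) * log_weight r a)"
    by (rule nev_N_eq; use A r f g poles in \<open>auto simp: A_def\<close>)+
  have "nev_N r g - nev_N r f = (\<Sum>a\<in>A. of_int (zorder f a) * log_weight r a)"
  proof -
    have "real (nat k) - real (nat (- k)) = of_int k" for k :: int by (cases "k \<ge> 0") auto
    thus ?thesis unfolding N sum_subtractf[symmetric] left_diff_distrib[symmetric] pf pg by simp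
  qed
  moreover have "nev_m r f - nev_m r g = ln (norm (zor_poly f 0 0)) + (\<Sum>a\<in>A. of_int (zorder f a) * log_weight r a)"
  proof -
    note I = set_lebesgue_integral_eq_integral(1)[OF integrable_log_plus_circle[OF _ r]]
    have "nev_m r f - nev_m r g = 1 / (2 * pi) * integral {0..2*pi}
        (\<lambda>t. log_plus (norm (f (of_real r * cis t))) - log_plus (norm (g (of_real r * cis t))))"
      unfolding nev_m_cis right_diff_distrib[symmetric] by (subst integral_diff[OF I[OF f] I[OF g]]) simp
    also have "\<dots> = 1 / (2 * pi) * integral {0..2*pi} (\<lambda>t. ln (norm (f (of_real r * cis t))))"
      by (subst ln_eq_log_plus_diff) (auto simp: g_def norm_divide)
    also have "\<dots> = ln (norm (zor_poly f 0 0)) + (\<Sum>a\<in>A. of_int (zorder f a) * log_weight r a)"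
      unfolding A_def using integral_unique[OF Jensen_formula(2)[OF f nz r]] by simp
    finally show ?thesis .
  qed
  ultimately show ?thesis unfolding nev_T_def g_def by linarith
qed

section \<open>Growth of entire functions\<close>

text \<open>On the circle, \<open>norm (w - a)\<close> coincides with the modulus of
  \<open>q w\<close>, which has no zeros in a disc beyond the circle. Hence the Poisson integral
  equals \<open>2 * pi * ln (norm (q z))\<close>, and inside the disc
  \<open>norm (z - a) \<le> norm (q z)\<close>.\<close>

lemma ln_le_Poisson_factor:
  fixes a z :: complex
  assumes R: "norm a < R" "norm z < R"
  shows "\<exists>I. ((\<lambda>t. ln (norm (of_real R * cis t - a)) * ((R\<^sup>2 - (norm z)\<^sup>2) / (norm (of_real R * cis t - z))\<^sup>2)) has_integral I) {0..2 * pi}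
    \<and> (z \<noteq> a \<longrightarrow> 2 * pi * ln (norm (z - a)) \<le> I)"
proof -
  have R0: "R > 0" using R norm_ge_zero[of a] by linarith
  \<comment> \<open>The zero of \<open>q\<close> is the reflection of \<open>a\<close>, at distance
    \<open>R\<^sup>2 / norm a\<close>. For \<open>a = 0\<close> the function \<open>q\<close> is
    constant and any radius above \<open>R\<close> serves.\<close>
  define S where "S = (if a = 0 then 2 * R else R\<^sup>2 / norm a)"
  have S: "S > R" using R R0 by (auto simp: S_def less_divide_eq power2_eq_square)
  define q where "q = (\<lambda>w. of_real R - cnj a * w / of_real R)"
  have pos: "Re (q w) > 0" if "w \<in> ball 0 S" for w
  proof -
    have "norm a * norm w < R\<^sup>2"
      using that R0 by (cases "a = 0") (auto simp: S_def less_divide_eq mult.commute)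
    hence "norm (cnj a * w / of_real R) < R"
      using R0 by (simp add: norm_mult norm_divide divide_less_eq power2_eq_square)
    hence "Re (cnj a * w / of_real R) < R"
      using complex_Re_le_cmod[of "cnj a * w / of_real R"] by linarith
    thus ?thesis unfolding q_def by simp
  qed
  define P where "P = (\<lambda>t. (R\<^sup>2 - (norm z)\<^sup>2) / (norm (of_real R * cis t - z))\<^sup>2)"
  have "((\<lambda>t. Ln (q (of_real R * cis t)) * of_real (P t)) has_integral 2 * of_real pi * Ln (q z)) {0..2 * pi}"
    unfolding P_def
  proof (rule has_integral_circle_Poisson[OF _ R(2) S])
    show "(\<lambda>w. Ln (q w)) holomorphic_on ball 0 S"
    proof (intro holomorphic_intros)
      show "q holomorphic_on ball 0 S" unfolding q_def using R0 by (intro holomorphic_intros) auto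
      fix w :: complex assume "w \<in> ball 0 S"
      from pos[OF this] show "q w \<notin> \<real>\<^sub>\<le>\<^sub>0" by (meson complex_nonpos_Reals_iff not_less)
    qed
  qed
  from has_integral_linear[OF this bounded_linear_Re]
  have I: "((\<lambda>t. Re (Ln (q (of_real R * cis t))) * P t) has_integral 2 * pi * Re (Ln (q z))) {0..2 * pi}"
    by (simp add: o_def)
  have Re: "Re (Ln (q w)) = ln (norm (q w))" if "w \<in> ball 0 S" for w
    using pos[OF that] by (intro Re_Ln) auto
  have q: "norm (q (of_real R * cis t)) = norm (of_real R * cis t - a)" for t
  proof -
    have "q (of_real R * cis t) = cis t * cnj (of_real R * cis t - a)"
      using R0 by (simp add: q_def cis_cnj algebra_simps cis_mult)
    thus ?thesis by (simp add: norm_mult del: complex_cnj_diff)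
  qed
  have "((\<lambda>t. ln (norm (of_real R * cis t - a)) * P t) has_integral 2 * pi * Re (Ln (q z))) {0..2 * pi}"
    using I S R0 by (simp add: Re norm_mult q)
  moreover have "ln (norm (z - a)) \<le> Re (Ln (q z))" if "z \<noteq> a"
  proof -
    have "(R * norm (q z))\<^sup>2 - (R * norm (z - a))\<^sup>2 = (R\<^sup>2 - (norm a)\<^sup>2) * (R\<^sup>2 - (norm z)\<^sup>2)"
    proof -
      have "R * norm (q z) = norm (of_real (R\<^sup>2) - cnj a * z)"
      proof -
        have "of_real (R\<^sup>2) - cnj a * z = of_real R * q z"
          using R0 by (simp add: q_def field_simps power2_eq_square)
        thus ?thesis using R0 by (simp add: norm_mult)
      qed
      hence q2: "(R * norm (q z))\<^sup>2 = (norm (of_real (R\<^sup>2) - cnj a * z))\<^sup>2" by simp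
      have ri: "Re (of_real (R\<^sup>2) - cnj a * z) = R\<^sup>2 - (Re a * Re z + Im a * Im z)"
        "Im (of_real (R\<^sup>2) - cnj a * z) = Im a * Re z - Re a * Im z"
        by (simp_all del: of_real_power)
      have z2: "(R * norm (z - a))\<^sup>2 = R\<^sup>2 * (norm (z - a))\<^sup>2" by (simp add: power_mult_distrib)
      show ?thesis
        unfolding q2 z2 cmod_power2 ri unfolding minus_complex.sel
        by (simp add: power2_eq_square ring_distribs)
    qed
    moreover have "0 \<le> (R\<^sup>2 - (norm a)\<^sup>2) * (R\<^sup>2 - (norm z)\<^sup>2)"
    proof (rule mult_nonneg_nonneg)
      have "(norm a)\<^sup>2 \<le> R\<^sup>2" by (rule power_mono) (use R in auto)
      thus "0 \<le> R\<^sup>2 - (norm a)\<^sup>2" by simp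
      have "(norm z)\<^sup>2 \<le> R\<^sup>2" by (rule power_mono) (use R in auto)
      thus "0 \<le> R\<^sup>2 - (norm z)\<^sup>2" by simp
    qed
    ultimately have "(R * norm (z - a))\<^sup>2 \<le> (R * norm (q z))\<^sup>2" by linarith
    hence "R * norm (z - a) \<le> R * norm (q z)" by (rule power2_le_imp_le) (use R0 in simp)
    hence "norm (z - a) \<le> norm (q z)" using R0 by simp
    moreover have zS: "z \<in> ball 0 S" using R S by simp
    moreover have "q z \<noteq> 0" using pos[OF zS] by auto
    ultimately show ?thesis using that by (subst Re) (auto intro: ln_mono)
  qed
  ultimately show ?thesis by (intro exI[of _ "2 * pi * Re (Ln (q z))"]) (simp add: P_def)
qed

text \<open>Recovers equality at an individual point from an identity that is only known off a
  sparse set.\<close>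

lemma isCont_cosparse_eq:
  fixes f g :: "complex \<Rightarrow> complex"
  assumes "isCont f z" "isCont g z" "\<forall>\<^sub>\<approx>w. f w = g w"
  shows "f z = g z"
proof (rule tendsto_unique[of "at z"])
  show "(f \<longlongrightarrow> f z) (at z)" using assms(1) by (simp add: isCont_def)
  have "(g \<longlongrightarrow> g z) (at z)" using assms(2) by (simp add: isCont_def)
  thus "(f \<longlongrightarrow> g z) (at z)"
    by (subst tendsto_cong[of f g]) (use eventually_cosparse_UNIV_at[OF assms(3)] in auto)
qed auto

text \<open>A Poisson-Jensen inequality: the zero-free factor is treated by the Poisson formula,
  each zero by \<open>ln_le_Poisson_factor\<close>. Since no zero lies on the circle, all zeros in
  the closed disc are strictly inside, as that lemma requires.\<close>

lemma entire_ln_norm_le_nev_m: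
  assumes F: "F holomorphic_on UNIV" and nz: "\<forall>\<^sub>\<approx>z. F z \<noteq> 0" and zR: "norm z < R"
    and circ: "\<And>w. norm w = R \<Longrightarrow> zorder F w = 0" and Fz: "F z \<noteq> 0"
  shows "ln (norm (F z)) \<le> (R + norm z) / (R - norm z) * nev_m R F"
proof -
  have R: "R > 0" using zR norm_ge_zero[of z] by linarith
  have "F analytic_on UNIV" using F by (simp add: analytic_on_open)
  hence an: "F analytic_on X" for X by (rule analytic_on_subset) simp
  have mero: "F meromorphic_on UNIV" by (intro analytic_on_imp_meromorphic_on an)
  define A where "A = {a. a \<in> cball 0 R \<and> zorder F a \<noteq> 0}"
  define m where "m = zorder F"
  have finA: "finite A" unfolding A_def by (rule finite_zorder_neq_0_cball[OF mero nz])
  have mpos: "m a > 0" if "a \<in> A" for a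
  proof -
    have "\<not> is_pole F a" by (intro analytic_at_imp_no_pole an)
    hence "\<not> zorder F a < 0"
      using zorder_neg_imp_is_pole[OF analytic_on_imp_meromorphic_on[OF an] eventually_cosparse_UNIV_at[OF nz]]
      by blast
    thus ?thesis using that by (simp add: A_def m_def)
  qed
  have AR: "norm a < R" if "a \<in> A" for a
  proof -
    have "norm a \<le> R" "norm a \<noteq> R" using that circ[of a] unfolding A_def by auto
    thus ?thesis by simp
  qed
  obtain u S where S: "R < S" and u: "u holomorphic_on ball 0 S" "\<And>w. w \<in> ball 0 S \<Longrightarrow> u w \<noteq> 0"
    and fu: "\<forall>\<^sub>\<approx>w. F w = u w * (\<Prod>a\<in>A. (w - a) powi m a)"
    by (rule meromorphic_factorization_cball[OF mero nz R, folded A_def, folded m_def]) (rule that)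
  have "0 \<in> ball 0 S" using S R by simp
  then obtain v where v: "v holomorphic_on ball 0 S" "\<And>w. w \<in> ball 0 S \<Longrightarrow> exp (v w) = u w"
    using holomorphic_logarithm_exists[OF convex_ball open_ball u] by blast
  have Feq: "F w = u w * (\<Prod>a\<in>A. (w - a) ^ nat (m a))" if "w \<in> ball 0 S" for w
  proof (rule isCont_cosparse_eq[where f = F and z = w and g = "\<lambda>w. u w * (\<Prod>a\<in>A. (w - a) ^ nat (m a))"])
    show "isCont F w" using an by (rule analytic_at_imp_isCont)
    have "isCont u w"
      using holomorphic_on_imp_continuous_on[OF u(1)] that by (simp add: continuous_on_eq_continuous_at)
    thus "isCont (\<lambda>w. u w * (\<Prod>a\<in>A. (w - a) ^ nat (m a))) w" by (intro continuous_intros)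
    have "(x - a) powi m a = (x - a) ^ nat (m a)" if "a \<in> A" for x a
      using mpos[OF that] by (simp add: power_int_def)
    thus "\<forall>\<^sub>\<approx>w. F w = u w * (\<Prod>a\<in>A. (w - a) ^ nat (m a))"
      using fu by (auto cong: prod.cong)
  qed
  have ln: "ln (norm (F w)) = Re (v w) + (\<Sum>a\<in>A. real (nat (m a)) * ln (norm (w - a)))"
    if "w \<in> ball 0 S" "w \<notin> A" for w
  proof -
    have "norm (F w) = exp (Re (v w)) * (\<Prod>a\<in>A. norm (w - a) ^ nat (m a))"
      unfolding Feq[OF that(1)] norm_mult v(2)[OF that(1), symmetric]
      by (simp add: prod_norm[symmetric] norm_power norm_exp_eq_Re)
    also have "ln \<dots> = Re (v w) + ln (\<Prod>a\<in>A. norm (w - a) ^ nat (m a))"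
      using that finA by (subst ln_mult) (auto intro!: prod_pos)
    also have "ln (\<Prod>a\<in>A. norm (w - a) ^ nat (m a)) = (\<Sum>a\<in>A. ln (norm (w - a) ^ nat (m a)))"
      using that finA by (intro ln_prod) auto
    also have "\<dots> = (\<Sum>a\<in>A. real (nat (m a)) * ln (norm (w - a)))"
      by (intro sum.cong refl ln_realpow)
    finally show ?thesis .
  qed
  have zS: "z \<in> ball 0 S" using zR S by simp
  have zA: "z \<notin> A"
  proof
    assume "z \<in> A"
    hence "(\<Prod>a\<in>A. (z - a) ^ nat (m a)) = 0" using mpos finA by (auto simp: prod_zero_iff)
    thus False using Feq[OF zS] Fz by simp
  qed
  define P where "P = (\<lambda>t. (R\<^sup>2 - (norm z)\<^sup>2) / (norm (of_real R * cis t - z))\<^sup>2)"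
  have "\<exists>I. ((\<lambda>t. ln (norm (of_real R * cis t - a)) * P t) has_integral I) {0..2 * pi} \<and> 2 * pi * ln (norm (z - a)) \<le> I"
    if aA: "a \<in> A" for a
    using ln_le_Poisson_factor[OF AR[OF aA] zR] zA aA unfolding P_def by blast
  then obtain I where I: "\<And>a. a \<in> A \<Longrightarrow> ((\<lambda>t. ln (norm (of_real R * cis t - a)) * P t) has_integral I a) {0..2 * pi}"
    "\<And>a. a \<in> A \<Longrightarrow> 2 * pi * ln (norm (z - a)) \<le> I a" by metis
  have Iv: "((\<lambda>t. Re (v (of_real R * cis t)) * P t) has_integral 2 * pi * Re (v z)) {0..2 * pi}"
    using has_integral_linear[OF has_integral_circle_Poisson[OF v(1) zR S] bounded_linear_Re]
    by (simp add: o_def P_def)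
  have "((\<lambda>t. Re (v (of_real R * cis t)) * P t + (\<Sum>a\<in>A. real (nat (m a)) * (ln (norm (of_real R * cis t - a)) * P t)))
     has_integral (2 * pi * Re (v z) + (\<Sum>a\<in>A. real (nat (m a)) * I a))) {0..2 * pi}"
    by (intro has_integral_add Iv has_integral_sum finA has_integral_mult_right I)
  moreover have "Re (v (of_real R * cis t)) * P t + (\<Sum>a\<in>A. real (nat (m a)) * (ln (norm (of_real R * cis t - a)) * P t))
     = ln (norm (F (of_real R * cis t))) * P t" for t
  proof -
    have "norm (of_real R * cis t) = R" using R by (simp add: norm_mult)
    hence "of_real R * cis t \<in> ball 0 S" "of_real R * cis t \<notin> A"
      using S AR[of "of_real R * cis t"] by auto
    from ln[OF this] show ?thesis by (simp add: algebra_simps sum_distrib_left)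
  qed
  ultimately have J: "((\<lambda>t. ln (norm (F (of_real R * cis t))) * P t) has_integral
      (2 * pi * Re (v z) + (\<Sum>a\<in>A. real (nat (m a)) * I a))) {0..2 * pi}" by simp
  define K where "K = (R + norm z) / (R - norm z)"
  have P: "0 \<le> P t" "P t \<le> K" for t
  proof -
    have n: "norm (of_real R * cis t - z) \<ge> R - norm z"
      using norm_triangle_ineq2[of "of_real R * cis t" z] R by (simp add: norm_mult)
    have d: "R\<^sup>2 - (norm z)\<^sup>2 = (R + norm z) * (R - norm z)" by (simp add: power2_eq_square algebra_simps)
    show "0 \<le> P t" unfolding P_def d using R zR by simp
    have "P t \<le> (R + norm z) * (R - norm z) / (R - norm z)\<^sup>2"
      unfolding P_def d using R zR n less_le_trans[OF _ n, of 0]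
      by (intro divide_left_mono power_mono mult_pos_pos zero_less_power) auto
    thus "P t \<le> K" unfolding K_def using zR by (simp add: power2_eq_square)
  qed
  have "2 * pi * ln (norm (F z)) = 2 * pi * Re (v z) + (\<Sum>a\<in>A. real (nat (m a)) * (2 * pi * ln (norm (z - a))))"
    unfolding ln[OF zS zA] by (simp add: algebra_simps sum_distrib_left)
  also have "\<dots> \<le> 2 * pi * Re (v z) + (\<Sum>a\<in>A. real (nat (m a)) * I a)"
    by (intro add_left_mono sum_mono mult_left_mono I) auto
  also have "\<dots> \<le> integral {0..2*pi} (\<lambda>t. K * log_plus (norm (F (of_real R * cis t))))"
  proof (rule has_integral_le[OF J integrable_integral])
    show "(\<lambda>t. K * log_plus (norm (F (of_real R * cis t)))) integrable_on {0..2 * pi}"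
      using set_lebesgue_integral_eq_integral(1)[OF integrable_log_plus_circle[OF mero R]]
      by (rule integrable_on_mult_right)
    fix t
    \<comment> \<open>The kernel is nonnegative, so \<open>ln\<close> may be raised to
      \<open>log_plus\<close>; only after that may the kernel be replaced by its upper bound
      \<open>K\<close>.\<close>
    have "ln (norm (F (of_real R * cis t))) * P t \<le> log_plus (norm (F (of_real R * cis t))) * P t"
      by (intro mult_right_mono P) (simp add: log_plus_eq_max)
    also have "\<dots> \<le> log_plus (norm (F (of_real R * cis t))) * K"
      by (intro mult_left_mono P) simp
    finally show "ln (norm (F (of_real R * cis t))) * P t \<le> K * log_plus (norm (F (of_real R * cis t)))"
      by (simp add: mult.commute)
  qed
  also have "\<dots> = 2 * pi * (K * nev_m R F)" unfolding nev_m_cis by simp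
  finally have "ln (norm (F z)) \<le> K * nev_m R F" by simp
  thus ?thesis by (simp add: K_def)
qed

lemma entire_norm_le_of_nev_m:
  assumes F: "F holomorphic_on UNIV" and nz: "\<forall>\<^sub>\<approx>z. F z \<noteq> 0"
    and m: "\<And>r. r \<ge> R0 \<Longrightarrow> nev_m r F \<le> r powr A" and "A \<ge> 0" and z: "norm z \<ge> R0" "R0 > 0"
  shows "norm (F z) \<le> exp (3 * (3 * norm z) powr A)"
proof (cases "F z = 0")
  case False
  define r where "r = norm z"
  have mero: "F meromorphic_on UNIV"
    using F by (intro analytic_on_imp_meromorphic_on) (simp add: analytic_on_open)
  have r: "r > 0" "r \<ge> R0" using z by (auto simp: r_def)
  \<comment> \<open>Only finitely many radii carry zeros, so some \<open>R\<close> between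
    \<open>2*r\<close> and \<open>3*r\<close> avoids them; for it the factor
    \<open>(R + r) / (R - r)\<close> is at most 3.\<close>
  have "infinite ({2*r<..<3*r} - norm ` {a. a \<in> cball 0 (3*r) \<and> zorder F a \<noteq> 0})"
    using finite_zorder_neq_0_cball[OF mero nz, of "3*r"] r
    by (intro Diff_infinite_finite) auto
  then obtain R where R: "R \<in> {2*r<..<3*r}" "R \<notin> norm ` {a. a \<in> cball 0 (3*r) \<and> zorder F a \<noteq> 0}"
    by (metis (no_types, lifting) Diff_iff finite.emptyI equals0I)
  have circ: "zorder F w = 0" if "norm w = R" for w using R that by force
  have "ln (norm (F z)) \<le> (R + r) / (R - r) * nev_m R F"
    unfolding r_def by (rule entire_ln_norm_le_nev_m[OF F nz _ circ False]) (use R r in \<open>auto simp: r_def\<close>)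
  also have "\<dots> \<le> 3 * (3 * r) powr A"
  proof (rule mult_mono)
    show "(R + r) / (R - r) \<le> 3" using R r by (simp add: field_simps)
    have "nev_m R F \<le> R powr A" by (rule m) (use R r in auto)
    also have "\<dots> \<le> (3 * r) powr A" using R r assms(4) by (intro powr_mono2) auto
    finally show "nev_m R F \<le> (3 * r) powr A" .
  qed (use nev_m_nonneg in auto)
  finally have "exp (ln (norm (F z))) \<le> exp (3 * (3 * r) powr A)" by simp
  thus ?thesis using False by (simp add: r_def)
qed simp

section \<open>Taylor coefficients of g from the growth of exp g\<close>

text \<open>The absolute value of \<open>Re g\<close> is twice its positive part, which is
  \<open>log_plus (norm (exp g))\<close>, minus \<open>Re g\<close>, whose mean is
  \<open>Re (g 0)\<close>. A Fourier coefficient of \<open>Re g\<close> is bounded by the mean of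
  this absolute value and is half the corresponding Taylor term of \<open>g\<close>, hence the
  constants 4 and 2.\<close>

lemma coeff_le_nev_m_exp:
  assumes g: "g holomorphic_on UNIV" and n: "n > 0" and r: "r > 0"
  shows "norm ((deriv ^^ n) g 0 / fact n) * r ^ n \<le> 4 * nev_m r (\<lambda>z. exp (g z)) - 2 * Re (g 0)"
proof -
  have gb: "g holomorphic_on ball 0 (r + 1)" using g by (rule holomorphic_on_subset) auto
  have lp: "log_plus (norm (exp (g z))) = max (Re (g z)) 0" for z
    by (simp add: log_plus_eq_max norm_exp_eq_Re)
  define M where "M = (\<lambda>t. log_plus (norm (exp (g (of_real r * cis t)))))"
  have "(\<lambda>z. exp (g z)) analytic_on UNIV"
    using g by (intro analytic_intros) (auto simp: analytic_on_open)
  hence "M integrable_on {0..2*pi}"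
    unfolding M_def by (intro set_lebesgue_integral_eq_integral(1) integrable_log_plus_circle r analytic_on_imp_meromorphic_on)
  hence M: "(M has_integral 2 * pi * nev_m r (\<lambda>z. exp (g z))) {0..2*pi}"
    unfolding nev_m_cis M_def by (simp add: has_integral_integral)
  have "((\<lambda>t. Re (g (of_real r * cis t))) has_integral 2 * pi * Re (g 0)) {0..2*pi}"
    using has_integral_linear[OF has_integral_circle_mean[OF gb r] bounded_linear_Re] by (simp add: o_def)
  from has_integral_diff[OF has_integral_mult_right[OF M, of 2] this]
  have abs: "((\<lambda>t. \<bar>Re (g (of_real r * cis t))\<bar>) has_integral 2 * (2 * pi * nev_m r (\<lambda>z. exp (g z))) - 2 * pi * Re (g 0)) {0..2*pi}"
    
  proof (rule has_integral_eq[rotated])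
    fix t
    have "M t = max (Re (g (of_real r * cis t))) 0" unfolding M_def by (rule lp)
    thus "2 * M t - Re (g (of_real r * cis t)) = \<bar>Re (g (of_real r * cis t))\<bar>" by auto
  qed
  have c: "((\<lambda>t. of_real (Re (g (of_real r * cis t))) * cis (- (real n * t)))
           has_integral of_real pi * ((deriv ^^ n) g 0 / fact n * of_real r ^ n)) {0..2 * pi}"
    by (rule has_integral_circle_Re_coeff[OF gb r]) (use n in auto)
  have "norm (of_real pi * ((deriv ^^ n) g 0 / fact n * of_real r ^ n)) \<le>
      2 * (2 * pi * nev_m r (\<lambda>z. exp (g z))) - 2 * pi * Re (g 0)"
    unfolding integral_unique[OF c, symmetric] integral_unique[OF abs, symmetric]
    by (rule integral_norm_bound_integral) (use c abs in \<open>auto simp: norm_mult intro: has_integral_integrable\<close>)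
  hence "pi * (norm ((deriv ^^ n) g 0 / fact n) * r ^ n) \<le> pi * (4 * nev_m r (\<lambda>z. exp (g z)) - 2 * Re (g 0))"
    using r by (simp add: norm_mult norm_divide norm_power algebra_simps)
  thus ?thesis by simp
qed

lemma entire_eq_polynomial:
  assumes g: "g holomorphic_on UNIV" and z: "\<And>n. n \<ge> N \<Longrightarrow> (deriv ^^ n) g 0 = 0"
  shows "g w = (\<Sum>n<N. (deriv ^^ n) g 0 / fact n * w ^ n)"
proof -
  have "(\<lambda>n. (deriv ^^ n) g 0 / fact n * (w - 0) ^ n) sums g w"
    by (rule holomorphic_power_series[of g 0 "norm w + 1"]) (use g holomorphic_on_subset in auto)
  moreover have "(\<lambda>n. (deriv ^^ n) g 0 / fact n * (w - 0) ^ n) sums (\<Sum>n<N. (deriv ^^ n) g 0 / fact n * (w - 0) ^ n)"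
    by (rule sums_finite) (use z in auto)
  ultimately show ?thesis using sums_unique2 by fastforce
qed

section \<open>A Phragmen-Lindelof theorem for half strips\<close>

text \<open>The hypothesis bounds \<gamma> times the argument of \<open>w\<close> by 1, which is
  below \<open>pi / 3\<close> because \<open>pi > 3\<close>; there the cosine is at least
  1/2.\<close>

lemma Re_powr_of_real_ge:
  fixes w :: complex
  assumes "Re w > 0" "\<gamma> \<ge> 0" "\<gamma> * \<bar>Im w\<bar> \<le> Re w"
  shows "norm w powr \<gamma> / 2 \<le> Re (w powr of_real \<gamma>)"
proof -
  have w: "w \<noteq> 0" using assms by auto
  have "Im (Ln w) = arctan (Im w / Re w)" using assms(1) w by (simp add: Im_Ln_eq)
  hence "\<bar>Im (Ln w)\<bar> \<le> \<bar>Im w / Re w\<bar>" by (simp only: abs_arctan_le)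
  hence "\<gamma> * \<bar>Im (Ln w)\<bar> \<le> \<gamma> * \<bar>Im w\<bar> / Re w"
    using assms by (simp add: mult_left_mono abs_divide flip: times_divide_eq_right)
  also have "\<dots> \<le> 1" using assms by simp
  finally have a: "\<bar>\<gamma> * Im (Ln w)\<bar> \<le> pi / 3" using assms pi_gt3 by (simp add: abs_mult)
  have "cos (pi / 3) \<le> cos \<bar>\<gamma> * Im (Ln w)\<bar>"
    using a by (intro cos_monotone_0_pi_le) auto
  hence c: "1 / 2 \<le> cos (\<gamma> * Im (Ln w))" by (simp add: cos_60)
  have "Re (w powr of_real \<gamma>) = exp (\<gamma> * ln (norm w)) * cos (\<gamma> * Im (Ln w))"
    using w by (simp add: powr_def Re_exp Re_Ln)
  also have "exp (\<gamma> * ln (norm w)) = norm w powr \<gamma>" using w by (simp add: powr_def)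
  finally show ?thesis using mult_left_mono[OF c, of "norm w powr \<gamma>"] by simp
qed

text \<open>The function is multiplied by the exponential of
  \<open>- 2 C w^\<beta> - \<delta> w^\<gamma>\<close>. The factor 2 makes up for the loss of 1/2 in
  the real part of a power, so the first term cancels the boundary growth; the second, with \<gamma>
  = A + 1, beats the a priori growth for every \<delta> > 0, and finally \<delta> tends to 0. The
  strip is horizontal so that principal powers are holomorphic in its right part.\<close>

theorem Phragmen_Lindelof_half_strip:
  assumes G: "G holomorphic_on UNIV" and "b > 0" "C \<ge> 0" "\<beta> \<ge> 0" "A \<ge> 0"
    and bd: "\<And>w. \<bar>Im w\<bar> = b \<Longrightarrow> Re w \<ge> 1 \<Longrightarrow> norm (G w) \<le> exp (C * norm w powr \<beta>)"
    and gr: "\<And>w. norm w \<ge> R \<Longrightarrow> norm (G w) \<le> exp (norm w powr A)"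
  shows "\<exists>C' x0. \<forall>w. \<bar>Im w\<bar> \<le> b \<longrightarrow> Re w \<ge> x0 \<longrightarrow> norm (G w) \<le> exp (C' * norm w powr \<beta>)"
proof -
  define \<gamma> where "\<gamma> = A + 1"
  \<comment> \<open>From here on the argument of \<open>w\<close> is small enough for
    \<open>Re_powr_of_real_ge\<close> with both exponents.\<close>
  define x0 where "x0 = max 1 (max (\<beta> * b) (\<gamma> * b))"
  have x0: "x0 \<ge> 1" "\<beta> * b \<le> x0" "\<gamma> * b \<le> x0" by (auto simp: x0_def)
  have strip: "norm w powr c / 2 \<le> Re (w powr of_real c)"
    if "\<bar>Im w\<bar> \<le> b" "Re w \<ge> x0" "c \<in> {\<beta>, \<gamma>}" for w c
  proof (rule Re_powr_of_real_ge)
    show c: "c \<ge> 0" using that assms by (auto simp: \<gamma>_def)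
    have "c * \<bar>Im w\<bar> \<le> c * b" by (rule mult_left_mono[OF that(1) c])
    also have "\<dots> \<le> Re w" using that x0 by auto
    finally show "c * \<bar>Im w\<bar> \<le> Re w" .
  qed (use that x0 in auto)
  have "compact (G ` cbox (Complex x0 (-b)) (Complex x0 b))"
    by (intro compact_continuous_image holomorphic_on_imp_continuous_on holomorphic_on_subset[OF G]) auto
  then obtain K0 where K0: "\<And>z. z \<in> G ` cbox (Complex x0 (-b)) (Complex x0 b) \<Longrightarrow> norm z \<le> K0"
    using compact_imp_bounded bounded_iff by metis
  define K where "K = max 1 K0"
  have left: "norm (G w) \<le> K" if "Re w = x0" "\<bar>Im w\<bar> \<le> b" for w
  proof -
    have "w \<in> cbox (Complex x0 (-b)) (Complex x0 b)" using that by (auto simp: in_cbox_complex_iff)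
    thus ?thesis using K0[of "G w"] by (simp add: K_def le_max_iff_disj)
  qed
  have key: "norm (G w) \<le> K * exp (2 * C * norm w powr \<beta> + \<delta> * norm w powr \<gamma>)"
    if w: "\<bar>Im w\<bar> \<le> b" "Re w \<ge> x0" and \<delta>: "\<delta> > 0" for w \<delta>
  proof -
    define H where "H = (\<lambda>w. G w * exp (- (of_real (2 * C) * w powr of_real \<beta>) - of_real \<delta> * w powr of_real \<gamma>))"
    \<comment> \<open>On the right side of the rectangle \<open>norm z\<close> is at least
      \<open>2 / \<delta>\<close>, hence \<open>\<delta> / 2\<close> times the power \<gamma>
      dominates the power \<open>A\<close> there. The bound \<open>K\<close> does not depend on
      \<delta>.\<close>
    define X where "X = max (Re w) (max R (2 / \<delta>))"
    define S where "S = cbox (Complex x0 (-b)) (Complex X b)"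
    have S: "z \<in> S \<longleftrightarrow> x0 \<le> Re z \<and> Re z \<le> X \<and> \<bar>Im z\<bar> \<le> b" for z
      by (auto simp: S_def in_cbox_complex_iff)
    have nH: "norm (H z) \<le> norm (G z) * exp (- (C * norm z powr \<beta>) - \<delta> * (norm z powr \<gamma> / 2))" if "z \<in> S" for z
    proof -
      have "C * norm z powr \<beta> = (2 * C) * (norm z powr \<beta> / 2)" by simp
      also have "\<dots> \<le> (2 * C) * Re (z powr of_real \<beta>)"
        using that assms by (intro mult_left_mono strip) (auto simp: S)
      finally have "C * norm z powr \<beta> \<le> 2 * C * Re (z powr of_real \<beta>)" .
      moreover have "\<delta> * (norm z powr \<gamma> / 2) \<le> \<delta> * Re (z powr of_real \<gamma>)"
        using that \<delta> by (intro mult_left_mono strip) (auto simp: S)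
      ultimately show ?thesis
        unfolding H_def norm_mult norm_exp_eq_Re
        by (intro mult_left_mono) (auto simp: mult.assoc)
    qed
    have "H holomorphic_on S" unfolding H_def
      by (intro holomorphic_intros holomorphic_on_subset[OF G])
         (use x0 in \<open>auto simp: S complex_nonpos_Reals_iff\<close>)
    moreover have "norm (H z) \<le> K" if z: "z \<in> frontier S" for z
    proof -
      have zS: "z \<in> S" using z unfolding S_def by (simp add: frontier_cbox)
      hence S': "x0 \<le> Re z" "Re z \<le> X" "\<bar>Im z\<bar> \<le> b" by (auto simp: S)
      have z1: "norm z \<ge> Re z" by (rule complex_Re_le_cmod)
      have "\<not> (x0 < Re z \<and> Re z < X \<and> - b < Im z \<and> Im z < b)"
        using z unfolding S_def frontier_cbox by (auto simp: in_box_complex_iff)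
      hence "Re z = x0 \<or> Re z = X \<or> \<bar>Im z\<bar> = b" using S' by argo
      then consider "Re z = x0" | "Re z = X" | "\<bar>Im z\<bar> = b" by blast
      thus ?thesis
      proof cases
        case 1
        have "norm (G z) * exp (- (C * norm z powr \<beta>) - \<delta> * (norm z powr \<gamma> / 2)) \<le> K * 1"
        proof (rule mult_mono)
          have "0 \<le> C * norm z powr \<beta>" "0 \<le> \<delta> * norm z powr \<gamma>" using assms(3) \<delta> by simp_all
          thus "exp (- (C * norm z powr \<beta>) - \<delta> * (norm z powr \<gamma> / 2)) \<le> 1" by simp
        qed (use left[OF 1 S'(3)] in \<open>auto simp: K_def\<close>)
        thus ?thesis using nH[OF zS] by simp
      next
        case 2
        have n: "norm z \<ge> R" "norm z \<ge> 2 / \<delta>" "norm z > 0" using z1 2 S'(1) x0 by (auto simp: X_def)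
        have "norm z powr A * 2 \<le> norm z powr A * (\<delta> * norm z)"
          using n \<delta> by (intro mult_left_mono) (auto simp: divide_le_eq mult.commute)
        also have "\<dots> = \<delta> * norm z powr \<gamma>" using n by (simp add: \<gamma>_def powr_add)
        finally have le: "norm z powr A \<le> \<delta> * (norm z powr \<gamma> / 2)" by simp
        have "norm (G z) * exp (- (C * norm z powr \<beta>) - \<delta> * (norm z powr \<gamma> / 2))
           \<le> exp (norm z powr A) * exp (- (C * norm z powr \<beta>) - \<delta> * (norm z powr \<gamma> / 2))"
          using gr[OF n(1)] by (intro mult_right_mono) auto
        also have "\<dots> \<le> 1"
          using le mult_nonneg_nonneg[OF assms(3), of "norm z powr \<beta>"] by (simp flip: exp_add)
        finally show ?thesis using nH[OF zS] by (simp add: K_def)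
      next
        case 3
        have "norm (G z) * exp (- (C * norm z powr \<beta>) - \<delta> * (norm z powr \<gamma> / 2))
           \<le> exp (C * norm z powr \<beta>) * exp (- (C * norm z powr \<beta>) - \<delta> * (norm z powr \<gamma> / 2))"
          using bd[OF 3] x0 S' by (intro mult_right_mono) auto
        also have "\<dots> \<le> 1" using \<delta> by (simp flip: exp_add)
        finally show ?thesis using nH[OF zS] by (simp add: K_def)
      qed
    qed
    moreover have "w \<in> S" using w by (simp add: S X_def)
    ultimately have "norm (H w) \<le> K"
    proof (intro maximum_modulus_frontier[of H S K w])
      assume hol: "H holomorphic_on S"
      show "H holomorphic_on interior S" by (rule holomorphic_on_subset[OF hol interior_subset])
      show "continuous_on (closure S) H" "bounded S"
        using holomorphic_on_imp_continuous_on[OF hol] by (auto simp: S_def)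
    qed
    have "G w = H w * exp (of_real (2 * C) * w powr of_real \<beta> + of_real \<delta> * w powr of_real \<gamma>)"
      unfolding H_def by (simp add: mult.assoc flip: exp_add)
    hence "norm (G w) = norm (H w) * exp (2 * C * Re (w powr of_real \<beta>) + \<delta> * Re (w powr of_real \<gamma>))"
      by (simp add: norm_mult norm_exp_eq_Re)
    also have "\<dots> \<le> K * exp (2 * C * norm w powr \<beta> + \<delta> * norm w powr \<gamma>)"
    proof (intro mult_mono)
      have "Re (w powr of_real c) \<le> norm w powr c" for c
        using complex_Re_le_cmod[of "w powr of_real c"] by (simp add: norm_powr_real_powr')
      thus "exp (2 * C * Re (w powr of_real \<beta>) + \<delta> * Re (w powr of_real \<gamma>)) \<le> exp (2 * C * norm w powr \<beta> + \<delta> * norm w powr \<gamma>)"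
        using assms \<delta> by (simp add: add_mono mult_left_mono)
    qed (use \<open>norm (H w) \<le> K\<close> in \<open>auto simp: K_def\<close>)
    finally show ?thesis .
  qed
  show ?thesis
  proof (rule exI[of _ "K + 2 * C"], rule exI[of _ x0], intro allI impI)
    fix w assume w: "\<bar>Im w\<bar> \<le> b" "Re w \<ge> x0"
    have lim: "((\<lambda>\<delta>. K * exp (2 * C * norm w powr \<beta> + \<delta> * norm w powr \<gamma>)) \<longlongrightarrow>
        K * exp (2 * C * norm w powr \<beta> + 0 * norm w powr \<gamma>)) (at_right 0)"
      by (intro tendsto_intros)
    have "norm (G w) \<le> K * exp (2 * C * norm w powr \<beta> + 0 * norm w powr \<gamma>)"
    proof (rule tendsto_lowerbound[OF lim])
      show "\<forall>\<^sub>F \<delta> in at_right 0. norm (G w) \<le> K * exp (2 * C * norm w powr \<beta> + \<delta> * norm w powr \<gamma>)"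
        using eventually_at_right_less[of "0::real"] by (rule eventually_mono) (rule key[OF w])
    qed simp
    \<comment> \<open>As \<open>norm w \<ge> 1\<close> here, the constant \<open>K\<close> is
      absorbed into the exponent.\<close>
    also have "\<dots> \<le> exp (K * norm w powr \<beta>) * exp (2 * C * norm w powr \<beta>)"
    proof -
      have "norm w \<ge> 1" using complex_Re_le_cmod[of w] w x0 by linarith
      hence "1 \<le> norm w powr \<beta>" using assms by (intro ge_one_powr_ge_zero) auto
      hence "K * 1 \<le> K * norm w powr \<beta>" by (intro mult_left_mono) (auto simp: K_def)
      also have "\<dots> \<le> exp (K * norm w powr \<beta>)" using exp_ge_add_one_self[of "K * norm w powr \<beta>"] by linarith
      finally show ?thesis by (intro mult_mono) auto
    qed
    also have "\<dots> = exp ((K + 2 * C) * norm w powr \<beta>)" by (simp add: algebra_simps flip: exp_add)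
    finally show "norm (G w) \<le> exp ((K + 2 * C) * norm w powr \<beta>)" .
  qed
qed

section \<open>Growth of the Gamma function\<close>

text \<open>The base \<open>1 + norm s\<close> keeps the power at least 1 for nonnegative exponents,
  so constants belong to the class and affine substitutions only change \<open>C\<close>.\<close>

definition exp_growth :: "real \<Rightarrow> complex set \<Rightarrow> (complex \<Rightarrow> complex) \<Rightarrow> bool" where
  "exp_growth \<beta> S f \<longleftrightarrow> (\<exists>C\<ge>0. \<forall>s\<in>S. norm (f s) \<le> exp (C * (1 + norm s) powr \<beta>))"

lemma exp_growth_bounded:
  assumes "\<And>s. s \<in> S \<Longrightarrow> norm (f s) \<le> M" "\<beta> \<ge> 0"
  shows "exp_growth \<beta> S f"
  unfolding exp_growth_def
proof (intro exI[of _ "max M 0"] conjI ballI)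
  fix s assume s: "s \<in> S"
  have 1: "1 \<le> (1 + norm s) powr \<beta>" using assms(2) by (intro ge_one_powr_ge_zero) auto
  have "norm (f s) \<le> max M 0 * 1" using assms(1)[OF s] by simp
  also have "\<dots> \<le> max M 0 * (1 + norm s) powr \<beta>" using 1 by (intro mult_left_mono) auto
  also have "\<dots> \<le> exp (max M 0 * (1 + norm s) powr \<beta>)"
    using exp_ge_add_one_self[of "max M 0 * (1 + norm s) powr \<beta>"] by linarith
  finally show "norm (f s) \<le> exp (max M 0 * (1 + norm s) powr \<beta>)" .
qed simp

lemma exp_growth_mult:
  assumes "exp_growth \<beta> S f" "exp_growth \<beta> S g"
  shows "exp_growth \<beta> S (\<lambda>s. f s * g s)"
proof -
  obtain C D where C: "C \<ge> 0" "D \<ge> 0" "\<And>s. s \<in> S \<Longrightarrow> norm (f s) \<le> exp (C * (1 + norm s) powr \<beta>)"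
    "\<And>s. s \<in> S \<Longrightarrow> norm (g s) \<le> exp (D * (1 + norm s) powr \<beta>)"
    using assms unfolding exp_growth_def by blast
  show ?thesis unfolding exp_growth_def
  proof (intro exI[of _ "C + D"] conjI ballI)
    fix s assume s: "s \<in> S"
    have "norm (f s * g s) \<le> exp (C * (1 + norm s) powr \<beta>) * exp (D * (1 + norm s) powr \<beta>)"
      unfolding norm_mult using C(3,4)[OF s] by (intro mult_mono) auto
    thus "norm (f s * g s) \<le> exp ((C + D) * (1 + norm s) powr \<beta>)"
      by (simp add: algebra_simps flip: exp_add)
  qed (use C in auto)
qed

lemma exp_growth_prod:
  assumes "finite A" "\<And>j. j \<in> A \<Longrightarrow> exp_growth \<beta> S (f j)" "\<beta> \<ge> 0"
  shows "exp_growth \<beta> S (\<lambda>s. \<Prod>j\<in>A. f j s)"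
  using assms(1,2)
proof (induction A rule: finite_induct)
  case empty
  show ?case using assms(3) by (intro exp_growth_bounded[of _ _ 1]) auto
next
  case (insert j A)
  thus ?case by (simp add: exp_growth_mult)
qed

lemma exp_growth_le:
  assumes "exp_growth \<beta> S f" "\<And>s. s \<in> T \<Longrightarrow> s \<in> S \<and> norm (g s) \<le> norm (f s)"
  shows "exp_growth \<beta> T g"
proof -
  obtain C where C: "C \<ge> 0" "\<And>s. s \<in> S \<Longrightarrow> norm (f s) \<le> exp (C * (1 + norm s) powr \<beta>)"
    using assms(1) unfolding exp_growth_def by blast
  show ?thesis unfolding exp_growth_def
    using C(1) assms(2) C(2) by (intro exI[of _ C] conjI ballI) (auto intro: order_trans)
qed

lemma exp_growth_compose:
  assumes "exp_growth \<beta> T f" "\<And>s. s \<in> S \<Longrightarrow> \<phi> s \<in> T" "\<And>s. s \<in> S \<Longrightarrow> 1 + norm (\<phi> s) \<le> c * (1 + norm s)" "c \<ge> 0" "\<beta> \<ge> 0"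
  shows "exp_growth \<beta> S (\<lambda>s. f (\<phi> s))"
proof -
  obtain C where C: "C \<ge> 0" "\<And>s. s \<in> T \<Longrightarrow> norm (f s) \<le> exp (C * (1 + norm s) powr \<beta>)"
    using assms(1) unfolding exp_growth_def by blast
  show ?thesis unfolding exp_growth_def
  proof (intro exI[of _ "C * c powr \<beta>"] conjI ballI)
    fix s assume s: "s \<in> S"
    have "(1 + norm (\<phi> s)) powr \<beta> \<le> (c * (1 + norm s)) powr \<beta>"
      using assms(3)[OF s] assms(5) by (intro powr_mono2) auto
    also have "\<dots> = c powr \<beta> * (1 + norm s) powr \<beta>" by (rule powr_mult)
    finally have "C * (1 + norm (\<phi> s)) powr \<beta> \<le> C * (c powr \<beta> * (1 + norm s) powr \<beta>)"
      using C(1) by (intro mult_left_mono)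
    hence "exp (C * (1 + norm (\<phi> s)) powr \<beta>) \<le> exp (C * c powr \<beta> * (1 + norm s) powr \<beta>)"
      by (simp add: mult.assoc)
    thus "norm (f (\<phi> s)) \<le> exp (C * c powr \<beta> * (1 + norm s) powr \<beta>)"
      using C(2)[OF assms(2)[OF s]] by linarith
  qed (use C in auto)
qed

lemma exp_growth_exp:
  assumes "\<beta> \<ge> 1" "\<And>s. s \<in> S \<Longrightarrow> norm (\<phi> s) \<le> c * (1 + norm s)" "c \<ge> 0"
  shows "exp_growth \<beta> S (\<lambda>s. exp (\<phi> s))"
  unfolding exp_growth_def
proof (intro exI[of _ c] conjI ballI)
  fix s assume s: "s \<in> S"
  have "Re (\<phi> s) \<le> c * (1 + norm s)" using complex_Re_le_cmod[of "\<phi> s"] assms(2)[OF s] by linarith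
  also have "\<dots> \<le> c * (1 + norm s) powr \<beta>"
    using assms(1,3) powr_mono[of 1 \<beta> "1 + norm s"] by (intro mult_left_mono) auto
  finally show "norm (exp (\<phi> s)) \<le> exp (c * (1 + norm s) powr \<beta>)" by (simp add: norm_exp_eq_Re)
qed (use assms in auto)

lemma norm_Gamma_le_Gamma_Re:
  assumes "Re z > 0"
  shows "norm (Gamma z) \<le> Gamma (Re z)"
proof -
  have c: "((\<lambda>t. complex_of_real t powr (z - 1) / of_real (exp t)) has_integral Gamma z) {0..}"
    using assms by (rule Gamma_integral_complex)
  have r: "((\<lambda>t. t powr (Re z - 1) / exp t) has_integral Gamma (Re z)) {0..}"
    using assms by (rule Gamma_integral_real)
  show ?thesis
    unfolding integral_unique[OF c, symmetric] integral_unique[OF r, symmetric]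
    by (rule integral_norm_bound_integral)
       (use c r in \<open>auto simp: norm_divide norm_powr_real_powr intro: has_integral_integrable\<close>)
qed

text \<open>The recursion leads back to the interval from 1 to 2, and each of the at most
  \<open>x - 1\<close> steps costs a factor at most \<open>x\<close>. The loss against Stirling's
  formula is harmless, as only exponents above 1 are claimed later.\<close>

lemma Gamma_real_le_powr:
  "\<exists>K>0. \<forall>x\<ge>1. Gamma x \<le> K * x powr (x::real)"
proof -
  have "compact ((Gamma :: real \<Rightarrow> real) ` {1..2})"
    by (intro compact_continuous_image continuous_intros) (auto simp: nonpos_Ints_def)
  then obtain K0 where K0: "\<And>z. z \<in> (Gamma :: real \<Rightarrow> real) ` {1..2} \<Longrightarrow> norm z \<le> K0"
    using compact_imp_bounded bounded_iff by metis
  define K where "K = max 1 K0"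
  have *: "Gamma x \<le> K * x ^ n" if "x \<in> {real n + 1..real n + 2}" for n and x :: real
    using that
  proof (induction n arbitrary: x)
    case 0
    thus ?case using K0[of "Gamma x"] by (auto simp: K_def le_max_iff_disj)
  next
    case (Suc n)
    have "Gamma (x - 1) \<le> K * (x - 1) ^ n" using Suc.prems by (intro Suc.IH) auto
    moreover have "Gamma x = (x - 1) * Gamma (x - 1)"
      using Gamma_plus1[of "x - 1"] Suc.prems nonpos_Ints_nonpos[of "x - 1"] by auto
    ultimately have "Gamma x \<le> (x - 1) * (K * (x - 1) ^ n)"
      using Suc.prems by (simp add: mult_left_mono)
    also have "\<dots> \<le> x * (K * x ^ n)"
      using Suc.prems by (intro mult_mono power_mono) (auto simp: K_def)
    finally show ?case by (simp add: algebra_simps)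
  qed
  show ?thesis
  proof (intro exI[of _ K] conjI allI impI)
    show "K > 0" by (simp add: K_def)
    fix x :: real assume x: "x \<ge> 1"
    define n where "n = nat \<lfloor>x - 1\<rfloor>"
    have n: "real n \<le> x - 1" "x - 1 < real n + 1" using x by (auto simp: n_def)
    hence "Gamma x \<le> K * x ^ n" by (intro *) auto
    also have "\<dots> \<le> K * x powr x"
    proof (intro mult_left_mono)
      have "x ^ n = x powr real n" using x by (simp add: powr_realpow)
      also have "\<dots> \<le> x powr x" using x n by (intro powr_mono) auto
      finally show "x ^ n \<le> x powr x" .
    qed (simp add: K_def)
    finally show "Gamma x \<le> K * x powr x" .
  qed
qed

lemma exp_growth_Gamma:
  assumes \<beta>: "\<beta> > 1"
  shows "exp_growth \<beta> {s. Re s \<ge> 1} Gamma"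
proof -
  obtain K :: real where K: "K > 0" "\<And>x::real. x \<ge> 1 \<Longrightarrow> Gamma x \<le> K * x powr x"
    using Gamma_real_le_powr by blast
  \<comment> \<open>The constant of the inequality
    \<open>ln x \<le> x powr (\<beta> - 1) / (\<beta> - 1)\<close>, which turns
    \<open>x * ln x\<close> into a multiple of \<open>x powr \<beta>\<close>.\<close>
  define C where "C = 1 / (\<beta> - 1)"
  have C: "C > 0" using \<beta> by (simp add: C_def)
  have le: "norm (Gamma s) \<le> norm (complex_of_real K * exp (complex_of_real (C * (norm s) powr \<beta>)))" if "s \<in> {s. Re s \<ge> 1}" for s
  proof -
    define x where "x = Re s"
    have x: "x \<ge> 1" "x \<le> norm s" using that complex_Re_le_cmod[of s] by (auto simp: x_def)
    have "norm (Gamma s) \<le> Gamma x" unfolding x_def by (rule norm_Gamma_le_Gamma_Re) (use that in auto)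
    also have "\<dots> \<le> K * x powr x" by (rule K(2)[OF x(1)])
    also have "x powr x = exp (x * ln x)" using x by (simp add: powr_def)
    also have "x * ln x \<le> x * (x powr (\<beta> - 1) / (\<beta> - 1))"
      using x \<beta> by (intro mult_left_mono ln_powr_bound) auto
    also have "\<dots> = C * x powr \<beta>" using x \<beta> by (simp add: C_def powr_diff)
    also have "\<dots> \<le> C * norm s powr \<beta>" using x \<beta> C by (intro mult_left_mono powr_mono2) auto
    finally show ?thesis using K(1) by (simp add: norm_mult norm_exp_eq_Re)
  qed
  have "exp_growth \<beta> {s. Re s \<ge> 1} (\<lambda>s. complex_of_real K * exp (complex_of_real (C * (norm s) powr \<beta>)))"
  proof (rule exp_growth_mult)
    show "exp_growth \<beta> {s. Re s \<ge> 1} (\<lambda>_. complex_of_real K)" using \<beta> by (intro exp_growth_bounded[of _ _ K]) (use K in auto)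
    have "C * norm s powr \<beta> \<le> C * (1 + norm s) powr \<beta>" for s :: complex
      using C \<beta> by (intro mult_left_mono powr_mono2) auto
    thus "exp_growth \<beta> {s. Re s \<ge> 1} (\<lambda>s. exp (complex_of_real (C * (norm s) powr \<beta>)))"
      unfolding exp_growth_def using C by (intro exI[of _ C]) (auto simp: norm_exp_eq_Re)
  qed
  thus ?thesis by (rule exp_growth_le) (use le in blast)
qed

text \<open>By the reflection formula \<open>rGamma s\<close> is \<open>sin (pi s) / pi\<close>
  times \<open>Gamma (1 - s)\<close>. The sine grows at most exponentially, and \<open>1 - s\<close>
  lies in the half plane where Gamma is already estimated.\<close>

lemma exp_growth_rGamma:
  assumes \<beta>: "\<beta> > 1"
  shows "exp_growth \<beta> {s. Re s \<le> 0} rGamma"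
proof -
  have tri: "1 + norm (1 - s) \<le> 2 * (1 + norm s)" for s :: complex
    using norm_triangle_ineq4[of 1 s] norm_ge_zero[of s] by (simp del: norm_ge_zero)
  have eq: "rGamma s = sin (of_real pi * s) / of_real pi * Gamma (1 - s)" if "s \<in> {s. Re s \<le> 0}" for s
  proof -
    have "1 - s \<notin> \<int>\<^sub>\<le>\<^sub>0" using that by (auto elim!: nonpos_Ints_cases simp: complex_eq_iff)
    hence "rGamma (1 - s) * Gamma (1 - s) = 1"
      by (simp add: rGamma_inverse_Gamma Gamma_eq_zero_iff)
    hence "rGamma s = (rGamma s * rGamma (1 - s)) * Gamma (1 - s)" by (simp only: mult.assoc mult_1_right)
    thus ?thesis by (simp only: rGamma_reflection_complex)
  qed
  have "exp_growth \<beta> {s. Re s \<le> 0} (\<lambda>s. sin (of_real pi * s) / of_real pi * Gamma (1 - s))"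
  proof (rule exp_growth_mult)
    show "exp_growth \<beta> {s. Re s \<le> 0} (\<lambda>s. Gamma (1 - s))"
      by (rule exp_growth_compose[OF exp_growth_Gamma[OF \<beta>], of _ _ 2]) (use \<beta> tri in \<open>auto simp del: distrib_left_numeral\<close>)
    have "exp_growth \<beta> {s. Re s \<le> 0} (\<lambda>s. exp (of_real (norm (of_real pi * s))))"
      by (rule exp_growth_exp[of _ _ _ pi]) (use \<beta> in \<open>auto simp: norm_mult\<close>)
    thus "exp_growth \<beta> {s. Re s \<le> 0} (\<lambda>s. sin (of_real pi * s) / of_real pi)"
    proof (rule exp_growth_le)
      fix s :: complex assume "s \<in> {s. Re s \<le> 0}"
      define w where "w = of_real pi * s"
      have "sin w = (exp (\<i> * w) - exp (- (\<i> * w))) / (2 * \<i>)" by (rule sin_exp_eq)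
      hence "norm (sin w) = norm (exp (\<i> * w) - exp (- (\<i> * w))) / 2" by (simp add: norm_divide norm_mult)
      also have "\<dots> \<le> (norm (exp (\<i> * w)) + norm (exp (- (\<i> * w)))) / 2"
        by (intro divide_right_mono norm_triangle_ineq4) auto
      also have "\<dots> \<le> (exp (norm w) + exp (norm w)) / 2"
        using abs_Im_le_cmod[of w] by (intro divide_right_mono add_mono) (auto simp: norm_exp_eq_Re)
      finally have "norm (sin w) \<le> exp (norm w)" by simp
      moreover have "norm (sin w) / pi \<le> norm (sin w) / 1" using pi_gt3 by (intro divide_left_mono) auto
      ultimately show "s \<in> {s. Re s \<le> 0} \<and> norm (sin (of_real pi * s) / of_real pi) \<le> norm (exp (complex_of_real (norm (of_real pi * s))))"
        using \<open>s \<in> _\<close> by (simp add: norm_divide w_def norm_exp_eq_Re)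
    qed
  qed
  thus ?thesis by (rule exp_growth_le) (simp add: eq)
qed

section \<open>Growth of L-functions\<close>

lemma extended_selberg_classD:
  assumes "L \<in> extended_selberg_class"
  shows "L meromorphic_on UNIV" "\<And>s. s \<noteq> 1 \<Longrightarrow> L analytic_on {s}"
proof -
  show mero: "L meromorphic_on UNIV"
    using assms by (simp add: extended_selberg_class_def nicely_meromorphic_on_def)
  obtain k F where F: "F holomorphic_on UNIV" "\<And>s. s \<noteq> 1 \<Longrightarrow> F s = (s - 1) ^ k * L s"
    using assms unfolding extended_selberg_class_def by auto
  have "(\<lambda>s. F s / (s - 1) ^ k) holomorphic_on - {1}"
    using F(1) by (intro holomorphic_intros) (auto intro: holomorphic_on_subset)
  hence "L holomorphic_on - {1}"
    by (rule holomorphic_transform) (use F(2) in auto)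
  thus "L analytic_on {s}" if "s \<noteq> 1" for s
    using that by (intro holomorphic_on_imp_analytic_at[of L "- {1}"]) auto
qed

text \<open>Every term after the first has base at least 2, so \<open>2 powr (2 - Re s)\<close> can
  be taken out and the convergent series at exponent 2 remains; the factor 4 in the witness is
  \<open>2 powr 2\<close>.\<close>

lemma extended_selberg_class_right:
  assumes "L \<in> extended_selberg_class"
  shows "\<exists>C\<ge>0. \<forall>s. Re s \<ge> 2 \<longrightarrow> norm (L s - 1) \<le> C * 2 powr (- Re s)"
proof -
  obtain a where a: "a 1 = 1" "ramanujan_hypothesis a"
    "\<And>s. Re s > 1 \<Longrightarrow> (\<lambda>n. a (Suc n) / of_nat (Suc n) powr s) sums L s"
    using assms unfolding extended_selberg_class_def by auto
  \<comment> \<open>With \<epsilon> = 1/2 the series at exponent 2 is dominated by the sum of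
    \<open>n powr (-3/2)\<close>.\<close>
  have "(\<lambda>n. norm (a n)) \<in> O(\<lambda>n. real n powr (1/2))"
    using a(2) unfolding ramanujan_hypothesis_def by simp
  then obtain c where c: "c > 0" "eventually (\<lambda>n. norm (norm (a n)) \<le> c * norm (real n powr (1/2))) sequentially"
    by (elim landau_o.bigE)
  have "summable (\<lambda>n. norm (a n) * real n powr (-2))"
  proof (rule summable_comparison_test_ev)
    show "\<forall>\<^sub>F n in sequentially. norm (norm (a n) * real n powr (-2)) \<le> c * real n powr (- (3/2))"
      using c(2) eventually_gt_at_top[of 0]
    proof eventually_elim
      case (elim n)
      have "norm (a n) * real n powr (-2) \<le> (c * real n powr (1/2)) * real n powr (-2)"
        using elim by (intro mult_right_mono) auto
      also have "\<dots> = c * real n powr (- (3/2))"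
        by (simp add: mult.assoc flip: powr_add)
      finally show ?case by simp
    qed
    show "summable (\<lambda>n. c * real n powr (- (3/2)))"
      by (intro summable_mult) (simp add: summable_real_powr_iff)
  qed
  hence S: "summable (\<lambda>n. norm (a (n + 2)) * real (n + 2) powr (-2))"
    by (rule summable_ignore_initial_segment)
  define M where "M = (\<Sum>n. norm (a (n + 2)) * real (n + 2) powr (-2))"
  have M: "M \<ge> 0" unfolding M_def by (intro suminf_nonneg S) auto
  show ?thesis
  proof (intro exI[of _ "M * 4"] conjI allI impI)
    fix s assume s: "Re s \<ge> 2"
    have "(\<lambda>n. a (Suc n) / of_nat (Suc n) powr s) sums L s" by (rule a(3)) (use s in auto)
    hence "(\<lambda>n. a (Suc (Suc n)) / of_nat (Suc (Suc n)) powr s) sums (L s - a (Suc 0) / of_nat (Suc 0) powr s)"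
      by (subst sums_Suc_iff)  simp
    hence sums: "(\<lambda>n. a (n + 2) / of_nat (n + 2) powr s) sums (L s - 1)" using a(1) by simp
    have le: "norm (a (n + 2) / of_nat (n + 2) powr s) \<le> (norm (a (n + 2)) * real (n + 2) powr (-2)) * 2 powr (2 - Re s)" for n
    proof -
      have "norm (of_nat (n + 2) powr s) = real (n + 2) powr Re s"
        by (subst norm_powr_real_powr) auto
      hence "norm (a (n + 2) / of_nat (n + 2) powr s) = norm (a (n + 2)) * real (n + 2) powr (-2 + (2 - Re s))"
        by (simp add: norm_divide powr_minus field_simps)
      also have "\<dots> = norm (a (n + 2)) * real (n + 2) powr (-2) * real (n + 2) powr (2 - Re s)"
        by (subst powr_add) simp
      also have "real (n + 2) powr (2 - Re s) \<le> 2 powr (2 - Re s)"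
        using s by (intro powr_mono2') auto
      finally show ?thesis by (simp add: mult_left_mono)
    qed
    have "norm (L s - 1) \<le> (\<Sum>n. (norm (a (n + 2)) * real (n + 2) powr (-2)) * 2 powr (2 - Re s))"
      unfolding sums_unique[OF sums] using le S by (intro norm_suminf_le summable_mult2)
    also have "\<dots> = M * 2 powr (2 - Re s)" unfolding M_def by (rule suminf_mult2[symmetric, OF S])
    also have "\<dots> = M * 4 * 2 powr (- Re s)" by (simp add: powr_diff powr_minus field_simps)
    finally show "norm (L s - 1) \<le> M * 4 * 2 powr (- Re s)" .
  qed (use M in auto)
qed

lemma norm_affine_le:
  fixes l :: real and m s :: complex
  assumes "l \<ge> 0"
  shows "1 + norm (of_real l * s + m) \<le> (1 + l + norm m) * (1 + norm s)"
proof -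
  have "norm (of_real l * s + m) \<le> l * norm s + norm m"
    using norm_triangle_ineq[of "of_real l * s" m] assms by (simp add: norm_mult)
  moreover have "0 \<le> norm m * norm s" "0 \<le> norm s" by auto
  moreover have "(1 + l + norm m) * (1 + norm s) = 1 + l + norm m + norm s + l * norm s + norm m * norm s"
    by (simp add: algebra_simps)
  ultimately show ?thesis using assms by linarith
qed

text \<open>The functional equation expresses the modulus of \<open>L s\<close> through
  \<open>L (1 - cnj s)\<close>, which is bounded, a power of \<open>Q\<close> and a quotient of
  Gamma factors.\<close>

lemma extended_selberg_class_left:
  assumes L: "L \<in> extended_selberg_class" and \<beta>: "\<beta> > 1"
  shows "\<exists>B. exp_growth \<beta> {s. Re s < - B} L"
proof -
  obtain Q \<omega> K lam mu where "selberg_functional_equation L Q \<omega> K lam mu"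
    using L unfolding extended_selberg_class_def by auto
  hence Q: "Q > 0" and \<omega>: "norm \<omega> = 1" and lam: "\<And>j. j \<in> {1..K} \<Longrightarrow> lam j > 0"
    and mu: "\<And>j. j \<in> {1..K} \<Longrightarrow> Re (mu j) \<ge> 0"
    and eq: "\<forall>\<^sub>\<approx>s. completed_L L Q K lam mu s = \<omega> * cnj (completed_L L Q K lam mu (1 - cnj s))"
    unfolding selberg_functional_equation_def by auto
  \<comment> \<open>Left of \<open>- B\<close> every argument \<open>lam j * s + mu j\<close> has
    nonpositive real part and every reflected argument has real part at least 1;
    \<open>B \<ge> 1\<close> puts \<open>1 - cnj s\<close> into the half plane
    \<open>Re \<ge> 2\<close>.\<close>
  define B where "B = Max (insert 1 ((\<lambda>j. (1 + Re (mu j)) / lam j) ` {1..K}))"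
  have B1: "B \<ge> 1" unfolding B_def by (intro Max_ge) auto
  have B: "1 + Re (mu j) \<le> lam j * B" if "j \<in> {1..K}" for j
  proof -
    have "(1 + Re (mu j)) / lam j \<le> B" unfolding B_def using that by (intro Max_ge) auto
    thus ?thesis using lam[OF that] by (simp add: divide_le_eq mult.commute)
  qed
  define S where "S = {s. Re s < - B}"
  obtain C where C: "C \<ge> 0" "\<And>s. Re s \<ge> 2 \<Longrightarrow> norm (L s - 1) \<le> C * 2 powr (- Re s)"
    using extended_selberg_class_right[OF L] by blast
  \<comment> \<open>The functional equation solved for the modulus of \<open>L\<close>. The Gamma
    factors of the left-hand side appear as \<open>rGamma\<close>, so no division by a default value
    occurs; both powers of \<open>Q\<close> combine into one exponential.\<close>
  define h where "h = (\<lambda>s. L (1 - cnj s) * exp (of_real (ln Q * (1 - 2 * Re s))) *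
     ((\<Prod>j=1..K. Gamma (of_real (lam j) * (1 - cnj s) + mu j)) * (\<Prod>j=1..K. rGamma (of_real (lam j) * s + mu j))))"
  have h: "exp_growth \<beta> S h" unfolding h_def
  proof (intro exp_growth_mult exp_growth_prod)
    have "norm (L (1 - cnj s)) \<le> C + 1" if "s \<in> S" for s
    proof -
      have re: "Re (1 - cnj s) \<ge> 2" using that B1 by (simp add: S_def)
      have "norm (L (1 - cnj s)) \<le> norm (L (1 - cnj s) - 1) + 1"
        using norm_triangle_ineq[of "L (1 - cnj s) - 1" 1] by simp
      also have "norm (L (1 - cnj s) - 1) \<le> C * 2 powr (- Re (1 - cnj s))" by (rule C(2)[OF re])
      also have "\<dots> \<le> C * 2 powr 0" using re C(1) by (intro mult_left_mono powr_mono) auto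
      finally show ?thesis by simp
    qed
    thus "exp_growth \<beta> S (\<lambda>s. L (1 - cnj s))" using \<beta> by (intro exp_growth_bounded[of _ _ "C + 1"]) auto
    show "exp_growth \<beta> S (\<lambda>s. exp (of_real (ln Q * (1 - 2 * Re s))))"
    proof (rule exp_growth_exp[of _ _ _ "2 * \<bar>ln Q\<bar>"])
      fix s :: complex
      have "\<bar>1 - 2 * Re s\<bar> \<le> 2 * (1 + norm s)"
        using abs_Re_le_cmod[of s] by (simp add: abs_le_iff)
      from mult_left_mono[OF this, of "\<bar>ln Q\<bar>"]
      show "norm (complex_of_real (ln Q * (1 - 2 * Re s))) \<le> 2 * \<bar>ln Q\<bar> * (1 + norm s)"
        by (simp only: norm_of_real abs_mult) (simp add: mult_ac)
    qed (use \<beta> in auto)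
    fix j assume j: "j \<in> {1..K}"
    show "exp_growth \<beta> S (\<lambda>s. rGamma (of_real (lam j) * s + mu j))"
    proof (rule exp_growth_compose[OF exp_growth_rGamma[OF \<beta>]])
      fix s assume "s \<in> S"
      hence "lam j * Re s \<le> lam j * (- B)" using lam[OF j] by (intro mult_left_mono) (auto simp: S_def)
      thus "of_real (lam j) * s + mu j \<in> {s. Re s \<le> 0}" using B[OF j] by simp
      show "1 + norm (of_real (lam j) * s + mu j) \<le> (1 + lam j + norm (mu j)) * (1 + norm s)"
        using lam[OF j] by (intro norm_affine_le) auto
    qed (use lam[OF j] \<beta> in auto)
    show "exp_growth \<beta> S (\<lambda>s. Gamma (of_real (lam j) * (1 - cnj s) + mu j))"
    proof (rule exp_growth_compose[OF exp_growth_Gamma[OF \<beta>]])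
      fix s assume "s \<in> S"
      hence "lam j * (- B) \<ge> lam j * Re s" using lam[OF j] by (intro mult_left_mono) (auto simp: S_def)
      thus "of_real (lam j) * (1 - cnj s) + mu j \<in> {s. Re s \<ge> 1}"
        using B[OF j] mu[OF j] lam[OF j] by (simp add: algebra_simps)
      have "1 + norm (of_real (lam j) * (1 - cnj s) + mu j) \<le> (1 + lam j + norm (mu j)) * (1 + norm (1 - cnj s))"
        using lam[OF j] by (intro norm_affine_le) auto
      also have "\<dots> \<le> (1 + lam j + norm (mu j)) * (2 * (1 + norm s))"
        using norm_triangle_ineq4[of 1 "cnj s"] norm_ge_zero[of s] lam[OF j] norm_ge_zero[of "mu j"]
        by (intro mult_left_mono) (simp_all del: norm_ge_zero)
      finally show "1 + norm (of_real (lam j) * (1 - cnj s) + mu j) \<le> (1 + lam j + norm (mu j)) * 2 * (1 + norm s)"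
        by (simp only: mult.assoc)
    qed (use lam[OF j] \<beta> in auto)
  qed (use \<beta> in auto)
  have rG: "\<forall>\<^sub>\<approx>s. rGamma (of_real (lam j) * s + mu j) \<noteq> 0" if "j \<in> {1..K}" for j
  proof -
    define q where "q = (\<lambda>s. rGamma (of_real (lam j) * s + mu j))"
    have qh: "q holomorphic_on UNIV" unfolding q_def by (intro holomorphic_intros)
    hence "q meromorphic_on UNIV" by (intro analytic_on_imp_meromorphic_on) (simp add: analytic_on_open)
    moreover have "\<not> (\<forall>\<^sub>\<approx>s. q s = 0)"
    proof
      assume ev: "\<forall>\<^sub>\<approx>s. q s = 0"
      \<comment> \<open>At this point the argument of \<open>rGamma\<close> is 1, where its value is
        1.\<close>
      have "q ((1 - mu j) / of_real (lam j)) = 0"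
        by (rule isCont_cosparse_eq[where f = q and g = "\<lambda>_. 0", OF _ _ ev])
           (use holomorphic_on_imp_continuous_on[OF qh] in \<open>auto simp: continuous_on_eq_continuous_at\<close>)
      thus False using lam[OF that] by (simp add: q_def)
    qed
    ultimately show ?thesis using meromorphic_eventually_zero_or_nonzero unfolding q_def by blast
  qed
  have "\<forall>\<^sub>\<approx>s. \<forall>j\<in>{1..K}. rGamma (of_real (lam j) * s + mu j) \<noteq> 0"
    by (intro eventually_ball_finite) (auto intro: rG)
  with eq have ev: "\<forall>\<^sub>\<approx>s. norm (L s) = norm (h s)"
  proof eventually_elim
    case (elim s)
    define P where "P = (\<Prod>j=1..K. Gamma (of_real (lam j) * s + mu j))"
    define R where "R = (\<Prod>j=1..K. rGamma (of_real (lam j) * s + mu j))"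
    define P' where "P' = (\<Prod>j=1..K. Gamma (of_real (lam j) * (1 - cnj s) + mu j))"
    have PR: "P * R = 1"
      unfolding P_def R_def prod.distrib[symmetric]
      by (rule prod.neutral) (use elim(2) in \<open>auto simp: rGamma_inverse_Gamma\<close>)
    have "L s * of_real Q powr s * P = \<omega> * cnj (L (1 - cnj s) * of_real Q powr (1 - cnj s) * P')"
      using elim(1) by (simp only: completed_L_def P_def P'_def)
    hence "norm (L s) * norm (of_real Q powr s) * norm P = norm (L (1 - cnj s)) * norm (of_real Q powr (1 - cnj s)) * norm P'"
      using \<omega> by (metis complex_mod_cnj mult_1 norm_mult)
    moreover have "norm (of_real Q powr w) = exp (ln Q * Re w)" for w
      using Q by (simp add: norm_powr_real_powr powr_def mult.commute)
    ultimately have e: "norm (L s) * exp (ln Q * Re s) * norm P = norm (L (1 - cnj s)) * exp (ln Q * (1 - Re s)) * norm P'"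
      by simp
    have "norm (L s) = norm (L s) * (exp (ln Q * Re s) * exp (- (ln Q * Re s))) * norm (P * R)"
      unfolding PR by (simp flip: exp_add)
    also have "\<dots> = (norm (L s) * exp (ln Q * Re s) * norm P) * (exp (- (ln Q * Re s)) * norm R)"
      by (simp add: norm_mult)
    also have "\<dots> = norm (L (1 - cnj s)) * (exp (ln Q * (1 - Re s)) * exp (- (ln Q * Re s))) * (norm P' * norm R)"
      unfolding e by simp
    also have "exp (ln Q * (1 - Re s)) * exp (- (ln Q * Re s)) = exp (ln Q * (1 - 2 * Re s))"
      by (simp add: algebra_simps flip: exp_add)
    finally show ?case
      unfolding h_def P_def[symmetric] R_def[symmetric] P'_def[symmetric]
      by (simp only: norm_mult norm_exp_eq_Re Re_complex_of_real)
  qed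
  obtain D where D: "D \<ge> 0" "\<And>s. s \<in> S \<Longrightarrow> norm (h s) \<le> exp (D * (1 + norm s) powr \<beta>)"
    using h unfolding exp_growth_def by auto
  \<comment> \<open>The modulus identity only holds off a sparse set; continuity of \<open>L\<close>
    away from 1 extends the bound to all of \<open>S\<close>.\<close>
  have "norm (L s) \<le> exp (D * (1 + norm s) powr \<beta>)" if s: "s \<in> S" for s
  proof (rule tendsto_le[of "at s"])
    have "s \<noteq> 1" using s B1 by (auto simp: S_def)
    hence "isCont L s" by (intro analytic_at_imp_isCont extended_selberg_classD(2)[OF L])
    thus "((\<lambda>s. norm (L s)) \<longlongrightarrow> norm (L s)) (at s)" by (intro tendsto_norm) (simp add: isCont_def)
    show "((\<lambda>s. exp (D * (1 + norm s) powr \<beta>)) \<longlongrightarrow> exp (D * (1 + norm s) powr \<beta>)) (at s)"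
      by (intro tendsto_intros) (use \<beta> in simp)
    have "open S" unfolding S_def by (rule open_halfspace_Re_lt)
    hence "eventually (\<lambda>x. x \<in> S) (at s)" using s by (rule eventually_at_in_open')
    with eventually_cosparse_UNIV_at[OF ev, of s]
    show "\<forall>\<^sub>F x in at s. norm (L x) \<le> exp (D * (1 + norm x) powr \<beta>)"
      by eventually_elim (use D(2) in auto)
  qed auto
  hence "exp_growth \<beta> {s. Re s < - B} L" unfolding exp_growth_def S_def using D(1) by blast
  thus ?thesis by blast
qed

section \<open>Passing between the order and power bounds\<close>

lemma nev_order_less_imp:
  assumes "nev_order f < ereal l"
  shows "\<exists>R\<ge>1. \<forall>r\<ge>R. nev_T r f \<le> r powr l"
proof -
  have "eventually (\<lambda>r. ereal (log_plus (nev_T r f) / ln r) < ereal l) at_top"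
    using Limsup_lessD[OF assms[unfolded nev_order_def]] .
  with eventually_gt_at_top[of 1] have "eventually (\<lambda>r. nev_T r f \<le> r powr l) at_top"
  proof eventually_elim
    case (elim r)
    have "log_plus (nev_T r f) \<le> l * ln r" using elim by (simp add: divide_less_eq)
    hence "exp (log_plus (nev_T r f)) \<le> r powr l" using elim by (simp add: powr_def)
    thus ?case using le_exp_log_plus[of "nev_T r f"] by linarith
  qed
  then obtain R where R: "\<And>r. r \<ge> R \<Longrightarrow> nev_T r f \<le> r powr l" unfolding eventually_at_top_linorder by blast
  thus ?thesis by (intro exI[of _ "max R 1"]) auto
qed

lemma eventually_powr_ge:
  assumes e: "e > 0"
  shows "eventually (\<lambda>r::real. r powr e \<ge> c) at_top"
  using eventually_ge_at_top[of "(max c 1) powr (1 / e)"]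
proof eventually_elim
  case (elim r)
  have "c \<le> ((max c 1) powr (1 / e)) powr e" using e by (simp add: powr_powr)
  also have "\<dots> \<le> r powr e" using elim e by (intro powr_mono2) auto
  finally show ?case .
qed

text \<open>An arbitrarily small increase of the exponent absorbs the constant
  \<open>C\<close>.\<close>

lemma nev_order_le:
  assumes le: "eventually (\<lambda>r. nev_T r f \<le> C * r powr \<mu>) at_top" and "\<mu> \<ge> 0"
  shows "nev_order f \<le> ereal \<mu>"
proof (rule ereal_le_epsilon2)
  fix e :: real assume e: "e > 0"
  from le eventually_powr_ge[OF e, of "max C 1"] eventually_gt_at_top[of 1] have "eventually (\<lambda>r. ereal (log_plus (nev_T r f) / ln r) \<le> ereal (\<mu> + e)) at_top"
  proof eventually_elim
    case (elim r)
    have "C * r powr \<mu> \<le> r powr e * r powr \<mu>" using elim by (intro mult_right_mono) auto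
    hence "nev_T r f \<le> r powr e * r powr \<mu>" using elim by linarith
    hence "nev_T r f \<le> r powr (\<mu> + e)" by (simp only: powr_add mult.commute)
    hence "log_plus (nev_T r f) \<le> (\<mu> + e) * ln r"
    proof (subst log_plus_le_iff)
      show "(\<mu> + e) * ln r \<ge> 0" using elim assms(2) e by simp
      show "nev_T r f \<le> exp ((\<mu> + e) * ln r)"
        using \<open>nev_T r f \<le> r powr (\<mu> + e)\<close> elim by (simp add: powr_def)
    qed
    hence "log_plus (nev_T r f) / ln r \<le> \<mu> + e" using elim by (subst divide_le_eq) auto
    thus ?case by (simp only: ereal_less_eq)
  qed
  hence "nev_order f \<le> ereal (\<mu> + e)" unfolding nev_order_def by (rule Limsup_bounded)
  thus "nev_order f \<le> ereal \<mu> + ereal e" by simp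
qed

text \<open>Along the positive real axis \<open>L\<close> tends to 1, so it cannot vanish
  identically.\<close>

lemma extended_selberg_class_nonzero:
  assumes L: "L \<in> extended_selberg_class"
  shows "\<forall>\<^sub>\<approx>z. L z \<noteq> 0"
proof -
  obtain C where C: "C \<ge> 0" "\<And>s. Re s \<ge> 2 \<Longrightarrow> norm (L s - 1) \<le> C * 2 powr (- Re s)"
    using extended_selberg_class_right[OF L] by blast
  have "(\<lambda>n. C * (1 / 2) ^ n) \<longlonglongrightarrow> C * 0" by (intro tendsto_mult LIMSEQ_realpow_zero) auto
  hence "eventually (\<lambda>n. C * (1 / 2) ^ n < 1) sequentially" by (intro order_tendstoD(2)[of _ "C * 0"]) auto
  from eventually_conj[OF this eventually_ge_at_top[of 2]]
  obtain n :: nat where n: "C * (1 / 2) ^ n < 1" "n \<ge> 2"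
    unfolding eventually_sequentially by blast
  define x where "x = real n"
  have x: "x \<ge> 2" "C * 2 powr (- x) < 1"
    using n by (auto simp: x_def powr_minus powr_realpow power_one_over inverse_eq_divide)
  have "\<not> (\<forall>\<^sub>\<approx>z. L z = 0)"
  proof
    assume ev: "\<forall>\<^sub>\<approx>z. L z = 0"
    have "L (of_real x) = 0"
      by (rule isCont_cosparse_eq[where f = L and g = "\<lambda>_. 0", OF _ _ ev])
         (use x in \<open>auto intro!: analytic_at_imp_isCont extended_selberg_classD(2)[OF L]\<close>)
    thus False using C(2)[of "of_real x"] x by simp
  qed
  thus ?thesis using meromorphic_eventually_zero_or_nonzero[OF extended_selberg_classD(1)[OF L]] by blast
qed

text \<open>The two half-plane estimates bound \<open>F = (s - 1)^k L\<close> outside a vertical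
  strip. Finite order supplies the a priori growth that Phragmen-Lindelof requires in the upper and
  lower half strips. The only possible pole of \<open>L\<close> is 1, so \<open>nev_N\<close> adds
  just a logarithm.\<close>

theorem extended_selberg_class_growth:
  assumes L: "L \<in> extended_selberg_class" and \<beta>: "\<beta> > 1"
  shows "\<exists>C\<ge>0. \<exists>R\<ge>1. \<forall>r\<ge>R. nev_T r L \<le> C * r powr \<beta>"
proof -
  obtain k F where F: "F holomorphic_on UNIV" "nev_order F < \<infinity>" "\<And>s. s \<noteq> 1 \<Longrightarrow> F s = (s - 1) ^ k * L s"
    using L unfolding extended_selberg_class_def by auto
  have nz: "\<forall>\<^sub>\<approx>z. F z \<noteq> 0"
  proof -
    have "\<forall>\<^sub>\<approx>z::complex. z \<notin> {1}" by (intro eventually_not_in_cosparse) auto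
    with extended_selberg_class_nonzero[OF L] show ?thesis
      by eventually_elim (simp add: F(3))
  qed
  obtain n where n: "nev_order F < ereal (real n)" using F(2) less_PInf_Ex_of_nat[of "nev_order F"] by auto
  define A where "A = real n"
  obtain R0 where R0: "R0 \<ge> 1" "\<And>r. r \<ge> R0 \<Longrightarrow> nev_T r F \<le> r powr A"
    using nev_order_less_imp[OF n] unfolding A_def by blast
  have A0: "A \<ge> 0" by (simp add: A_def)
  have "F analytic_on UNIV" using F(1) by (simp add: analytic_on_open)
  hence T: "nev_T r F = nev_m r F" for r by (rule nev_T_analytic)
  \<comment> \<open>Beyond \<open>R1\<close> the constant \<open>3 * 3 powr A\<close> is at most
    \<open>norm z\<close>, at the price of one more unit in the exponent.\<close>
  define R1 where "R1 = max R0 (3 * 3 powr A)"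
  have gr: "norm (F z) \<le> exp (norm z powr (A + 1))" if z: "norm z \<ge> R1" for z
  proof -
    have z0: "norm z > 0" "norm z \<ge> R0" "norm z \<ge> 3 * 3 powr A" using z R0(1) by (auto simp: R1_def)
    have "norm (F z) \<le> exp (3 * (3 * norm z) powr A)"
      by (rule entire_norm_le_of_nev_m[OF F(1) nz, of R0]) (use R0 T A0 z0 in auto)
    also have "3 * (3 * norm z) powr A = (3 * 3 powr A) * norm z powr A" by (simp add: powr_mult)
    also have "\<dots> \<le> norm z * norm z powr A" using z0 by (intro mult_right_mono) auto
    also have "\<dots> = norm z powr (A + 1)" using z0 by (simp add: powr_add)
    finally show ?thesis by simp
  qed
  obtain B where B: "exp_growth \<beta> {s. Re s < - B} L" using extended_selberg_class_left[OF L \<beta>] by blast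
  obtain C where C: "C \<ge> 0" "\<And>s. Re s \<ge> 2 \<Longrightarrow> norm (L s - 1) \<le> C * 2 powr (- Re s)"
    using extended_selberg_class_right[OF L] by blast
  have Lr: "exp_growth \<beta> {s. Re s \<ge> 2} L"
  proof (rule exp_growth_bounded[of _ _ "C + 1"])
    fix s assume s: "s \<in> {s. Re s \<ge> 2}"
    have "norm (L s) \<le> norm (L s - 1) + 1" using norm_triangle_ineq[of "L s - 1" 1] by simp
    also have "norm (L s - 1) \<le> C * 2 powr (- Re s)" using s by (intro C(2)) simp
    also have "\<dots> \<le> C * 2 powr 0" using s C(1) by (intro mult_left_mono powr_mono) auto
    finally show "norm (L s) \<le> C + 1" by simp
  qed (use \<beta> in auto)
  have pol: "exp_growth \<beta> S (\<lambda>s. (s - 1) ^ k)" for S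
  proof -
    have "exp_growth \<beta> S (\<lambda>s. s - 1)"
    proof (rule exp_growth_le)
      show "exp_growth \<beta> S (\<lambda>s. exp (of_real (1 + norm s)))"
        by (rule exp_growth_exp[of _ _ _ 1]) (use \<beta> in \<open>auto simp: norm_of_real simp del: of_real_add\<close>)
      fix s assume "s \<in> S"
      have "norm (s - 1) \<le> 1 + norm s" using norm_triangle_ineq4[of s 1] by simp
      also have "\<dots> \<le> exp (1 + norm s)" using exp_ge_add_one_self[of "1 + norm s"] by linarith
      finally show "s \<in> S \<and> norm (s - 1) \<le> norm (exp (complex_of_real (1 + norm s)))"
        using \<open>s \<in> S\<close> by (simp add: norm_exp_eq_Re)
    qed
    hence "exp_growth \<beta> S (\<lambda>s. \<Prod>j<k. s - 1)" using \<beta> by (intro exp_growth_prod) auto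
    thus ?thesis by simp
  qed
  define b where "b = max 2 (B + 1)"
  have b: "b > 0" "b \<ge> 2" "b > B" by (auto simp: b_def)
  obtain C1 where C1: "C1 \<ge> 0" "\<And>s. Re s \<ge> 2 \<Longrightarrow> norm ((s - 1) ^ k * L s) \<le> exp (C1 * (1 + norm s) powr \<beta>)"
    using exp_growth_mult[OF pol Lr] unfolding exp_growth_def by auto
  obtain C2 where C2: "C2 \<ge> 0" "\<And>s. Re s < - B \<Longrightarrow> norm ((s - 1) ^ k * L s) \<le> exp (C2 * (1 + norm s) powr \<beta>)"
    using exp_growth_mult[OF pol B] unfolding exp_growth_def by auto
  define C3 where "C3 = max C1 C2 * 2 powr \<beta>"
  have C3: "C3 \<ge> 0" using C1(1) by (simp add: C3_def)
  have out: "norm (F s) \<le> exp (C3 * norm s powr \<beta>)" if s: "\<bar>Re s\<bar> \<ge> b" for s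
  proof -
    have s1: "s \<noteq> 1" using s b by auto
    have ns: "norm s \<ge> 1" using abs_Re_le_cmod[of s] s b by linarith
    have "Re s \<ge> 2 \<or> Re s < - B" using s b by linarith
    hence "norm (F s) \<le> exp (C1 * (1 + norm s) powr \<beta>) \<or> norm (F s) \<le> exp (C2 * (1 + norm s) powr \<beta>)"
      using C1(2) C2(2) F(3)[OF s1] by metis
    moreover have "c * (1 + norm s) powr \<beta> \<le> C3 * norm s powr \<beta>" if c: "c \<ge> 0" "c \<le> max C1 C2" for c
    proof -
      have "(1 + norm s) powr \<beta> \<le> (2 * norm s) powr \<beta>" using ns \<beta> by (intro powr_mono2) auto
      also have "\<dots> = 2 powr \<beta> * norm s powr \<beta>" by (simp add: powr_mult)
      finally have "c * (1 + norm s) powr \<beta> \<le> max C1 C2 * (2 powr \<beta> * norm s powr \<beta>)" using c by (intro mult_mono) auto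
      thus ?thesis by (simp add: C3_def mult_ac)
    qed
    from this[of C1] this[of C2] have "exp (C1 * (1 + norm s) powr \<beta>) \<le> exp (C3 * norm s powr \<beta>)"
      "exp (C2 * (1 + norm s) powr \<beta>) \<le> exp (C3 * norm s powr \<beta>)" using C1(1) C2(1) by auto
    ultimately show ?thesis by linarith
  qed
  \<comment> \<open>Multiplication by \<open>u\<close> rotates the right half strip onto the upper
    or the lower vertical one.\<close>
  have PL: "\<exists>C' x0. \<forall>w. \<bar>Im w\<bar> \<le> b \<longrightarrow> Re w \<ge> x0 \<longrightarrow> norm (F (u * w)) \<le> exp (C' * norm w powr \<beta>)"
    if u: "u = \<i> \<or> u = - \<i>" for u
  proof (rule Phragmen_Lindelof_half_strip[where A = "A + 1" and C = C3 and R = R1])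
    show "(\<lambda>w. F (u * w)) holomorphic_on UNIV"
      using holomorphic_on_compose_gen[of "\<lambda>w. u * w" UNIV F UNIV] F(1)
      by (auto simp: o_def intro!: holomorphic_intros)
    show "norm (F (u * w)) \<le> exp (C3 * norm w powr \<beta>)" if "\<bar>Im w\<bar> = b" for w
      using out[of "u * w"] that u by (auto simp: norm_mult)
    show "norm (F (u * w)) \<le> exp (norm w powr (A + 1))" if "norm w \<ge> R1" for w
      using gr[of "u * w"] that u by (auto simp: norm_mult)
  qed (use b C3 \<beta> A0 in auto)
  obtain C4 x4 where P4: "\<And>w. \<bar>Im w\<bar> \<le> b \<Longrightarrow> Re w \<ge> x4 \<Longrightarrow> norm (F (\<i> * w)) \<le> exp (C4 * norm w powr \<beta>)"
    using PL[of \<i>] by blast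
  obtain C5 x5 where P5: "\<And>w. \<bar>Im w\<bar> \<le> b \<Longrightarrow> Re w \<ge> x5 \<Longrightarrow> norm (F (- \<i> * w)) \<le> exp (C5 * norm w powr \<beta>)"
    using PL[of "- \<i>"] by blast
  define D where "D = max C3 (max C4 C5)"
  \<comment> \<open>A point of modulus at least \<open>R\<close> lies outside the strip or has
    imaginary part beyond \<open>x4\<close> or below \<open>- x5\<close>; \<open>R \<ge> 2\<close>
    keeps \<open>s - 1\<close> at modulus at least 1, so that \<open>F\<close> dominates
    \<open>L\<close>.\<close>
  define R where "R = max 2 (b + max x4 x5)"
  have D: "D \<ge> 0" using C3 by (simp add: D_def)
  have FD: "norm (F s) \<le> exp (D * norm s powr \<beta>)" if s: "norm s \<ge> R" for s
  proof -
    have mono: "exp (c * norm s powr \<beta>) \<le> exp (D * norm s powr \<beta>)" if "c \<le> D" for c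
      using that by (simp add: mult_right_mono)
    have "norm s \<le> \<bar>Re s\<bar> + \<bar>Im s\<bar>" by (rule cmod_le)
    hence "\<bar>Re s\<bar> \<ge> b \<or> (\<bar>Re s\<bar> \<le> b \<and> Im s \<ge> x4) \<or> (\<bar>Re s\<bar> \<le> b \<and> - Im s \<ge> x5)"
      using s unfolding R_def by linarith
    thus ?thesis
    proof (elim disjE conjE)
      assume "\<bar>Re s\<bar> \<ge> b"
      from order_trans[OF out[OF this] mono[of C3]] show ?thesis by (simp add: D_def)
    next
      assume "\<bar>Re s\<bar> \<le> b" "Im s \<ge> x4"
      hence "norm (F (\<i> * (- \<i> * s))) \<le> exp (C4 * norm (- \<i> * s) powr \<beta>)" by (intro P4) auto
      hence "norm (F s) \<le> exp (C4 * norm s powr \<beta>)" by (simp add: norm_mult flip: mult.assoc)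
      from order_trans[OF this mono[of C4]] show ?thesis by (simp add: D_def)
    next
      assume "\<bar>Re s\<bar> \<le> b" "- Im s \<ge> x5"
      hence "norm (F (- \<i> * (\<i> * s))) \<le> exp (C5 * norm (\<i> * s) powr \<beta>)" by (intro P5) auto
      hence "norm (F s) \<le> exp (C5 * norm s powr \<beta>)" by (simp add: norm_mult flip: mult.assoc)
      from order_trans[OF this mono[of C5]] show ?thesis by (simp add: D_def)
    qed
  qed
  note mero = extended_selberg_classD(1)[OF L]
  have bound: "nev_T r L \<le> (D + real (pole_order L 1)) * r powr \<beta>" if r: "r \<ge> R" for r
  proof -
    have r2: "r \<ge> 2" using r by (simp add: R_def)
    have "nev_m r L \<le> D * r powr \<beta>"
    proof (rule nev_m_le[OF _ mero])
      fix s :: complex assume s: "norm s = r"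
      have s1: "norm (s - 1) \<ge> 1" using norm_triangle_ineq2[of s 1] s r2 by simp
      hence "s \<noteq> 1" by auto
      have "1 * norm (L s) \<le> norm (s - 1) ^ k * norm (L s)"
        using s1 by (intro mult_right_mono one_le_power) auto
      also have "\<dots> = norm (F s)" using F(3)[OF \<open>s \<noteq> 1\<close>] by (simp add: norm_mult norm_power)
      also have "\<dots> \<le> exp (D * norm s powr \<beta>)" by (rule FD) (use s r in simp)
      finally show "log_plus (norm (L s)) \<le> D * r powr \<beta>" using D s by (subst log_plus_le_iff) auto
    qed (use r2 in auto)
    moreover have "nev_N r L = real (pole_order L 1) * ln r"
    proof -
      have "is_pole L z \<Longrightarrow> z = 1" for z
        using extended_selberg_classD(2)[OF L] analytic_at_imp_no_pole by blast
      hence "nev_N r L = (\<Sum>a\<in>{1}. real (pole_order L a) * log_weight r a)"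
        by (intro nev_N_eq mero) (use r2 in auto)
      thus ?thesis by (simp add: log_weight_def)
    qed
    moreover have "real (pole_order L 1) * ln r \<le> real (pole_order L 1) * r powr \<beta>"
    proof (intro mult_left_mono)
      have "ln r \<le> r powr 1" using ln_le_minus_one[of r] r2 by simp
      also have "\<dots> \<le> r powr \<beta>" using r2 \<beta> by (intro powr_mono) auto
      finally show "ln r \<le> r powr \<beta>" .
    qed auto
    ultimately show ?thesis unfolding nev_T_def by (simp add: algebra_simps)
  qed
  show ?thesis
    by (rule exI[of _ "D + real (pole_order L 1)"], rule conjI[OF _ exI[of _ R]])
       (use D bound in \<open>auto simp: R_def\<close>)
qed

section \<open>Growth rates of the characteristic\<close>

text \<open>One-sided, unlike \<open>O(r powr \<mu>)\<close>: \<open>nev_T\<close> needs no lower bound.\<close>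
definition nev_growth :: "(complex \<Rightarrow> complex) \<Rightarrow> real \<Rightarrow> bool" where
  "nev_growth f \<mu> \<longleftrightarrow> (\<exists>C. eventually (\<lambda>r. nev_T r f \<le> C * r powr \<mu>) at_top)"

lemma nev_growthI:
  assumes "\<mu> \<ge> 0" "\<And>r. r \<ge> R \<Longrightarrow> nev_T r f \<le> C * r powr \<mu> + D"
  shows "nev_growth f \<mu>"
  unfolding nev_growth_def
proof (rule exI[of _ "C + \<bar>D\<bar>"])
  show "eventually (\<lambda>r. nev_T r f \<le> (C + \<bar>D\<bar>) * r powr \<mu>) at_top"
    using eventually_ge_at_top[of "max R 1"]
  proof eventually_elim
    case (elim r)
    have "\<bar>D\<bar> * 1 \<le> \<bar>D\<bar> * r powr \<mu>"
      using elim assms(1) by (intro mult_left_mono ge_one_powr_ge_zero) auto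
    thus ?case using assms(2)[of r] elim by (simp add: algebra_simps)
  qed
qed

lemma nev_growth_sum:
  assumes "nev_growth f \<mu>" "nev_growth g \<mu>" "\<mu> \<ge> 0"
    and "\<And>r. r \<ge> 1 \<Longrightarrow> nev_T r h \<le> nev_T r f + nev_T r g + D"
  shows "nev_growth h \<mu>"
proof -
  obtain C1 C2 where "eventually (\<lambda>r. nev_T r f \<le> C1 * r powr \<mu>) at_top" "eventually (\<lambda>r. nev_T r g \<le> C2 * r powr \<mu>) at_top"
    using assms(1,2) unfolding nev_growth_def by blast
  hence "eventually (\<lambda>r. nev_T r h \<le> (C1 + C2) * r powr \<mu> + D) at_top" using eventually_ge_at_top[of 1]
  proof eventually_elim
    case (elim r)
    thus ?case using assms(4)[of r] by (simp add: distrib_right)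
  qed
  then obtain R where "\<And>r. r \<ge> R \<Longrightarrow> nev_T r h \<le> (C1 + C2) * r powr \<mu> + D"
    unfolding eventually_at_top_linorder by blast
  thus ?thesis by (rule nev_growthI[OF assms(3)])
qed

lemma nev_growth_diff:
  "f meromorphic_on UNIV \<Longrightarrow> g meromorphic_on UNIV \<Longrightarrow> \<mu> \<ge> 0 \<Longrightarrow> nev_growth f \<mu> \<Longrightarrow> nev_growth g \<mu> \<Longrightarrow>
   nev_growth (\<lambda>z. f z - g z) \<mu>"
  by (rule nev_growth_sum[of f \<mu> g _ "ln 2"]) (simp_all add: nev_T_diff_le)

lemma nev_growth_mult:
  "f meromorphic_on UNIV \<Longrightarrow> g meromorphic_on UNIV \<Longrightarrow> \<mu> \<ge> 0 \<Longrightarrow> nev_growth f \<mu> \<Longrightarrow> nev_growth g \<mu> \<Longrightarrow>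
   nev_growth (\<lambda>z. f z * g z) \<mu>"
  by (rule nev_growth_sum[of f \<mu> g _ 0]) (simp_all add: nev_T_mult_le)

lemma nev_growth_inverse:
  assumes "f meromorphic_on UNIV" "\<forall>\<^sub>\<approx>z. f z \<noteq> 0" "\<mu> \<ge> 0" "nev_growth f \<mu>"
  shows "nev_growth (\<lambda>z. 1 / f z) \<mu>"
proof -
  obtain C where "eventually (\<lambda>r. nev_T r f \<le> C * r powr \<mu>) at_top"
    using assms(4) unfolding nev_growth_def by blast
  hence "eventually (\<lambda>r. nev_T r (\<lambda>z. 1 / f z) \<le> C * r powr \<mu> + (- ln (norm (zor_poly f 0 0)))) at_top"
    using eventually_gt_at_top[of 0] by eventually_elim (simp add: nev_T_inverse[OF assms(1,2)])
  then obtain R where "\<And>r. r \<ge> R \<Longrightarrow> nev_T r (\<lambda>z. 1 / f z) \<le> C * r powr \<mu> + (- ln (norm (zor_poly f 0 0)))"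
    unfolding eventually_at_top_linorder by blast
  thus ?thesis by (rule nev_growthI[OF assms(3)])
qed

lemma nev_growth_divide:
  assumes "f meromorphic_on UNIV" "g meromorphic_on UNIV" "\<forall>\<^sub>\<approx>z. g z \<noteq> 0" "\<mu> \<ge> 0" "nev_growth f \<mu>" "nev_growth g \<mu>"
  shows "nev_growth (\<lambda>z. f z / g z) \<mu>"
proof -
  have "(\<lambda>z. 1 / g z) meromorphic_on UNIV" by (intro meromorphic_intros assms)
  from nev_growth_mult[OF assms(1) this assms(4,5) nev_growth_inverse[OF assms(2,3,4,6)]]
  show ?thesis by simp
qed

lemma nev_growth_const: "\<mu> \<ge> 0 \<Longrightarrow> nev_growth (\<lambda>_. c) \<mu>"
  using nev_T_const by (intro nev_growthI[of _ 1 _ 0 "log_plus (norm c)"]) auto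

lemma nev_growth_cong:
  assumes fg: "\<forall>\<^sub>\<approx>z. f z = g z" and f: "nev_growth f \<mu>"
  shows "nev_growth g \<mu>"
proof -
  obtain C where "eventually (\<lambda>r. nev_T r f \<le> C * r powr \<mu>) at_top"
    using f unfolding nev_growth_def by blast
  hence "eventually (\<lambda>r. nev_T r g \<le> C * r powr \<mu>) at_top"
    using eventually_gt_at_top[of 0] by eventually_elim (simp add: nev_T_cong[OF fg])
  thus ?thesis unfolding nev_growth_def by blast
qed

lemma nev_growth_order_less:
  assumes "nev_order f < ereal \<mu>"
  shows "nev_growth f \<mu>"
proof -
  obtain R where "\<forall>r\<ge>R. nev_T r f \<le> r powr \<mu>" using nev_order_less_imp[OF assms] by blast
  hence "eventually (\<lambda>r. nev_T r f \<le> 1 * r powr \<mu>) at_top" unfolding eventually_at_top_linorder by auto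
  thus ?thesis unfolding nev_growth_def by blast
qed

lemma nev_order_le_of_growth: "nev_growth f \<mu> \<Longrightarrow> \<mu> \<ge> 0 \<Longrightarrow> nev_order f \<le> ereal \<mu>"
  unfolding nev_growth_def using nev_order_le by blast

lemma nev_growth_extended_selberg_class:
  assumes "L \<in> extended_selberg_class" "\<beta> > 1"
  shows "nev_growth L \<beta>"
proof -
  obtain C R where "\<forall>r\<ge>R. nev_T r L \<le> C * r powr \<beta>"
    using extended_selberg_class_growth[OF assms] by blast
  hence "eventually (\<lambda>r. nev_T r L \<le> C * r powr \<beta>) at_top"
    unfolding eventually_at_top_linorder by (rule exI)
  thus ?thesis unfolding nev_growth_def by (rule exI)
qed

lemma nev_growth_linear_powi:
  assumes "\<mu> \<ge> 1"
  shows "nev_growth (\<lambda>z. (z - 1) powi m) \<mu>"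
proof -
  have pow: "nev_growth (\<lambda>z. (z - 1) ^ n) \<mu>" for n
  proof (rule nev_growthI[of _ 1 _ "real n" 0])
    fix r :: real assume r: "r \<ge> 1"
    have an: "(\<lambda>z. (z - 1) ^ n) analytic_on UNIV" by (intro analytic_intros)
    have "nev_m r (\<lambda>z. (z - 1) ^ n) \<le> real n * r"
    proof (rule nev_m_le)
      show "(\<lambda>z. (z - 1) ^ n) meromorphic_on UNIV" by (intro analytic_on_imp_meromorphic_on an)
      fix z :: complex assume z: "norm z = r"
      have "norm (z - 1) \<le> 1 + r" using norm_triangle_ineq4[of z 1] z by simp
      also have "\<dots> \<le> exp r" by (rule exp_ge_add_one_self)
      finally have "norm (z - 1) ^ n \<le> exp r ^ n" by (intro power_mono) auto
      thus "log_plus (norm ((z - 1) ^ n)) \<le> real n * r"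
        using r by (subst log_plus_le_iff) (auto simp: norm_power exp_of_nat_mult)
    qed (use r in auto)
    also have "\<dots> \<le> real n * r powr \<mu>" using r assms powr_mono[of 1 \<mu> r] by (intro mult_left_mono) auto
    finally show "nev_T r (\<lambda>z. (z - 1) ^ n) \<le> real n * r powr \<mu> + 0" by (simp add: nev_T_analytic[OF an])
  qed (use assms in auto)
  show ?thesis
  proof (cases "m \<ge> 0")
    case True
    thus ?thesis using pow[of "nat m"] by (simp add: power_int_def)
  next
    case False
    have "\<forall>\<^sub>\<approx>z::complex. z \<notin> {1}" by (intro eventually_not_in_cosparse) auto
    hence "\<forall>\<^sub>\<approx>z::complex. (z - 1) ^ nat (- m) \<noteq> 0" by eventually_elim auto
    from nev_growth_inverse[OF _ this _ pow] assms False show ?thesis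
      by (simp add: power_int_def meromorphic_intros inverse_eq_divide power_one_over)
  qed
qed

text \<open>By \<open>coeff_le_nev_m_exp\<close>, the coefficient times \<open>r ^ n\<close> is at
  most a multiple of \<open>r powr \<mu>\<close> for large \<open>r\<close>, which forces it to
  vanish when \<open>n\<close> exceeds \<mu>.\<close>

lemma coeff_eq_0_of_nev_growth:
  assumes g: "g holomorphic_on UNIV" and T: "nev_growth (\<lambda>z. exp (g z)) \<mu>" and n: "\<mu> \<ge> 0" "real n > \<mu>"
  shows "(deriv ^^ n) g 0 = 0"
proof (rule ccontr)
  assume nz: "(deriv ^^ n) g 0 \<noteq> 0"
  define a where "a = norm ((deriv ^^ n) g 0 / fact n)"
  have a: "a > 0" using nz by (simp add: a_def)
  have "(\<lambda>z. exp (g z)) analytic_on UNIV" using g by (intro analytic_intros) (auto simp: analytic_on_open)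
  note Tm = nev_T_analytic[OF this]
  obtain C where C: "eventually (\<lambda>r. nev_T r (\<lambda>z. exp (g z)) \<le> C * r powr \<mu>) at_top"
    using T unfolding nev_growth_def by blast
  define M where "M = 4 * \<bar>C\<bar> + 2 * \<bar>Re (g 0)\<bar>"
  have "0 < real n - \<mu>" using n by simp
  note ev = eventually_powr_ge[OF this, of "M / a + 1"]
  have "eventually (\<lambda>r. False) (at_top :: real filter)"
    using C eventually_ge_at_top[of 1] ev
  proof eventually_elim
    case (elim r)
    have p: "1 \<le> r powr \<mu>" using elim n by (intro ge_one_powr_ge_zero) auto
    have "a * r ^ n \<le> 4 * nev_m r (\<lambda>z. exp (g z)) - 2 * Re (g 0)"
      unfolding a_def by (rule coeff_le_nev_m_exp[OF g]) (use n elim in auto)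
    also have "\<dots> \<le> 4 * (C * r powr \<mu>) + 2 * \<bar>Re (g 0)\<bar>" using elim(1) unfolding Tm by linarith
    also have "\<dots> \<le> M * r powr \<mu>"
    proof -
      have "C * r powr \<mu> \<le> \<bar>C\<bar> * r powr \<mu>" by (intro mult_right_mono) auto
      moreover have "\<bar>Re (g 0)\<bar> * 1 \<le> \<bar>Re (g 0)\<bar> * r powr \<mu>" using p by (intro mult_left_mono) auto
      ultimately show ?thesis unfolding M_def by (simp add: algebra_simps)
    qed
    also have "r ^ n = r powr (real n - \<mu>) * r powr \<mu>"
      using elim by (simp add: powr_realpow flip: powr_add)
    finally have "(a * r powr (real n - \<mu>)) * r powr \<mu> \<le> M * r powr \<mu>" by (simp add: mult.assoc)
    hence "a * r powr (real n - \<mu>) \<le> M" by (rule mult_right_le_imp_le) (use p in linarith)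
    hence "r powr (real n - \<mu>) \<le> M / a" using a by (simp add: field_simps)
    thus False using elim n by simp
  qed
  thus False by simp
qed

section \<open>Lower bounds for the characteristic from decay in a sector\<close>

definition cone :: "real \<Rightarrow> real \<Rightarrow> complex set" where
  "cone \<alpha> \<beta> = {of_real r * cis t | r t. r \<ge> 0 \<and> t \<in> {\<alpha>..\<beta>}}"

text \<open>Decay in a sector makes \<open>m(r, 1/f)\<close>, hence by Jensen's formula \<open>T(r, f)\<close>, grow linearly.\<close>
lemma nev_T_ge_of_cone_decay:
  assumes f: "f meromorphic_on UNIV" and nz: "\<forall>\<^sub>\<approx>z. f z \<noteq> 0"
    and ab: "0 \<le> \<alpha>" "\<alpha> < \<beta>" "\<beta> \<le> 2 * pi" and c: "c > 0" and K: "K > 0" and R: "R \<ge> 1"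
    and le: "\<forall>\<^sub>\<approx>z. z \<in> cone \<alpha> \<beta> \<longrightarrow> norm z \<ge> R \<longrightarrow> norm (f z) \<le> K * exp (- c * norm z)"
  shows "\<exists>c'>0. \<exists>C. \<forall>r\<ge>R. nev_T r f \<ge> c' * r - C"
proof -
  define q where "q = (\<beta> - \<alpha>) / (2 * pi)"
  have q: "q > 0" using ab by (simp add: q_def)
  have inv: "(\<lambda>z. 1 / f z) meromorphic_on UNIV" by (intro meromorphic_intros f)
  have "nev_T r f \<ge> (q * c) * r - (q * ln K - ln (norm (zor_poly f 0 0)))" if r: "r \<ge> R" for r
  proof -
    have r1: "r \<ge> 1" using r R by simp
    define M where "M = (\<lambda>t. log_plus (norm (1 / f (of_real r * cis t))))"
    define E where "E = {t\<in>{0..2*pi}. of_real r * cis t \<in> {z. \<not> (f z \<noteq> 0 \<and> (z \<in> cone \<alpha> \<beta> \<longrightarrow> norm z \<ge> R \<longrightarrow> norm (f z) \<le> K * exp (- c * norm z)))}}"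
    have "finite E" unfolding E_def
      by (rule finite_circle_preimage) (use eventually_conj[OF nz le] r1 in \<open>auto simp: eventually_cosparse\<close>)
    have Mge: "M t \<ge> c * r - ln K" if t: "t \<in> {\<alpha>..\<beta>} - E" for t
    proof -
      define z where "z = of_real r * cis t"
      have "norm z = r" using r1 by (simp add: z_def norm_mult)
      moreover have "z \<in> cone \<alpha> \<beta>" unfolding cone_def z_def mem_Collect_eq
        by (rule exI[of _ r], rule exI[of _ t]) (use t r1 in simp)
      moreover have "t \<in> {0..2*pi}" using t ab by auto
      ultimately have fz: "f z \<noteq> 0" "norm (f z) \<le> K * exp (- c * r)" using t r by (auto simp: E_def z_def)
      have "ln (norm (f z)) \<le> ln (K * exp (- c * r))" using fz K by (intro ln_mono) auto
      also have "\<dots> = ln K - c * r" using K by (simp add: ln_mult)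
      finally have "c * r - ln K \<le> ln (norm (1 / f z))" using fz by (simp add: norm_divide ln_div)
      also have "\<dots> \<le> M t" unfolding M_def z_def by (simp add: log_plus_eq_max)
      finally show ?thesis .
    qed
    have Mint: "M integrable_on {0..2*pi}" unfolding M_def
      by (intro set_lebesgue_integral_eq_integral(1) integrable_log_plus_circle inv) (use r1 in auto)
    have Mint': "M integrable_on {\<alpha>..\<beta>}" by (rule integrable_subinterval_real[OF Mint]) (use ab in auto)
    \<comment> \<open>Changing the integrand on the finite set \<open>E\<close> makes the lower
      bound hold everywhere on the arc without changing the integral.\<close>
    define G where "G = (\<lambda>t. if t \<in> E then c * r - ln K else M t)"
    have "(\<beta> - \<alpha>) * (c * r - ln K) = integral {\<alpha>..\<beta>} (\<lambda>_. c * r - ln K)" using ab by simp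
    also have "\<dots> \<le> integral {\<alpha>..\<beta>} G"
    proof (rule integral_le)
      show "G integrable_on {\<alpha>..\<beta>}"
        by (rule integrable_spike_finite[OF \<open>finite E\<close> _ Mint']) (auto simp: G_def)
    qed (use Mge in \<open>auto simp: G_def\<close>)
    also have "\<dots> = integral {\<alpha>..\<beta>} M"
      by (rule integral_spike[OF negligible_finite[OF \<open>finite E\<close>]]) (auto simp: G_def)
    also have "\<dots> \<le> integral {0..2*pi} M"
      by (rule integral_subset_le) (use ab Mint Mint' in \<open>auto simp: M_def\<close>)
    also have "\<dots> = 2 * pi * nev_m r (\<lambda>z. 1 / f z)" unfolding nev_m_cis M_def by simp
    finally have "q * (c * r - ln K) \<le> nev_m r (\<lambda>z. 1 / f z)" by (simp add: q_def field_simps)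
    also have "\<dots> \<le> nev_T r (\<lambda>z. 1 / f z)" unfolding nev_T_def using nev_N_nonneg[OF inv r1] by simp
    also have "\<dots> = nev_T r f - ln (norm (zor_poly f 0 0))" by (rule nev_T_inverse[OF f nz]) (use r1 in auto)
    finally show ?thesis by (simp add: algebra_simps)
  qed
  thus ?thesis using q c by (intro exI[of _ "q * c"] conjI exI[of _ "q * ln K - ln (norm (zor_poly f 0 0))"]) auto
qed

text \<open>For angles up to \<open>pi / 3\<close> the real part is at least half the modulus, so
  decay like \<open>2 powr (- Re z)\<close> becomes exponential decay with rate
  \<open>ln 2 / 2\<close>. The resulting linear lower bound for the characteristic of
  \<open>h - 1\<close> contradicts any order below 1.\<close>

lemma nev_order_ge_1_of_cone_bound:
  assumes h: "h meromorphic_on UNIV" and L: "L1 \<in> extended_selberg_class" "L2 \<in> extended_selberg_class"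
    and h1: "\<forall>\<^sub>\<approx>z. h z \<noteq> 1" and ab: "0 \<le> \<alpha>" "\<alpha> < \<beta>" "\<beta> \<le> pi / 3"
    and le: "\<forall>\<^sub>\<approx>z. z \<in> cone \<alpha> \<beta> \<longrightarrow> norm z \<ge> R \<longrightarrow> norm (h z - 1) \<le> K * (norm (L1 z - 1) + norm (L2 z - 1))"
  shows "nev_order h \<ge> 1"
proof (rule ccontr)
  assume "\<not> nev_order h \<ge> 1"
  hence "nev_order h < ereal 1" by (simp add: one_ereal_def)
  then obtain l where l: "nev_order h < ereal l" "l < 1" using ereal_dense2[of "nev_order h" "ereal 1"] by auto
  obtain R1 where R1: "R1 \<ge> 1" "\<forall>r\<ge>R1. nev_T r h \<le> r powr l" using nev_order_less_imp[OF l(1)] by blast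
  obtain C1 where C1: "C1 \<ge> 0" "\<forall>s. Re s \<ge> 2 \<longrightarrow> norm (L1 s - 1) \<le> C1 * 2 powr (- Re s)"
    using extended_selberg_class_right[OF L(1)] by blast
  obtain C2 where C2: "C2 \<ge> 0" "\<forall>s. Re s \<ge> 2 \<longrightarrow> norm (L2 s - 1) \<le> C2 * 2 powr (- Re s)"
    using extended_selberg_class_right[OF L(2)] by blast
  \<comment> \<open>\<open>K\<close> carries no sign condition, hence the absolute value; adding 1
    makes the constant positive.\<close>
  define K' where "K' = \<bar>K\<bar> * (C1 + C2) + 1"
  have K': "K' > 0" using C1(1) C2(1) unfolding K'_def by (intro add_nonneg_pos mult_nonneg_nonneg) auto
  \<comment> \<open>From modulus 4 on, the real part in the sector is at least 2, where the
    estimates of both Dirichlet series are available.\<close>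
  define R' where "R' = max (max R 4) R1"
  have hm: "(\<lambda>z. h z - 1) meromorphic_on UNIV" by (intro meromorphic_intros h)
  have nz: "\<forall>\<^sub>\<approx>z. h z - 1 \<noteq> 0" using h1 by eventually_elim simp
  have ev: "\<forall>\<^sub>\<approx>z. z \<in> cone \<alpha> \<beta> \<longrightarrow> norm z \<ge> R' \<longrightarrow> norm (h z - 1) \<le> K' * exp (- (ln 2 / 2) * norm z)"
    using le
  proof eventually_elim
    case (elim z)
    show ?case
    proof (intro impI)
      assume z: "z \<in> cone \<alpha> \<beta>" "norm z \<ge> R'"
      then obtain r t where rt: "z = of_real r * cis t" "r \<ge> 0" "t \<in> {\<alpha>..\<beta>}" by (auto simp: cone_def)
      have nr: "norm z = r" using rt by (simp add: norm_mult)
      have "cos (pi / 3) \<le> cos t" by (rule cos_monotone_0_pi_le) (use rt ab in auto)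
      hence "r * (1 / 2) \<le> r * cos t" using rt(2) by (intro mult_left_mono) (auto simp: cos_60)
      hence Re: "Re z \<ge> norm z / 2" using nr rt by simp
      have Re2: "Re z \<ge> 2" using Re z by (simp add: R'_def)
      have "norm (h z - 1) \<le> K * (norm (L1 z - 1) + norm (L2 z - 1))" using elim z by (simp add: R'_def)
      also have "\<dots> \<le> \<bar>K\<bar> * (C1 * 2 powr (- Re z) + C2 * 2 powr (- Re z))"
        using C1(2) C2(2) Re2 by (intro mult_mono add_mono) auto
      also have "\<dots> = (\<bar>K\<bar> * (C1 + C2)) * 2 powr (- Re z)" by (simp add: algebra_simps)
      also have "\<dots> \<le> K' * exp (- (ln 2 / 2) * norm z)"
      proof (rule mult_mono)
        have "ln 2 * (norm z / 2) \<le> ln 2 * Re z" using Re by (intro mult_left_mono) auto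
        thus "2 powr (- Re z) \<le> exp (- (ln 2 / 2) * norm z)" by (simp add: powr_def mult.commute)
      qed (use K' in \<open>auto simp: K'_def\<close>)
      finally show "norm (h z - 1) \<le> K' * exp (- (ln 2 / 2) * norm z)" .
    qed
  qed
  have "\<exists>c>0. \<exists>C. \<forall>r\<ge>R'. nev_T r (\<lambda>z. h z - 1) \<ge> c * r - C"
    by (rule nev_T_ge_of_cone_decay[OF hm nz ab(1,2) _ _ K' _ ev]) (use ab pi_gt_zero in \<open>auto simp: R'_def\<close>)
  then obtain c C where c: "c > 0" "\<forall>r\<ge>R'. nev_T r (\<lambda>z. h z - 1) \<ge> c * r - C" by blast
  define D where "D = C + log_plus 1 + ln 2"
  have "0 < 1 - l" using l by simp
  note ev' = eventually_powr_ge[OF this, of "2 / c"]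
  have "eventually (\<lambda>r::real. False) at_top"
    using eventually_ge_at_top[of "max R' 1"] eventually_gt_at_top[of "2 * D / c"] ev'
  proof eventually_elim
    case (elim r)
    have r: "r \<ge> R'" "r \<ge> 1" "r \<ge> R1" using elim by (auto simp: R'_def)
    have "c * r - C \<le> nev_T r (\<lambda>z. h z - 1)" using c r by auto
    also have "\<dots> \<le> nev_T r h + nev_T r (\<lambda>_. 1) + ln 2"
      by (rule nev_T_diff_le[OF h _ r(2)]) auto
    also have "\<dots> \<le> r powr l + log_plus 1 + ln 2" using R1(2) r nev_T_const[of r 1] by auto
    finally have 1: "c * r \<le> r powr l + D" by (simp add: D_def)
    have "r powr l * (2 / c) \<le> r powr l * r powr (1 - l)" using elim by (intro mult_left_mono) auto
    also have "\<dots> = r" using r by (simp flip: powr_add)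
    finally have "r powr l \<le> c * r / 2" using c by (simp add: field_simps)
    moreover have "D < c * r / 2" using elim c by (simp add: field_simps)
    ultimately show False using 1 by linarith
  qed
  thus False by simp
qed

section \<open>The quotient of the two differences\<close>

text \<open>The poles agree, and at a pole the normalisation forces the value 0; elsewhere both
  functions are continuous.\<close>

lemma nicely_meromorphic_cosparse_eq:
  assumes f: "f nicely_meromorphic_on UNIV" and g: "g nicely_meromorphic_on UNIV" and eq: "\<forall>\<^sub>\<approx>z. f z = g z"
  shows "f = g"
proof
  fix z
  have ev: "eventually (\<lambda>w. f w = g w) (at z)" by (rule eventually_cosparse_UNIV_at[OF eq])
  have pole: "is_pole f z \<longleftrightarrow> is_pole g z" by (rule is_pole_cong[OF ev refl])
  show "f z = g z"
  proof (cases "is_pole f z")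
    case True
    thus ?thesis using is_pole_zero_at_nicely_mero[OF f] is_pole_zero_at_nicely_mero[OF g] pole by simp
  next
    case False
    hence "f \<midarrow>z\<rightarrow> f z" "g \<midarrow>z\<rightarrow> g z"
      using f g pole unfolding nicely_meromorphic_on_def by auto
    hence "f \<midarrow>z\<rightarrow> g z" using tendsto_cong[OF ev] by blast
    thus ?thesis using \<open>f \<midarrow>z\<rightarrow> f z\<close> LIM_unique by blast
  qed
qed

text \<open>Subadditivity of \<open>pole_order\<close> is used twice: for \<open>L - h\<close>, and
  for \<open>- h\<close> written as the sum of \<open>L - h\<close> and \<open>- L\<close>.\<close>

lemma is_pole_diff_analytic_iff:
  assumes L: "L analytic_on {z}" and h: "h meromorphic_on {z}"
  shows "is_pole (\<lambda>z. L z - h z) z \<longleftrightarrow> is_pole h z"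
proof -
  have iff: "is_pole f z \<longleftrightarrow> pole_order f z > 0" if "f meromorphic_on {z}" for f
    using isolated_pole_imp_neg_zorder[of f z] that by (auto simp: pole_order_def meromorphic_at_iff)
  have Lm: "L meromorphic_on {z}" using L by (rule analytic_on_imp_meromorphic_on)
  have nL: "(\<lambda>z. - L z) meromorphic_on {z}" "(\<lambda>z. - h z) meromorphic_on {z}"
    using Lm h by (auto intro: meromorphic_intros)
  have fm: "(\<lambda>z. L z - h z) meromorphic_on {z}" by (intro meromorphic_intros Lm h)
  have L0: "pole_order L z = 0" using iff[OF Lm] analytic_at_imp_no_pole[OF L] by simp
  have neg: "pole_order (\<lambda>z. - f z) z = pole_order f z" for f by (simp add: pole_order_def)
  have "pole_order (\<lambda>z. L z - h z) z \<le> pole_order h z"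
    using pole_order_add_le[OF Lm nL(2)] L0 neg[of h] by simp
  moreover have "pole_order h z \<le> pole_order (\<lambda>z. L z - h z) z"
  proof -
    have "pole_order (\<lambda>z. (L z - h z) + - L z) z \<le> pole_order (\<lambda>z. L z - h z) z"
      using pole_order_add_le[OF fm nL(1)] L0 neg[of L] by simp
    moreover have "pole_order (\<lambda>z. (L z - h z) + - L z) z = pole_order h z"
      using neg[of h] by simp
    ultimately show ?thesis by simp
  qed
  ultimately show ?thesis using iff[OF fm] iff[OF h] by simp
qed

text \<open>At a pole of \<open>h\<close> both differences inherit its order, since the L-functions
  are analytic there. At any other point neither difference has a pole, and the order is the
  multiplicity of a zero or 0.\<close>

lemma zorder_diff_eq_of_same_zeros_CM:
  assumes L: "L1 analytic_on {z}" "L2 analytic_on {z}"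
    and nzL: "eventually (\<lambda>w. L1 w \<noteq> 0) (at z)" "eventually (\<lambda>w. L2 w \<noteq> 0) (at z)"
    and h: "h meromorphic_on {z}"
    and nz: "eventually (\<lambda>w. L1 w - h w \<noteq> 0) (at z)" "eventually (\<lambda>w. L2 w - h w \<noteq> 0) (at z)"
    and same: "same_zeros_CM (\<lambda>z. L1 z - h z) (\<lambda>z. L2 z - h z)"
  shows "zorder (\<lambda>z. L1 z - h z) z = zorder (\<lambda>z. L2 z - h z) z"
proof -
  have fm: "(\<lambda>z. L z - h z) meromorphic_on {z}" if "L analytic_on {z}" for L
    by (intro meromorphic_intros h analytic_on_imp_meromorphic_on that)
  have fr: "frequently P (at z)" if "eventually P (at z)" for P :: "complex \<Rightarrow> bool"
    using that by (intro eventually_frequently) auto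
  show ?thesis
  proof (cases "is_pole h z")
    case True
    have hneg: "zorder h z < 0"
      using isolated_pole_imp_neg_zorder True h by (simp add: meromorphic_at_iff)
    have "zorder (\<lambda>z. L z - h z) z = zorder h z" if L: "L analytic_on {z}" "eventually (\<lambda>w. L w \<noteq> 0) (at z)" for L
    proof (rule zorder_diff2)
      show Lm: "L meromorphic_on {z}" using L(1) by (rule analytic_on_imp_meromorphic_on)
      have "\<not> zorder L z < 0"
        using zorder_neg_imp_is_pole[OF Lm L(2)] analytic_at_imp_no_pole[OF L(1)] by blast
      thus "zorder h z < zorder L z" using hneg by simp
      show "\<exists>\<^sub>F z in at z. h z \<noteq> 0"
        using True non_zero_neighbour_pole fr by blast
    qed (use h L fr in auto)
    thus ?thesis using L nzL by simp
  next
    case False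
    have np: "\<not> is_pole (\<lambda>z. L z - h z) z" if "L analytic_on {z}" for L
      using is_pole_diff_analytic_iff[OF that h] False by simp
    have z: "zorder f z = zorder g z"
      if fg: "f meromorphic_on {z}" "g meromorphic_on {z}" "eventually (\<lambda>w. g w \<noteq> 0) (at z)"
        "isolated_zero f z" "same_zeros_CM f g" for f g
    proof -
      have "zorder f z > 0" using fg by (intro zorder_isolated_zero_pos') (auto simp: meromorphic_at_iff)
      hence "zero_of_multiplicity f z (nat (zorder f z))" using fg by (simp add: zero_of_multiplicity_def)
      hence "zero_of_multiplicity g z (nat (zorder f z))" using fg by (simp add: same_zeros_CM_def)
      thus ?thesis using \<open>zorder f z > 0\<close> by (simp add: zero_of_multiplicity_def)
    qed
    have same': "same_zeros_CM (\<lambda>z. L2 z - h z) (\<lambda>z. L1 z - h z)" using same by (simp add: same_zeros_CM_def)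
    consider "isolated_zero (\<lambda>z. L1 z - h z) z" | "isolated_zero (\<lambda>z. L2 z - h z) z"
      | "\<not> isolated_zero (\<lambda>z. L1 z - h z) z" "\<not> isolated_zero (\<lambda>z. L2 z - h z) z" by blast
    thus ?thesis
    proof cases
      case 1
      thus ?thesis by (rule z[OF fm[OF L(1)] fm[OF L(2)] nz(2) _ same])
    next
      case 2
      thus ?thesis by (rule z[OF fm[OF L(2)] fm[OF L(1)] nz(1) _ same', symmetric])
    next
      case 3
      thus ?thesis
        using not_pole_not_isolated_zero_imp_zorder_eq_0[OF fm[OF L(1)] np[OF L(1)] _ fr[OF nz(1)]]
          not_pole_not_isolated_zero_imp_zorder_eq_0[OF fm[OF L(2)] np[OF L(2)] _ fr[OF nz(2)]] by simp
    qed
  qed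
qed

text \<open>Once the power at \<open>p\<close> is divided out, the quotient has order 0 everywhere;
  with its singularities removed it is entire without zeros and has an entire logarithm.\<close>

lemma quotient_eq_powi_exp:
  assumes f: "f1 meromorphic_on UNIV" "f2 meromorphic_on UNIV"
    and nz: "\<forall>\<^sub>\<approx>z. f1 z \<noteq> 0" "\<forall>\<^sub>\<approx>z. f2 z \<noteq> 0"
    and zo: "\<And>z. z \<noteq> p \<Longrightarrow> zorder f1 z = zorder f2 z"
  shows "\<exists>m g. g holomorphic_on UNIV \<and> (\<forall>\<^sub>\<approx>z. f1 z / f2 z = (z - p) powi m * exp (g z))"
proof -
  define m where "m = zorder f1 p - zorder f2 p"
  define P where "P = (\<lambda>z. (z - p) powi m)"
  have fr: "frequently (\<lambda>w. q w \<noteq> 0) (at z)" if "\<forall>\<^sub>\<approx>z. q z \<noteq> 0" for q :: "complex \<Rightarrow> complex" and z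
    using eventually_cosparse_UNIV_at[OF that] by (intro eventually_frequently) auto
  have "\<forall>\<^sub>\<approx>z. z \<notin> {p}" by (intro eventually_not_in_cosparse) auto
  hence Pnz: "\<forall>\<^sub>\<approx>z. P z \<noteq> 0" by eventually_elim (simp add: P_def)
  have Pm: "P meromorphic_on X" for X unfolding P_def by (intro meromorphic_intros)
  have fX: "f1 meromorphic_on X" "f2 meromorphic_on X" for X using f meromorphic_on_subset by blast+
  define Q where "Q = (\<lambda>z. f2 z * P z)"
  have Qm: "Q meromorphic_on X" for X unfolding Q_def by (intro meromorphic_intros fX Pm)
  have Qnz: "\<forall>\<^sub>\<approx>z. Q z \<noteq> 0" using nz(2) Pnz by eventually_elim (simp add: Q_def)
  define q where "q = (\<lambda>z. f1 z / Q z)"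
  have qm: "q meromorphic_on UNIV" unfolding q_def by (intro meromorphic_intros fX Qm)
  have qz: "zorder q z = 0" for z
  proof -
    have "zorder P z = (if z = p then m else 0)"
      using zorder_prod_linear_powi[of "{p}" "\<lambda>_. m" z] by (simp add: P_def)
    moreover have "zorder Q z = zorder f2 z + zorder P z"
      unfolding Q_def by (rule Meromorphic.zorder_mult[OF fX(2) fr[OF nz(2)] Pm fr[OF Pnz]])
    moreover have "zorder q z = zorder f1 z - zorder Q z"
      unfolding q_def by (rule Meromorphic.zorder_divide[OF fX(1) fr[OF nz(1)] Qm fr[OF Qnz]])
    ultimately show ?thesis using zo[of z] by (auto simp: m_def)
  qed
  define u where "u = remove_sings q"
  have um: "u nicely_meromorphic_on UNIV" unfolding u_def by (rule remove_sings_nicely_meromorphic[OF qm])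
  have uq: "\<forall>\<^sub>\<approx>z. u z = q z" unfolding u_def by (rule eventually_remove_sings_eq[OF qm])
  have unz: "\<forall>\<^sub>\<approx>z. u z \<noteq> 0" using uq nz(1) Qnz by eventually_elim (simp add: q_def)
  have uz: "zorder u z = 0" for z
    using zorder_cong[OF eventually_cosparse_UNIV_at[OF uq] refl] qz by simp
  have "u analytic_on UNIV"
    by (subst analytic_on_analytic_at) (use nicely_meromorphic_zorder_0_imp(1)[OF um unz uz] in auto)
  hence uh: "u holomorphic_on UNIV" by (rule analytic_imp_holomorphic)
  have "\<exists>g. g holomorphic_on UNIV \<and> (\<forall>z. exp (g z) = u z)"
    by (rule holomorphic_logarithm_exists[OF convex_UNIV open_UNIV uh, of 0])
       (use nicely_meromorphic_zorder_0_imp(2)[OF um unz uz] in auto)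
  then obtain g where g: "g holomorphic_on UNIV" "\<And>z. exp (g z) = u z" by blast
  have "\<forall>\<^sub>\<approx>z. f1 z / f2 z = (z - p) powi m * exp (g z)"
    using uq Pnz nz(2) by eventually_elim (simp add: g(2) q_def Q_def P_def)
  thus ?thesis using g(1) by blast
qed

section \<open>The quotient in a sector when g is linear\<close>

text \<open>The logarithm of the modulus is \<open>m ln (norm (z - 1)) + Re a + Re (b z)\<close>. If
  \<open>b \<noteq> 0\<close>, the last term is linear in \<open>norm z\<close> in a suitable
  sector; if \<open>b = 0\<close> and \<open>m \<noteq> 0\<close>, the first term is unbounded;
  otherwise the function is a constant other than 1.\<close>

lemma powi_exp_linear_away_from_1_in_cone:
  assumes not1: "\<not> (\<forall>\<^sub>\<approx>z. (z - 1) powi m * exp (a + b * z) = 1)"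
  shows "\<exists>\<alpha> \<beta> R K. 0 \<le> \<alpha> \<and> \<alpha> < \<beta> \<and> \<beta> \<le> pi / 3 \<and> (\<forall>z. z \<in> cone \<alpha> \<beta> \<longrightarrow> norm z \<ge> R \<longrightarrow>
     (z - 1) powi m * exp (a + b * z) \<noteq> 1 \<and>
     norm (1 / (1 - (z - 1) powi m * exp (a + b * z))) \<le> K \<and>
     norm ((z - 1) powi m * exp (a + b * z) / (1 - (z - 1) powi m * exp (a + b * z))) \<le> K)"
proof -
  define F where "F = (\<lambda>z. (z - 1) powi m * exp (a + b * z))"
  have goal: "\<exists>\<alpha> \<beta> R K. 0 \<le> \<alpha> \<and> \<alpha> < \<beta> \<and> \<beta> \<le> pi / 3 \<and> (\<forall>z. z \<in> cone \<alpha> \<beta> \<longrightarrow> norm z \<ge> R \<longrightarrow>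
     F z \<noteq> 1 \<and> norm (1 / (1 - F z)) \<le> K \<and> norm (F z / (1 - F z)) \<le> K)"
  proof (cases "m = 0 \<and> b = 0")
    case True
    hence F: "F z = exp a" for z by (simp add: F_def)
    have "exp a \<noteq> 1" using not1 True by auto
    thus ?thesis unfolding F
      by (intro exI[of _ 0] exI[of _ "pi / 3"] exI[of _ "max (norm (1 / (1 - exp a))) (norm (exp a / (1 - exp a)))"])
         (use pi_gt_zero in auto)
  next
    case False
    \<comment> \<open>The modulus is then at least 2 or at most 1/2, and in both cases the distance
      of \<open>F z\<close> from 1 is at least 1/2 and at least half of
      \<open>norm (F z)\<close>.\<close>
    have away: "F z \<noteq> 1 \<and> norm (1 / (1 - F z)) \<le> 2 \<and> norm (F z / (1 - F z)) \<le> 2"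
      if "z \<noteq> 1" "\<bar>ln (norm (F z))\<bar> \<ge> ln 2" for z
    proof -
      have Fp: "norm (F z) > 0" using that(1) by (simp add: F_def)
      have "norm (F z) \<ge> 2 \<or> norm (F z) \<le> 1 / 2"
      proof (cases "ln (norm (F z)) \<ge> 0")
        case True
        hence "ln 2 \<le> ln (norm (F z))" using that by simp
        thus ?thesis using Fp by simp
      next
        case False
        hence "ln (norm (F z)) \<le> ln (1 / 2)" using that by (simp add: ln_div)
        thus ?thesis using Fp by (subst (asm) ln_le_cancel_iff) auto
      qed
      moreover have n: "norm (1 - F z) \<ge> \<bar>1 - norm (F z)\<bar>"
        using norm_triangle_ineq3[of 1 "F z"] by simp
      ultimately show ?thesis
      proof (elim disjE)
        assume ge: "norm (F z) \<ge> 2"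
        hence d: "norm (1 - F z) \<ge> norm (F z) - 1" using n by linarith
        have "norm (1 - F z) \<ge> 1" "norm (F z) \<le> 2 * norm (1 - F z)" using d ge by linarith+
        moreover have "F z \<noteq> 1" using ge by auto
        ultimately show ?thesis by (auto simp: norm_divide divide_le_eq)
      next
        assume ge: "norm (F z) \<le> 1 / 2"
        hence d: "norm (1 - F z) \<ge> 1 - norm (F z)" using n by linarith
        have "1 \<le> 2 * norm (1 - F z)" "norm (F z) \<le> 2 * norm (1 - F z)" using d ge by linarith+
        moreover have "F z \<noteq> 1" using ge by auto
        ultimately show ?thesis by (auto simp: norm_divide divide_le_eq)
      qed
    qed
    have lnF: "ln (norm (F z)) = of_int m * ln (norm (z - 1)) + Re a + Re (b * z)" if "z \<noteq> 1" for z
    proof -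
      have "norm (F z) = norm (z - 1) powi m * exp (Re (a + b * z))"
        by (simp add: F_def norm_mult norm_power_int norm_exp_eq_Re)
      thus ?thesis using that by (subst (asm) eq_commute) (simp add: ln_mult ln_powi zero_less_power_int)
    qed
    define u where "u = (\<lambda>t. Re (b * cis t))"
    have "\<exists>\<alpha> \<beta> c. 0 \<le> \<alpha> \<and> \<alpha> < \<beta> \<and> \<beta> \<le> pi / 3 \<and> c \<ge> 0 \<and> (b \<noteq> 0 \<longrightarrow> c > 0) \<and> (\<forall>t\<in>{\<alpha>..\<beta>}. \<bar>u t\<bar> \<ge> c)"
    proof (cases "b = 0")
      case True
      thus ?thesis using pi_gt_zero by (intro exI[of _ 0] exI[of _ "pi / 3"]) auto
    next
      case False
      \<comment> \<open>\<open>Re (b * cis t)\<close> vanishes for only one line of directions when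
        \<open>b \<noteq> 0\<close>, so it cannot vanish at two such angles.\<close>
      have "u (pi / 6) \<noteq> 0 \<or> u (pi / 4) \<noteq> 0"
      proof (rule ccontr)
        assume "\<not> ?thesis"
        hence "Re b * (sqrt 3 / 2) = Im b * (1 / 2)" "Re b * (sqrt 2 / 2) = Im b * (sqrt 2 / 2)"
          by (auto simp: u_def cos_30 sin_30 cos_45 sin_45)
        hence e: "Re b = Im b" "Re b * sqrt 3 = Im b" by auto
        hence "Re b * (sqrt 3 - 1) = 0" by (simp add: algebra_simps)
        moreover have "sqrt 3 \<noteq> (1::real)" by simp
        ultimately have "Re b = 0" by auto
        thus False using e False by (simp add: complex_eq_iff)
      qed
      then obtain t0 where t0: "0 < t0" "t0 < pi / 3" "u t0 \<noteq> 0"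
        using pi_gt_zero by (elim disjE) (auto intro: that[of "pi / 6"] that[of "pi / 4"])
      have "isCont (\<lambda>t. \<bar>u t\<bar>) t0" 
      unfolding u_def by simp
      hence "eventually (\<lambda>t. \<bar>u t\<bar> > \<bar>u t0\<bar> / 2) (at t0)"
        using t0 by (intro order_tendstoD(1)[of _ "\<bar>u t0\<bar>"]) (auto simp: isCont_def)
      then obtain d where d: "d > 0" "\<And>t. t \<noteq> t0 \<Longrightarrow> dist t t0 < d \<Longrightarrow> \<bar>u t\<bar> > \<bar>u t0\<bar> / 2"
        unfolding eventually_at by blast
      define \<beta> where "\<beta> = min (t0 + d / 2) (pi / 3)"
      have "\<forall>t\<in>{t0..\<beta>}. \<bar>u t\<bar> \<ge> \<bar>u t0\<bar> / 2"
      proof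
        fix t assume t: "t \<in> {t0..\<beta>}"
        show "\<bar>u t\<bar> \<ge> \<bar>u t0\<bar> / 2"
        proof (cases "t = t0")
          case False
          have "dist t t0 < d" using t d(1) by (auto simp: dist_real_def \<beta>_def)
          thus ?thesis using d(2)[OF False] by simp
        qed simp
      qed
      moreover have "t0 < \<beta>" using t0 d(1) by (simp add: \<beta>_def)
      moreover have "\<beta> \<le> pi / 3" unfolding \<beta>_def by (rule min.cobounded2)
      moreover have "\<bar>u t0\<bar> / 2 > 0" using t0 by simp
      ultimately show ?thesis using t0(1)
        by (intro exI[of _ t0] exI[of _ \<beta>] exI[of _ "\<bar>u t0\<bar> / 2"]) auto
    qed
    then obtain \<alpha> \<beta> c where ab: "0 \<le> \<alpha>" "\<alpha> < \<beta>" "\<beta> \<le> pi / 3" and c: "c \<ge> 0" "b \<noteq> 0 \<longrightarrow> c > 0"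
      "\<forall>t\<in>{\<alpha>..\<beta>}. \<bar>u t\<bar> \<ge> c" by blast
    have "\<exists>R\<ge>2. \<forall>z. z \<in> cone \<alpha> \<beta> \<longrightarrow> norm z \<ge> R \<longrightarrow> \<bar>ln (norm (F z))\<bar> \<ge> ln 2"
    proof (cases "b = 0")
      case True
      hence m: "m \<noteq> 0" using False by simp
      define R where "R = exp (ln 2 + \<bar>Re a\<bar>) + 2"
      have "\<bar>ln (norm (F z))\<bar> \<ge> ln 2" if z: "norm z \<ge> R" for z
      proof -
        have "norm (z - 1) \<ge> norm z - 1" using norm_triangle_ineq2[of z 1] by simp
        hence z1: "norm (z - 1) \<ge> exp (ln 2 + \<bar>Re a\<bar>)" using z by (simp add: R_def)
        hence "ln (exp (ln 2 + \<bar>Re a\<bar>)) \<le> ln (norm (z - 1))" by (intro ln_mono) auto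
        hence l: "ln 2 + \<bar>Re a\<bar> \<le> ln (norm (z - 1))" by simp
        have "z \<noteq> 1" using z1 by auto
        have "1 * (ln 2 + \<bar>Re a\<bar>) \<le> \<bar>of_int m\<bar> * ln (norm (z - 1))"
          using m l by (intro mult_mono) auto
        also have "\<dots> = \<bar>of_int m * ln (norm (z - 1))\<bar>"
        proof -
          have "0 < ln 2 + \<bar>Re a\<bar>" by (intro add_pos_nonneg) auto
          thus ?thesis using l by (simp add: abs_mult)
        qed
        finally show ?thesis using lnF[OF \<open>z \<noteq> 1\<close>] True by simp
      qed
      thus ?thesis by (intro exI[of _ R]) (auto simp: R_def)
    next
      case False
      have cpos: "c > 0" using c False by simp
      define M where "M = \<bar>of_int m\<bar> * (2::real)"
      define D where "D = \<bar>Re a\<bar> + ln 2"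
      \<comment> \<open>The square gives \<open>M * sqrt r \<le> c * r / 2\<close>, where
        \<open>M\<close> stems from \<open>\<bar>ln (norm (z - 1))\<bar> \<le> 2 * sqrt r\<close>;
        the last summand gives \<open>D \<le> c * r / 2\<close>. Of the main term
        \<open>c * r\<close> there remains at least \<open>D\<close>, that is \<open>ln 2\<close>
        after subtracting \<open>\<bar>Re a\<bar>\<close>.\<close>
      define R where "R = 2 + (2 * (M / c + 1))\<^sup>2 + 2 * D / c"
      have "\<bar>ln (norm (F z))\<bar> \<ge> ln 2" if z: "z \<in> cone \<alpha> \<beta>" "norm z \<ge> R" for z
      proof -
        obtain r t where rt: "z = of_real r * cis t" "r \<ge> 0" "t \<in> {\<alpha>..\<beta>}" using z by (auto simp: cone_def)
        have nr: "norm z = r" using rt by (simp add: norm_mult)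
        have M0: "M \<ge> 0" by (simp add: M_def)
        have D0: "D \<ge> 0" by (simp add: D_def)
        have r2: "r \<ge> 2" "r \<ge> (2 * (M / c + 1))\<^sup>2" "r \<ge> 2 * D / c"
          using z nr D0 cpos unfolding R_def by (auto intro: add_increasing add_increasing2 order_trans[rotated])
        have "z \<noteq> 1" using nr r2 by auto
        have ub: "\<bar>Re (b * z)\<bar> \<ge> c * r"
        proof -
          have "Re (b * z) = r * u t" by (simp add: rt(1) u_def algebra_simps)
          moreover have "c * r \<le> \<bar>u t\<bar> * r" using c(3) rt by (intro mult_right_mono) auto
          ultimately show ?thesis using rt(2) by (simp add: abs_mult mult.commute)
        qed
        have lz: "\<bar>ln (norm (z - 1))\<bar> \<le> 2 * sqrt r"
        proof -
          have "norm (z - 1) \<le> r + 1" using norm_triangle_ineq4[of z 1] nr by simp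
          hence up: "norm (z - 1) \<le> r * r" using r2 mult_mono[of 2 r 1 r] mult_right_mono[of 2 r r] by linarith
          have lo: "norm (z - 1) \<ge> 1" using norm_triangle_ineq2[of z 1] nr r2 by simp
          have "ln (norm (z - 1)) \<le> ln (r * r)" using up lo by (intro ln_mono) auto
          also have "\<dots> = 4 * ln (sqrt r)" using r2 by (simp add: ln_mult ln_sqrt)
          finally have "ln (norm (z - 1)) \<le> 4 * ln (sqrt r)" .
          moreover have "ln (sqrt r) \<le> sqrt r / 2"
          proof -
            have "ln (sqrt r / 2) \<le> sqrt r / 2 - 1" using r2 by (intro ln_le_minus_one) auto
            hence "ln (sqrt r) \<le> sqrt r / 2 - 1 + ln 2" using r2 by (simp add: ln_div)
            moreover have "ln 2 \<le> (1::real)" using ln_le_minus_one[of 2] by simp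
            ultimately show ?thesis by linarith
          qed
          moreover have "ln (norm (z - 1)) \<ge> 0" using lo by simp
          ultimately show ?thesis by linarith
        qed
        have "\<bar>of_int m * ln (norm (z - 1))\<bar> \<le> \<bar>of_int m\<bar> * (2 * sqrt r)"
          unfolding abs_mult using lz by (intro mult_left_mono) auto
        also have "\<dots> = M * sqrt r" by (simp add: M_def)
        also have "\<dots> \<le> c * r / 2"
        proof -
          have "2 * (M / c + 1) \<le> sqrt r" using r2 by (intro real_le_rsqrt) auto
          hence "M \<le> c * sqrt r / 2" using cpos by (simp add: field_simps)
          hence "M * sqrt r \<le> c * sqrt r / 2 * sqrt r" using r2 by (intro mult_right_mono) auto
          also have "\<dots> = c / 2 * (sqrt r * sqrt r)" by (simp only: times_divide_eq_left mult.assoc)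
          also have "sqrt r * sqrt r = r" using r2 by simp
          finally show ?thesis by simp
        qed
        finally have 1: "\<bar>of_int m * ln (norm (z - 1))\<bar> \<le> c * r / 2" .
        have "D \<le> c * r / 2" using r2(3) cpos by (simp add: field_simps)
        thus ?thesis using 1 ub lnF[OF \<open>z \<noteq> 1\<close>] unfolding D_def by linarith
      qed
      moreover have "R \<ge> 2"
      proof -
        have "0 \<le> D" unfolding D_def by (intro add_nonneg_nonneg) auto
        hence "0 \<le> 2 * D / c" using cpos by simp
        thus ?thesis unfolding R_def by simp
      qed
      ultimately show ?thesis by blast
    qed
    then obtain R where R: "R \<ge> 2" "\<And>z. z \<in> cone \<alpha> \<beta> \<Longrightarrow> norm z \<ge> R \<Longrightarrow> \<bar>ln (norm (F z))\<bar> \<ge> ln 2" by blast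
    have "F z \<noteq> 1 \<and> norm (1 / (1 - F z)) \<le> 2 \<and> norm (F z / (1 - F z)) \<le> 2"
      if "z \<in> cone \<alpha> \<beta>" "norm z \<ge> R" for z
      by (rule away) (use R that in auto)
    thus ?thesis
      by (intro exI[of _ \<alpha>] exI[of _ \<beta>] exI[of _ R] exI[of _ 2] conjI allI impI ab) simp_all
  qed
  thus ?thesis unfolding F_def .
qed

section \<open>The contradiction from two distinct L-functions\<close>

theorem theorem4:
  fixes h L1 L2 :: "complex \<Rightarrow> complex" and d1 d2 :: real
  assumes "transcendental_meromorphic h"
    and "\<exists>z. is_pole h z"
    and "nev_order h \<notin> {ereal (real n) | n. n \<ge> 1} \<union> {\<infinity>}"
    and "L1 \<in> extended_selberg_class" and "has_degree L1 d1" and "d1 > 0"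
    and "L2 \<in> extended_selberg_class" and "has_degree L2 d2" and "d2 > 0"
    and "same_zeros_CM (\<lambda>z. L1 z - h z) (\<lambda>z. L2 z - h z)"
  shows "L1 = L2"
proof (rule ccontr)
  assume ne: "L1 \<noteq> L2"
  have h: "h meromorphic_on UNIV" and notrat: "\<not> rational_function h"
    using assms(1) by (auto simp: transcendental_meromorphic_def)
  note L = assms(4,7) and same = assms(10)
  have Lm: "L1 meromorphic_on UNIV" "L2 meromorphic_on UNIV" using L extended_selberg_classD(1) by blast+
  have nicely: "L1 nicely_meromorphic_on UNIV" "L2 nicely_meromorphic_on UNIV"
    using L by (simp_all add: extended_selberg_class_def)
  have LT: "nev_growth L1 \<mu>" "nev_growth L2 \<mu>" if "\<mu> > 1" for \<mu>
    using L that by (simp_all add: nev_growth_extended_selberg_class)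
  have h1: "\<forall>\<^sub>\<approx>z. h z \<noteq> 1"
  proof -
    have "\<not> (\<forall>\<^sub>\<approx>z. h z = 1)"
    proof
      assume "\<forall>\<^sub>\<approx>z. h z = 1"
      hence "rational_function h" unfolding rational_function_def
        by (intro exI[of _ 1] conjI) simp_all
      thus False using notrat by simp
    qed
    thus ?thesis using meromorphic_imp_constant_or_avoid[OF h open_UNIV connected_UNIV, of 1] by blast
  qed
  have order_ne_1: "nev_order h \<noteq> 1"
  proof
    assume "nev_order h = 1"
    hence "nev_order h = ereal (real 1) \<and> (1::nat) \<ge> 1" by (simp add: one_ereal_def)
    hence "nev_order h \<in> {ereal (real n) | n. n \<ge> 1}" by (intro CollectI exI)
    thus False using assms(3) by (meson UnI1)
  qed
  \<comment> \<open>The sector bound forces order at least 1, and order exactly 1 is excluded. Both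
    remaining uses need only produce such a bound.\<close>
  have not_cone: "\<not> (\<forall>\<^sub>\<approx>z. z \<in> cone \<alpha> \<beta> \<longrightarrow> norm z \<ge> R \<longrightarrow> norm (h z - 1) \<le> K * (norm (L1 z - 1) + norm (L2 z - 1)))"
    if "nev_order h \<le> 1" "0 \<le> \<alpha>" "\<alpha> < \<beta>" "\<beta> \<le> pi / 3" for \<alpha> \<beta> R K
  proof
    assume "\<forall>\<^sub>\<approx>z. z \<in> cone \<alpha> \<beta> \<longrightarrow> norm z \<ge> R \<longrightarrow> norm (h z - 1) \<le> K * (norm (L1 z - 1) + norm (L2 z - 1))"
    from antisym[OF that(1) nev_order_ge_1_of_cone_bound[OF h L h1 that(2-4) this]]
    show False using order_ne_1 by contradiction
  qed
  \<comment> \<open>If \<open>h\<close> agreed with \<open>L\<close>, its order would be at most 1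
    and the sector bound would hold trivially, because \<open>h - 1\<close> is \<open>L - 1\<close>
    off a sparse set.\<close>
  have Lh: "\<forall>\<^sub>\<approx>z. L z - h z \<noteq> 0" if LL: "L \<in> {L1, L2}" for L
  proof -
    have "\<not> (\<forall>\<^sub>\<approx>z. L z - h z = 0)"
    proof
      assume ev: "\<forall>\<^sub>\<approx>z. L z - h z = 0"
      have "nev_order h \<le> 1"
      proof (rule ereal_le_epsilon2)
        fix e :: real assume e: "e > 0"
        have eq: "\<forall>\<^sub>\<approx>z. L z = h z" using ev by eventually_elim simp
        have "nev_growth L (1 + e)" using LL LT e by auto
        from nev_order_le_of_growth[OF nev_growth_cong[OF eq this]] e
        show "nev_order h \<le> 1 + ereal e" by (simp add: one_ereal_def)
      qed
      moreover have "\<forall>\<^sub>\<approx>z. z \<in> cone 0 (pi / 3) \<longrightarrow> norm z \<ge> 0 \<longrightarrow> norm (h z - 1) \<le> 1 * (norm (L1 z - 1) + norm (L2 z - 1))"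
        using ev by eventually_elim (use LL in auto)
      ultimately show False using not_cone[of 0 "pi / 3" 0 1] by simp
    qed
    moreover have "(\<lambda>z. L z - h z) meromorphic_on UNIV" using Lm LL h by (auto intro: meromorphic_intros)
    ultimately show ?thesis using meromorphic_eventually_zero_or_nonzero by blast
  qed
  define f1 where "f1 = (\<lambda>z. L1 z - h z)"
  define f2 where "f2 = (\<lambda>z. L2 z - h z)"
  have fm: "f1 meromorphic_on UNIV" "f2 meromorphic_on UNIV"
    unfolding f1_def f2_def by (intro meromorphic_intros Lm h)+
  have fnz: "\<forall>\<^sub>\<approx>z. f1 z \<noteq> 0" "\<forall>\<^sub>\<approx>z. f2 z \<noteq> 0" unfolding f1_def f2_def using Lh by auto
  have "zorder f1 z = zorder f2 z" if z: "z \<noteq> 1" for z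
    unfolding f1_def f2_def
  proof (rule zorder_diff_eq_of_same_zeros_CM[OF _ _ _ _ _ _ _ same])
    show "L1 analytic_on {z}" "L2 analytic_on {z}" using extended_selberg_classD(2) L z by auto
    show "eventually (\<lambda>w. L1 w \<noteq> 0) (at z)" "eventually (\<lambda>w. L2 w \<noteq> 0) (at z)"
      using extended_selberg_class_nonzero L eventually_cosparse_UNIV_at by auto
    show "h meromorphic_on {z}" using h meromorphic_on_subset by blast
    show "eventually (\<lambda>w. L1 w - h w \<noteq> 0) (at z)" "eventually (\<lambda>w. L2 w - h w \<noteq> 0) (at z)"
      using fnz eventually_cosparse_UNIV_at unfolding f1_def f2_def by auto
  qed
  hence "\<exists>m g. g holomorphic_on UNIV \<and> (\<forall>\<^sub>\<approx>z. f1 z / f2 z = (z - 1) powi m * exp (g z))"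
    by (rule quotient_eq_powi_exp[OF fm fnz])
  then
  obtain m g where g: "g holomorphic_on UNIV" "\<forall>\<^sub>\<approx>z. f1 z / f2 z = (z - 1) powi m * exp (g z)"
    by blast
  define E where "E = (\<lambda>z. exp (g z))"
  define F where "F = (\<lambda>z. (z - 1) powi m * E z)"
  have Em: "E meromorphic_on UNIV" unfolding E_def
    using g(1) by (intro analytic_on_imp_meromorphic_on analytic_intros) (simp add: analytic_on_open)
  have Pm: "(\<lambda>z. (z - 1) powi k) meromorphic_on UNIV" for k by (intro meromorphic_intros)
  have Fm: "F meromorphic_on UNIV" unfolding F_def by (intro meromorphic_on_mult Em Pm)
  have F1m: "(\<lambda>z. 1 - F z) meromorphic_on UNIV" by (intro meromorphic_intros Fm)
  have ff: "\<forall>\<^sub>\<approx>z. f1 z = F z * f2 z"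
    using g(2) fnz(2) by eventually_elim (simp add: F_def E_def divide_eq_eq)
  have Fne: "\<not> (\<forall>\<^sub>\<approx>z. F z = 1)"
  proof
    assume "\<forall>\<^sub>\<approx>z. F z = 1"
    with ff have "\<forall>\<^sub>\<approx>z. L1 z = L2 z" by eventually_elim (simp add: f1_def f2_def)
    thus False using nicely_meromorphic_cosparse_eq[OF nicely] ne by simp
  qed
  have F1nz: "\<forall>\<^sub>\<approx>z. 1 - F z \<noteq> 0"
    using meromorphic_eventually_zero_or_nonzero[OF F1m]
  proof
    assume "\<forall>\<^sub>\<approx>z. 1 - F z = 0"
    hence "\<forall>\<^sub>\<approx>z. F z = 1" by eventually_elim simp
    thus ?thesis using Fne by contradiction
  qed
  \<comment> \<open>\<open>E\<close> is the quotient \<open>f1 / f2\<close> divided by the power of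
    \<open>z - 1\<close>. The exponent has to exceed 1 because of the L-functions and of that
    power.\<close>
  have ET: "nev_growth E \<mu>" if \<mu>: "\<mu> > 1" "nev_growth h \<mu>" for \<mu>
  proof -
    have "nev_growth f1 \<mu>" "nev_growth f2 \<mu>"
      unfolding f1_def f2_def using \<mu> LT by (auto intro!: nev_growth_diff Lm h)
    hence "nev_growth (\<lambda>z. f1 z / f2 z) \<mu>" using \<mu> by (intro nev_growth_divide fm fnz) auto
    hence "nev_growth (\<lambda>z. (f1 z / f2 z) * (z - 1) powi (- m)) \<mu>"
      using \<mu> by (intro nev_growth_mult nev_growth_linear_powi Pm) (auto intro!: meromorphic_intros fm)
    moreover have "\<forall>\<^sub>\<approx>z::complex. z \<notin> {1}" by (intro eventually_not_in_cosparse) auto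
    with g(2) have "\<forall>\<^sub>\<approx>z. (f1 z / f2 z) * (z - 1) powi (- m) = E z"
      by eventually_elim (simp add: E_def power_int_minus)
    ultimately show ?thesis by (rule nev_growth_cong[rotated])
  qed
  have coeff0: "(deriv ^^ n) g 0 = 0" if "nev_growth h \<mu>" "\<mu> > 1" "real n > \<mu>" for n \<mu>
    by (rule coeff_eq_0_of_nev_growth[OF g(1), of \<mu>]) (use ET[OF that(2,1)] that in \<open>auto simp: E_def\<close>)
  have finite_order: "nev_order h \<noteq> \<infinity>" using assms(3) by auto
  consider "nev_order h > 1" | "nev_order h < 1" using order_ne_1 by (rule linorder_neqE)
  thus False
  proof cases
    case 1
    then obtain \<rho> where \<rho>: "nev_order h = ereal \<rho>" "\<rho> > 1"
      using finite_order by (cases "nev_order h") (auto simp: one_ereal_def)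
    define N where "N = nat \<lfloor>\<rho>\<rfloor>"
    have N: "N \<ge> 1" "real N \<le> \<rho>" "\<rho> < real N + 1" using \<rho>(2) unfolding N_def by linarith+
    have "\<rho> \<noteq> real N" using assms(3) N(1) \<rho>(1) by auto
    hence N': "real N < \<rho>" using N by simp
    have z: "(deriv ^^ n) g 0 = 0" if "n \<ge> Suc N" for n
    proof -
      have "\<rho> < real n" using N that by simp
      then obtain l where l: "\<rho> < l" "l < real n" using dense by blast
      have "nev_growth h l" using l \<rho> by (intro nev_growth_order_less) simp
      thus ?thesis by (rule coeff0) (use l \<rho> in auto)
    qed
    \<comment> \<open>An exponent strictly below \<rho> that covers the degree bound
      \<open>N\<close> and still exceeds 1, which matters when \<open>N = 1\<close>.\<close>
    define \<nu> where "\<nu> = max (real N) ((1 + \<rho>) / 2)"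
    have \<nu>: "\<nu> > 1" "\<nu> \<ge> real N" "\<nu> < \<rho>" using N N' \<rho>(2) unfolding \<nu>_def less_max_iff_disj by auto
    have "nev_growth E \<nu>"
    proof (rule nev_growthI[of _ 1 _ "\<Sum>n<Suc N. norm ((deriv ^^ n) g 0 / fact n)" 0])
      fix r :: real assume r: "r \<ge> 1"
      define C where "C = (\<Sum>n<Suc N. norm ((deriv ^^ n) g 0 / fact n))"
      have C: "C \<ge> 0" unfolding C_def by (intro sum_nonneg) auto
      have "E analytic_on UNIV" unfolding E_def using g(1) by (intro analytic_intros) (simp add: analytic_on_open)
      hence "nev_T r E = nev_m r E" by (rule nev_T_analytic)
      also have "\<dots> \<le> C * r powr \<nu>"
      proof (rule nev_m_le[OF _ Em])
        fix w :: complex assume w: "norm w = r"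
        have "norm (g w) \<le> (\<Sum>n<Suc N. norm ((deriv ^^ n) g 0 / fact n) * r ^ n)"
        proof -
          have "g w = (\<Sum>n<Suc N. (deriv ^^ n) g 0 / fact n * w ^ n)"
            by (rule entire_eq_polynomial[OF g(1) z])
          also have "norm \<dots> \<le> (\<Sum>n<Suc N. norm ((deriv ^^ n) g 0 / fact n) * r ^ n)"
            by (rule sum_norm_le) (simp only: norm_mult norm_power w order_refl)
          finally show ?thesis .
        qed
        also have "\<dots> \<le> (\<Sum>n<Suc N. norm ((deriv ^^ n) g 0 / fact n) * r powr \<nu>)"
        proof (intro sum_mono mult_left_mono)
          fix n assume "n \<in> {..<Suc N}"
          hence "real n \<le> \<nu>" using \<nu>(2) by auto
          thus "r ^ n \<le> r powr \<nu>" using r powr_mono[of "real n" \<nu> r] by (simp add: powr_realpow)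
        qed auto
        also have "\<dots> = C * r powr \<nu>" unfolding C_def by (rule sum_distrib_right[symmetric])
        finally have "Re (g w) \<le> C * r powr \<nu>" using complex_Re_le_cmod[of "g w"] by linarith
        thus "log_plus (norm (E w)) \<le> C * r powr \<nu>"
          using C by (subst log_plus_le_iff) (auto simp: E_def norm_exp_eq_Re)
      qed (use r in auto)
      finally show "nev_T r E \<le> (\<Sum>n<Suc N. norm ((deriv ^^ n) g 0 / fact n)) * r powr \<nu> + 0" by (simp add: C_def)
    qed (use \<nu> in auto)
    hence FT: "nev_growth F \<nu>" unfolding F_def using \<nu> by (intro nev_growth_mult nev_growth_linear_powi Pm Em) auto
    have "nev_growth (\<lambda>z. (L1 z - F z * L2 z) / (1 - F z)) \<nu>"
      using \<nu> FT LT[of \<nu>]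
      by (intro nev_growth_divide nev_growth_diff nev_growth_mult nev_growth_const F1nz Lm Fm)
         (auto intro!: meromorphic_intros Lm Fm)
    moreover have "\<forall>\<^sub>\<approx>z. (L1 z - F z * L2 z) / (1 - F z) = h z"
      using ff F1nz by eventually_elim (simp add: f1_def f2_def field_simps)
    ultimately have "nev_growth h \<nu>" by (rule nev_growth_cong[rotated])
    hence "nev_order h \<le> ereal \<nu>" by (rule nev_order_le_of_growth) (use \<nu> in auto)
    thus False using \<rho> \<nu> by simp
  next
    case 2
    \<comment> \<open>Any exponent strictly between 1 and 2 would do: above 1 for the L-functions,
      below 2 so that all coefficients of \<open>g\<close> from the second on vanish.\<close>
    have "nev_growth h (3 / 2)"
      using less_trans[OF 2, of "ereal (3 / 2)"] by (intro nev_growth_order_less) (simp add: one_ereal_def)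
    hence z: "(deriv ^^ n) g 0 = 0" if "n \<ge> 2" for n by (rule coeff0) (use that in auto)
    define a where "a = g 0"
    define b where "b = deriv g 0"
    have glin: "g w = a + b * w" for w
      using entire_eq_polynomial[OF g(1) z, where w = w] by (simp add: a_def b_def numeral_2_eq_2)
    have Flin: "F w = (w - 1) powi m * exp (a + b * w)" for w by (simp add: F_def E_def glin)
    obtain \<alpha> \<beta> R K where ab: "0 \<le> \<alpha>" "\<alpha> < \<beta>" "\<beta> \<le> pi / 3"
      and FK: "\<And>z. z \<in> cone \<alpha> \<beta> \<Longrightarrow> norm z \<ge> R \<Longrightarrow> F z \<noteq> 1 \<and> norm (1 / (1 - F z)) \<le> K \<and> norm (F z / (1 - F z)) \<le> K"
      using powi_exp_linear_away_from_1_in_cone[OF Fne[unfolded Flin]] unfolding Flin by blast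
    have "\<forall>\<^sub>\<approx>z. z \<in> cone \<alpha> \<beta> \<longrightarrow> norm z \<ge> R \<longrightarrow> norm (h z - 1) \<le> K * (norm (L1 z - 1) + norm (L2 z - 1))"
      using ff
    proof eventually_elim
      case (elim z)
      show ?case
      proof (intro impI)
        assume "z \<in> cone \<alpha> \<beta>" "norm z \<ge> R"
        note FK = FK[OF this]
        have "(1 - F z) * (h z - 1) = (L1 z - 1) - F z * (L2 z - 1)"
          using elim by (simp add: f1_def f2_def algebra_simps)
        moreover have "1 - F z \<noteq> 0" using FK by simp
        ultimately have "h z - 1 = ((L1 z - 1) - F z * (L2 z - 1)) / (1 - F z)"
          by (metis nonzero_mult_div_cancel_left)
        also have "\<dots> = 1 / (1 - F z) * (L1 z - 1) - F z / (1 - F z) * (L2 z - 1)"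
          by (simp add: diff_divide_distrib)
        finally have "h z - 1 = \<dots>" .
        hence "norm (h z - 1) \<le> norm (1 / (1 - F z)) * norm (L1 z - 1) + norm (F z / (1 - F z)) * norm (L2 z - 1)"
          using norm_triangle_ineq4[of "1 / (1 - F z) * (L1 z - 1)" "F z / (1 - F z) * (L2 z - 1)"]
          by (simp only: norm_mult)
        also have "\<dots> \<le> K * norm (L1 z - 1) + K * norm (L2 z - 1)"
          using FK by (intro add_mono mult_right_mono) auto
        finally show "norm (h z - 1) \<le> K * (norm (L1 z - 1) + norm (L2 z - 1))" by (simp add: algebra_simps)
      qed
    qed
    thus False using not_cone[OF _ ab] 2 by auto
  qed
qed

end
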